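(* Let $1<p,q<\infty$ and let $n=cd(\ell_p,\ell_q)$. Then: (a) $\mathcal P_w(^n\ell_p,\ell_q)$ is an $M$-ideal in $\mathcal P(^n\ell_p,\ell_q)$. (b) $\mathcal P_w(^k\ell_p,\ell_q)$ is not a semi $M$-ideal in $\mathcal P(^k\ell_p,\ell_q)$, for all $k>n$.
   Context: $\mathcal P(^nE,F)$ is the Banach space of continuous $n$-homogeneous polynomials $P:E\to F$ with norm $\|P\|=\sup_{\|x\|\le1}\|P(x)\|$. $\mathcal P_w(^nE,F)$ is the subspace of polynomials that are weakly continuous on bounded sets: $\|P(x_\alpha)-P(x)\|\to0$ for every bounded net $(x_\alpha)$ converging weakly to $x\in E$. The critical degree $cd(E,F)$ is the smallest $k\ge1$ such that $\mathcal P_w(^kE,F)\ne\mathcal P(^kE,F)$ (it exists for the pair $(\ell_p,\ell_q)$, and is the integer with $\frac pq\le cd(\ell_p,\ell_q)<\frac pq+1$). A closed subspace $J$ of a Banach space $X$ is an $M$-ideal if there is a linear projection $\pi$ on $X^*$ with kernel $J^\perp$ such that $\|x^*\|=\|\pi(x^* )\|+\|x^*-\pi(x^* )\|$ for all $x^*\in X^*$. $J$ is a semi $M$-ideal if it satisfies the 2-ball property: for all $x_1,x_2\in X$ and $r_1,r_2>0$ with $B(x_1,r_1)\cap B(x_2,r_2)\ne\emptyset$ and $B(x_j,r_j)\cap J\neq\emptyset$ ($j=1,2$), one has $B(x_1,r_1+\varepsilon)\cap B(x_2,r_2+\varepsilon)\cap J\neq\emptyset$ for all $\varepsilon>0$,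 where $B(x,r)$ is the closed ball. *)

theory Defs
  imports "HOL-Analysis.Analysis" "HOL-Library.Function_Algebras"
begin

text \<open>
  The exponents of the spaces \<open>\<ell>\<^sub>p\<close> are arbitrary real numbers, so these spaces cannot be types.
  A normed space over the scalar field \<open>'k\<close> is therefore a carrier set inside an additive group
  \<open>'v\<close>, with its scalar multiplication and its norm. Addition is the one of \<open>'v\<close>; for all spaces
  below \<open>'v\<close> is a type of functions, and addition is pointwise.
\<close>

record ('k, 'v) nspace =
  vecs :: "'v set"
  scal :: "'k \<Rightarrow> 'v \<Rightarrow> 'v"
  nrm :: "'v \<Rightarrow> real"

definition ell :: "real \<Rightarrow> ('k::real_normed_field, nat \<Rightarrow> 'k) nspace" where
  "ell p = \<lparr>vecs = {x. summable (\<lambda>i. norm (x i) powr p)},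
            scal = (\<lambda>c x i. c * x i),
            nrm = (\<lambda>x. (\<Sum>i. norm (x i) powr p) powr (1 / p))\<rparr>"

text \<open>
  A map defined on a space is represented by its extension by \<open>0\<close> outside the carrier. So equality
  of maps is equality on the carrier, and pointwise operations preserve this representation.
\<close>

definition dual ::
    "('k::real_normed_field, 'v::ab_group_add) nspace \<Rightarrow> ('k, 'v \<Rightarrow> 'k) nspace" where
  "dual X = \<lparr>vecs = {f. (\<forall>x\<in>vecs X. \<forall>y\<in>vecs X. f (x + y) = f x + f y)
                      \<and> (\<forall>c. \<forall>x\<in>vecs X. f (scal X c x) = c * f x)
                      \<and> (\<exists>C. \<forall>x\<in>vecs X. norm (f x) \<le> C * nrm X x)
                      \<and> (\<forall>x. x \<notin> vecs X \<longrightarrow> f x = 0)},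
             scal = (\<lambda>c f x. c * f x),
             nrm = (\<lambda>f. SUP x\<in>{x \<in> vecs X. nrm X x \<le> 1}. norm (f x))\<rparr>"

text \<open>An \<open>n\<close>-linear map takes the list of its \<open>n\<close> arguments.\<close>

definition multilinear ::
    "nat \<Rightarrow> ('k, 'v::ab_group_add) nspace \<Rightarrow> ('k, 'w::ab_group_add) nspace \<Rightarrow> ('v list \<Rightarrow> 'w) \<Rightarrow> bool"
  where
  "multilinear n E F A \<longleftrightarrow>
     (\<forall>xs. length xs = n \<and> set xs \<subseteq> vecs E \<longrightarrow>
        A xs \<in> vecs F \<and>
        (\<forall>i<n. (\<forall>u\<in>vecs E. \<forall>v\<in>vecs E. A (xs[i := u + v]) = A (xs[i := u]) + A (xs[i := v])) \<and>
               (\<forall>c. \<forall>u\<in>vecs E. A (xs[i := scal E c u]) = scal F c (A (xs[i := u])))))"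

definition homogeneous_polynomial ::
    "nat \<Rightarrow> ('k, 'v::ab_group_add) nspace \<Rightarrow> ('k, 'w::ab_group_add) nspace \<Rightarrow> ('v \<Rightarrow> 'w) \<Rightarrow> bool"
  where
  "homogeneous_polynomial n E F P \<longleftrightarrow>
     (\<exists>A. multilinear n E F A \<and> (\<forall>x\<in>vecs E. P x = A (replicate n x)))"

definition norm_continuous ::
    "('k, 'v::ab_group_add) nspace \<Rightarrow> ('k, 'w::ab_group_add) nspace \<Rightarrow> ('v \<Rightarrow> 'w) \<Rightarrow> bool"
  where
  "norm_continuous E F P \<longleftrightarrow>
     (\<forall>x\<in>vecs E. \<forall>\<epsilon>>0. \<exists>\<delta>>0. \<forall>y\<in>vecs E. nrm E (y - x) < \<delta> \<longrightarrow> nrm F (P y - P x) < \<epsilon>)"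

definition poly_space ::
    "nat \<Rightarrow> ('k, 'v::ab_group_add) nspace \<Rightarrow> ('k, 'w::ab_group_add) nspace \<Rightarrow> ('k, 'v \<Rightarrow> 'w) nspace"
  where
  "poly_space n E F =
     \<lparr>vecs = {P. homogeneous_polynomial n E F P \<and> norm_continuous E F P
               \<and> (\<forall>x. x \<notin> vecs E \<longrightarrow> P x = 0)},
      scal = (\<lambda>c P x. scal F c (P x)),
      nrm = (\<lambda>P. SUP x\<in>{x \<in> vecs E. nrm E x \<le> 1}. nrm F (P x))\<rparr>"

text \<open>
  Nets are rendered by filters: a net in \<open>E\<close> induces the filter \<open>G\<close> on \<open>E\<close> generated by its tails,
  every proper filter on \<open>E\<close> arises in this way, and convergence along the net (of the net, or of
  its image under a map) is convergence along \<open>G\<close>.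
\<close>

definition weakly_converges ::
    "('k::real_normed_field, 'v::ab_group_add) nspace \<Rightarrow> 'v filter \<Rightarrow> 'v \<Rightarrow> bool" where
  "weakly_converges E G x \<longleftrightarrow> (\<forall>f\<in>vecs (dual E). (f \<longlongrightarrow> f x) G)"

definition weakly_continuous_on_bounded ::
    "('k::real_normed_field, 'v::ab_group_add) nspace \<Rightarrow> ('k, 'w::ab_group_add) nspace
       \<Rightarrow> ('v \<Rightarrow> 'w) \<Rightarrow> bool" where
  "weakly_continuous_on_bounded E F P \<longleftrightarrow>
     (\<forall>G M. \<forall>x\<in>vecs E.
        (\<forall>\<^sub>F y in G. y \<in> vecs E \<and> nrm E y \<le> M) \<and> weakly_converges E G x \<longrightarrow>
        ((\<lambda>y. nrm F (P y - P x)) \<longlongrightarrow> 0) G)"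

definition polys_w ::
    "nat \<Rightarrow> ('k::real_normed_field, 'v::ab_group_add) nspace \<Rightarrow> ('k, 'w::ab_group_add) nspace
       \<Rightarrow> ('v \<Rightarrow> 'w) set" where
  "polys_w n E F = {P \<in> vecs (poly_space n E F). weakly_continuous_on_bounded E F P}"

definition critical_degree ::
    "('k::real_normed_field, 'v::ab_group_add) nspace \<Rightarrow> ('k, 'w::ab_group_add) nspace \<Rightarrow> nat"
  where
  "critical_degree E F = (LEAST k. 1 \<le> k \<and> polys_w k E F \<noteq> vecs (poly_space k E F))"

definition closed_subspace :: "'v::ab_group_add set \<Rightarrow> ('k, 'v) nspace \<Rightarrow> bool" where
  "closed_subspace J X \<longleftrightarrow>
     J \<subseteq> vecs X \<and> 0 \<in> J \<and> (\<forall>x\<in>J. \<forall>y\<in>J. x + y \<in> J) \<and> (\<forall>c. \<forall>x\<in>J. scal X c x \<in> J) \<and>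
     (\<forall>x\<in>vecs X. (\<forall>\<epsilon>>0. \<exists>y\<in>J. nrm X (y - x) < \<epsilon>) \<longrightarrow> x \<in> J)"

definition annihilator ::
    "'v::ab_group_add set \<Rightarrow> ('k::real_normed_field, 'v) nspace \<Rightarrow> ('v \<Rightarrow> 'k) set" where
  "annihilator J X = {f \<in> vecs (dual X). \<forall>x\<in>J. f x = 0}"

definition linear_projection_on :: "('k, 'v::ab_group_add) nspace \<Rightarrow> ('v \<Rightarrow> 'v) \<Rightarrow> bool" where
  "linear_projection_on X \<pi> \<longleftrightarrow>
     (\<forall>x\<in>vecs X. \<pi> x \<in> vecs X \<and> \<pi> (\<pi> x) = \<pi> x) \<and>
     (\<forall>x\<in>vecs X. \<forall>y\<in>vecs X. \<pi> (x + y) = \<pi> x + \<pi> y) \<and>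
     (\<forall>c. \<forall>x\<in>vecs X. \<pi> (scal X c x) = scal X c (\<pi> x))"

definition M_ideal ::
    "'v::ab_group_add set \<Rightarrow> ('k::real_normed_field, 'v) nspace \<Rightarrow> bool" where
  "M_ideal J X \<longleftrightarrow>
     closed_subspace J X \<and>
     (\<exists>\<pi>. linear_projection_on (dual X) \<pi> \<and>
          {f \<in> vecs (dual X). \<pi> f = 0} = annihilator J X \<and>
          (\<forall>f\<in>vecs (dual X). nrm (dual X) f = nrm (dual X) (\<pi> f) + nrm (dual X) (f - \<pi> f)))"

definition closed_ball :: "('k, 'v::ab_group_add) nspace \<Rightarrow> 'v \<Rightarrow> real \<Rightarrow> 'v set" where
  "closed_ball X x r = {y \<in> vecs X. nrm X (y - x) \<le> r}"

text \<open>
  Only the 2-ball property is stated, for a \<open>J\<close> that is understood to be a closed subspace of \<open>X\<close>: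
  then the negation really says that the 2-ball property fails.
\<close>

definition semi_M_ideal :: "'v::ab_group_add set \<Rightarrow> ('k, 'v) nspace \<Rightarrow> bool" where
  "semi_M_ideal J X \<longleftrightarrow>
     (\<forall>x1\<in>vecs X. \<forall>x2\<in>vecs X. \<forall>r1>0. \<forall>r2>0.
        closed_ball X x1 r1 \<inter> closed_ball X x2 r2 \<noteq> {} \<and>
        closed_ball X x1 r1 \<inter> J \<noteq> {} \<and> closed_ball X x2 r2 \<inter> J \<noteq> {} \<longrightarrow>
        (\<forall>\<epsilon>>0. closed_ball X x1 (r1 + \<epsilon>) \<inter> closed_ball X x2 (r2 + \<epsilon>) \<inter> J \<noteq> {}))"

end

theory Submission
  imports Defs "HOL-Library.Diagonal_Subsequence"
begin

text \<open>
  Let \<open>n\<close> be the critical degree. Polynomials of smaller degree are weakly continuous, so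
  \<open>P (y + w\<^sub>m) - P y - P (w\<^sub>m) \<rightarrow> 0\<close> for \<open>P\<close> of degree \<open>n\<close> and bounded weakly null \<open>w\<^sub>m\<close>: all mixed terms
  have smaller degree in \<open>w\<^sub>m\<close>. Comparing \<open>P\<close> on long sums of sparse \<open>w\<^sub>m\<close> with the \<open>p\<close>-norm of these
  sums shows that \<open>nq \<ge> p\<close>, and that \<open>P (w\<^sub>m)\<close> is coordinatewise null if \<open>n < p\<close>. Hence, for \<open>S\<close> in the
  subspace, \<open>S y + R w\<close> with \<open>y\<close> an initial segment and \<open>w\<close> a far tail of a unit vector has norm
  almost at most 1: if \<open>n < p\<close> the two values are almost disjoint and \<open>nq \<ge> p\<close>, and if \<open>n \<ge> p\<close> the
  triangle inequality suffices. So \<open>\<parallel>S + R - K R\<parallel> \<le> 1 + \<epsilon>\<close> for suitable averages \<open>K\<close> of the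
  cut-offs \<open>R \<mapsto> R \<circ> \<Pi>\<^sub>m\<close>, and the M-projection is \<open>f \<mapsto> lim\<^sub>m f (\<cdot> \<circ> \<Pi>\<^sub>m)\<close>. Above the critical degree, the
  2-ball property fails for \<open>x\<^sub>0^k e\<^sub>0\<close> and a multiple of \<open>x\<^sub>0^(k-n) \<Sum>i\<ge>1. x\<^sub>i^n e\<^sub>i\<close>.
\<close>

subsection \<open>Normed spaces and their duals\<close>

text \<open>A single cut-off need not satisfy
  \<open>\<parallel>S + R - K R\<parallel> \<le> 1 + \<epsilon>\<close>:
  \<open>R x - R (trunc m x)\<close> differs from \<open>R (x - trunc m x)\<close> by mixed terms
  between coordinates just below and just above \<open>m\<close>, and these need not become
  uniformly small as \<open>m\<close> grows. At a given \<open>x\<close> they are small unless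
  \<open>x\<close> is heavy on the block that follows the cut. If the cuts are far apart, a unit
  vector is heavy on few blocks only, but on which ones depends on the vector; hence the averages
  over many cuts. Since only averages are controlled, the convergence of \<open>f (K m r)\<close>
  has to be derived from its cluster points. The dual of the domain is never identified. Weak
  convergence is handled through coordinatewise convergence of bounded sequences, and one argument
  with sparse sums serves functionals and polynomials alike. Local compactness of the scalars
  (\<open>heine_borel\<close>) supplies cluster points and diagonal subsequences for the real and
  the complex case at once.\<close>

locale normed_nspace =
  fixes X :: "('k::real_normed_field, 'v::ab_group_add) nspace"
  assumes zero_mem [simp, intro]: "0 \<in> vecs X"
    and add_mem [simp, intro]: "x \<in> vecs X \<Longrightarrow> y \<in> vecs X \<Longrightarrow> x + y \<in> vecs X"
    and scal_mem [simp, intro]: "x \<in> vecs X \<Longrightarrow> scal X c x \<in> vecs X"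
    and scal_add: "x \<in> vecs X \<Longrightarrow> y \<in> vecs X \<Longrightarrow> scal X c (x + y) = scal X c x + scal X c y"
    and scal_plus: "x \<in> vecs X \<Longrightarrow> scal X (c + d) x = scal X c x + scal X d x"
    and scal_scal [simp]: "x \<in> vecs X \<Longrightarrow> scal X c (scal X d x) = scal X (c * d) x"
    and scal_one [simp]: "x \<in> vecs X \<Longrightarrow> scal X 1 x = x"
    and nrm_scal: "x \<in> vecs X \<Longrightarrow> nrm X (scal X c x) = norm c * nrm X x"
    and nrm_add: "x \<in> vecs X \<Longrightarrow> y \<in> vecs X \<Longrightarrow> nrm X (x + y) \<le> nrm X x + nrm X y"
    and nrm_eq_0: "x \<in> vecs X \<Longrightarrow> nrm X x = 0 \<Longrightarrow> x = 0"
begin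

lemma scal_zero_left [simp]: "x \<in> vecs X \<Longrightarrow> scal X 0 x = 0"
  using scal_plus[of x 0 0] by simp

lemma scal_zero_right [simp]: "scal X c 0 = 0"
  using scal_add[of 0 0 c] by simp

lemma uminus_eq_scal: "x \<in> vecs X \<Longrightarrow> - x = scal X (-1) x"
  using scal_plus[of x 1 "-1"] by (simp add: eq_neg_iff_add_eq_0 neg_eq_iff_add_eq_0)

lemma uminus_mem [simp, intro]: "x \<in> vecs X \<Longrightarrow> - x \<in> vecs X"
  by (simp add: uminus_eq_scal)

lemma diff_mem [simp, intro]: "x \<in> vecs X \<Longrightarrow> y \<in> vecs X \<Longrightarrow> x - y \<in> vecs X"
  using add_mem[of x "- y"] by simp

lemma scal_uminus: "x \<in> vecs X \<Longrightarrow> scal X c (- x) = - scal X c x"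
  by (simp add: uminus_eq_scal)

lemma scal_diff: "x \<in> vecs X \<Longrightarrow> y \<in> vecs X \<Longrightarrow> scal X c (x - y) = scal X c x - scal X c y"
  using scal_add[of x "- y" c] by (simp add: scal_uminus)

lemma nrm_zero [simp]: "nrm X 0 = 0"
  using nrm_scal[of 0 0] by simp

lemma nrm_uminus [simp]: "x \<in> vecs X \<Longrightarrow> nrm X (- x) = nrm X x"
  by (simp add: uminus_eq_scal nrm_scal)

lemma nrm_nonneg [simp]: "x \<in> vecs X \<Longrightarrow> 0 \<le> nrm X x"
  using nrm_add[of x "- x"] by simp

lemma nrm_diff: "x \<in> vecs X \<Longrightarrow> y \<in> vecs X \<Longrightarrow> nrm X (x - y) \<le> nrm X x + nrm X y"
  using nrm_add[of x "- y"] by simp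

lemma nrm_diff_commute: "x \<in> vecs X \<Longrightarrow> y \<in> vecs X \<Longrightarrow> nrm X (x - y) = nrm X (y - x)"
  using nrm_uminus[of "x - y"] by simp

lemma nrm_triangle_sub: "x \<in> vecs X \<Longrightarrow> y \<in> vecs X \<Longrightarrow> nrm X x \<le> nrm X y + nrm X (x - y)"
  using nrm_add[of y "x - y"] by simp

lemma sum_mem [simp, intro]: "(\<And>i. i \<in> I \<Longrightarrow> f i \<in> vecs X) \<Longrightarrow> sum f I \<in> vecs X"
  by (induction I rule: infinite_finite_induct) auto

lemma nrm_sum: "(\<And>i. i \<in> I \<Longrightarrow> f i \<in> vecs X) \<Longrightarrow> nrm X (sum f I) \<le> (\<Sum>i\<in>I. nrm X (f i))"
proof (induction I rule: infinite_finite_induct)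
  case (insert i I)
  then show ?case using nrm_add[of "f i" "sum f I"] by simp
qed auto

lemma scal_sum: "(\<And>i. i \<in> I \<Longrightarrow> f i \<in> vecs X) \<Longrightarrow> scal X c (sum f I) = (\<Sum>i\<in>I. scal X c (f i))"
  by (induction I rule: infinite_finite_induct) (auto simp: scal_add)

lemma mem_dual_iff:
  "f \<in> vecs (dual X) \<longleftrightarrow> (\<forall>x\<in>vecs X. \<forall>y\<in>vecs X. f (x + y) = f x + f y)
      \<and> (\<forall>c. \<forall>x\<in>vecs X. f (scal X c x) = c * f x)
      \<and> (\<exists>C. \<forall>x\<in>vecs X. norm (f x) \<le> C * nrm X x)
      \<and> (\<forall>x. x \<notin> vecs X \<longrightarrow> f x = 0)"
  by (simp add: dual_def)

context
  fixes f assumes f: "f \<in> vecs (dual X)"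
begin

lemma dual_add: "x \<in> vecs X \<Longrightarrow> y \<in> vecs X \<Longrightarrow> f (x + y) = f x + f y"
  using f by (simp add: mem_dual_iff)

lemma dual_scal: "x \<in> vecs X \<Longrightarrow> f (scal X c x) = c * f x"
  using f by (simp add: mem_dual_iff)

lemma dual_outside: "x \<notin> vecs X \<Longrightarrow> f x = 0"
  using f by (simp add: mem_dual_iff)

lemma dual_zero: "f 0 = 0"
  using dual_scal[of 0 0] by simp

lemma dual_uminus: "x \<in> vecs X \<Longrightarrow> f (- x) = - f x"
  using dual_scal[of x "-1"] by (simp add: uminus_eq_scal)

lemma dual_diff: "x \<in> vecs X \<Longrightarrow> y \<in> vecs X \<Longrightarrow> f (x - y) = f x - f y"
  using dual_add[of x "- y"] by (simp add: dual_uminus)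

lemma dual_sum: "(\<And>i. i \<in> I \<Longrightarrow> x i \<in> vecs X) \<Longrightarrow> f (sum x I) = (\<Sum>i\<in>I. f (x i))"
  by (induction I rule: infinite_finite_induct) (auto simp: dual_add dual_zero)

lemma dual_nrm_bdd: "bdd_above ((\<lambda>x. norm (f x)) ` {x \<in> vecs X. nrm X x \<le> 1})"
proof -
  obtain C where C: "\<forall>x\<in>vecs X. norm (f x) \<le> C * nrm X x" using f by (auto simp: mem_dual_iff)
  have "norm (f x) \<le> \<bar>C\<bar>" if "x \<in> vecs X" "nrm X x \<le> 1" for x
  proof -
    have "norm (f x) \<le> C * nrm X x" using C that by blast
    also have "\<dots> \<le> \<bar>C\<bar> * 1" using that by (intro mult_mono) auto
    finally show ?thesis by simp
  qed
  then show ?thesis by (auto intro!: bdd_aboveI[of _ "\<bar>C\<bar>"])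
qed

lemma dual_le_nrm_ball: "x \<in> vecs X \<Longrightarrow> nrm X x \<le> 1 \<Longrightarrow> norm (f x) \<le> nrm (dual X) f"
  unfolding dual_def by (simp, rule cSUP_upper[OF _ dual_nrm_bdd]) auto

lemma dual_nrm_nonneg: "0 \<le> nrm (dual X) f"
  using dual_le_nrm_ball[of 0] by (simp add: dual_zero)

lemma dual_le_nrm:
  assumes x: "x \<in> vecs X" shows "norm (f x) \<le> nrm (dual X) f * nrm X x"
proof (cases "nrm X x = 0")
  case True
  then show ?thesis using nrm_eq_0[OF x] dual_zero by simp
next
  case False
  then have pos: "nrm X x > 0" using nrm_nonneg[OF x] by linarith
  have "norm (f (scal X (of_real (inverse (nrm X x))) x)) \<le> nrm (dual X) f"
    using x pos by (intro dual_le_nrm_ball) (auto simp: nrm_scal norm_inverse)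
  then show ?thesis using pos x by (simp add: dual_scal norm_mult norm_divide divide_simps inverse_eq_divide mult_ac)
qed

end

lemma dual_nrm_le: "(\<And>x. x \<in> vecs X \<Longrightarrow> nrm X x \<le> 1 \<Longrightarrow> norm (f x) \<le> C) \<Longrightarrow> nrm (dual X) f \<le> C"
  unfolding dual_def using nrm_zero zero_mem
  by (simp, intro cSUP_least) (force)+

lemma add_mem_dual:
  assumes "f \<in> vecs (dual X)" "g \<in> vecs (dual X)" shows "f + g \<in> vecs (dual X)"
proof -
  have "norm ((f + g) x) \<le> (nrm (dual X) f + nrm (dual X) g) * nrm X x" if "x \<in> vecs X" for x
    using dual_le_nrm[OF assms(1) that] dual_le_nrm[OF assms(2) that] norm_triangle_ineq[of "f x" "g x"]
    by (simp add: algebra_simps)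
  then have "\<exists>C. \<forall>x\<in>vecs X. norm ((f + g) x) \<le> C * nrm X x" by blast
  then show ?thesis using assms unfolding mem_dual_iff by (simp add: algebra_simps)
qed

lemma diff_mem_dual:
  assumes "f \<in> vecs (dual X)" "g \<in> vecs (dual X)" shows "f - g \<in> vecs (dual X)"
proof -
  have "norm ((f - g) x) \<le> (nrm (dual X) f + nrm (dual X) g) * nrm X x" if "x \<in> vecs X" for x
    using dual_le_nrm[OF assms(1) that] dual_le_nrm[OF assms(2) that] norm_triangle_ineq4[of "f x" "g x"]
    by (simp add: algebra_simps)
  then have "\<exists>C. \<forall>x\<in>vecs X. norm ((f - g) x) \<le> C * nrm X x" by blast
  then show ?thesis using assms unfolding mem_dual_iff by (simp add: algebra_simps)
qed

end

lemma unimodular_times_eq_norm: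
  fixes z :: "'k::real_normed_field"
  obtains c :: 'k where "norm c = 1" "c * z = of_real (norm z)"
proof (cases "z = 0")
  case True
  then show ?thesis using that[of 1] by simp
next
  case False
  then show ?thesis using that[of "of_real (norm z) / z"] by (simp add: norm_divide)
qed

text \<open>Local compactness gives one cluster point, and a subsequence that stays away from it
  gives a second. Infinite index sets are stated instead of subsequences because averages will be
  formed over finite subsets of them.\<close>

lemma bounded_seq_not_convergent:
  fixes a :: "nat \<Rightarrow> 'k::{real_normed_vector,heine_borel}"
  assumes "bounded (range a)" "\<not> convergent a"
  obtains b c where "b \<noteq> c" "\<And>\<delta>. \<delta> > 0 \<Longrightarrow> infinite {m. norm (a m - b) \<le> \<delta>}"
    "\<And>\<delta>. \<delta> > 0 \<Longrightarrow> infinite {m. norm (a m - c) \<le> \<delta>}"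
proof -
  have inf: "infinite {m. norm (a m - l) \<le> \<delta>}"
    if "strict_mono s" "(a \<circ> s) \<longlonglongrightarrow> l" "\<delta> > 0" for s l \<delta>
  proof -
    from that(2,3) obtain N where N: "\<And>m. m \<ge> N \<Longrightarrow> norm (a (s m) - l) < \<delta>"
      by (auto simp: LIMSEQ_iff)
    have "s ` {N..} \<subseteq> {m. norm (a m - l) \<le> \<delta>}" using N by (auto intro: less_imp_le)
    moreover have "infinite (s ` {N..})"
      using finite_imageD[of s "{N..}"] strict_mono_imp_inj_on[OF that(1)] infinite_Ici
      by (meson inj_on_subset subset_UNIV)
    ultimately show ?thesis using infinite_super by blast
  qed
  obtain b s where s: "strict_mono s" "(a \<circ> s) \<longlonglongrightarrow> b"
    using bounded_imp_convergent_subsequence[OF assms(1)] by blast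
  have "\<not> a \<longlonglongrightarrow> b" using assms(2) convergentI by blast
  then obtain e where e: "e > 0" "\<And>N. \<exists>m\<ge>N. norm (a m - b) \<ge> e"
    unfolding LIMSEQ_iff by (meson not_le)
  then have "infinite {m. norm (a m - b) \<ge> e}"
    unfolding infinite_nat_iff_unbounded_le by auto
  from infinite_enumerate[OF this] obtain r :: "nat \<Rightarrow> nat"
    where r: "strict_mono r" "\<And>m. norm (a (r m) - b) \<ge> e" by auto
  have "bounded (range (a \<circ> r))" using assms(1) by (rule bounded_subset) auto
  then obtain c t where t: "strict_mono t" "(a \<circ> r \<circ> t) \<longlonglongrightarrow> c"
    using bounded_imp_convergent_subsequence by blast
  have "(\<lambda>m. norm (a (r (t m)) - b)) \<longlonglongrightarrow> norm (c - b)"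
    using t(2) by (intro tendsto_intros) (simp add: o_def)
  then have "norm (c - b) \<ge> e" using r(2) by (intro LIMSEQ_le_const) auto
  then have "b \<noteq> c" using e(1) by auto
  moreover have "strict_mono (r \<circ> t)" using r(1) t(1) by (rule strict_mono_o)
  moreover have "(a \<circ> (r \<circ> t)) \<longlonglongrightarrow> c" using t(2) by (simp add: comp_assoc)
  ultimately show ?thesis by (intro that[of b c] inf[OF s] inf[of "r \<circ> t"])
qed

subsection \<open>A criterion for M-ideals\<close>

text \<open>
  The averages in the hypothesis \<open>avg\<close> allow cut-offs that are only good on average. The
  projection is \<open>f \<mapsto> lim\<^sub>m f \<circ> K m\<close>: two different cluster points of \<open>f (K m r)\<close> would produce
  an element of the ideal on which \<open>f\<close> exceeds the norm of its restriction.
\<close>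

locale M_ideal_approximation = normed_nspace X
  for X :: "('k::{real_normed_field,heine_borel}, 'v::ab_group_add) nspace" +
  fixes J :: "'v set" and K :: "nat \<Rightarrow> 'v \<Rightarrow> 'v"
  assumes closed_J: "closed_subspace J X"
    and K_mem: "x \<in> vecs X \<Longrightarrow> K m x \<in> J"
    and K_add: "x \<in> vecs X \<Longrightarrow> y \<in> vecs X \<Longrightarrow> K m (x + y) = K m x + K m y"
    and K_scal: "x \<in> vecs X \<Longrightarrow> K m (scal X c x) = scal X c (K m x)"
    and K_contractive: "x \<in> vecs X \<Longrightarrow> nrm X (K m x) \<le> nrm X x"
    and K_tendsto: "x \<in> J \<Longrightarrow> (\<lambda>m. nrm X (K m x - x)) \<longlonglongrightarrow> 0"
    and K_K: "x \<in> vecs X \<Longrightarrow> m \<le> m' \<Longrightarrow> K m' (K m x) = K m x"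
    and avg: "s \<in> J \<Longrightarrow> r \<in> vecs X \<Longrightarrow> nrm X s \<le> 1 \<Longrightarrow> nrm X r \<le> 1 \<Longrightarrow> \<epsilon> > 0 \<Longrightarrow> infinite I \<Longrightarrow>
       \<exists>T\<subseteq>I. finite T \<and> T \<noteq> {} \<and>
         nrm X (s + r - scal X (inverse (of_nat (card T))) (\<Sum>m\<in>T. K m r)) \<le> 1 + \<epsilon>"
begin

lemma J_subset: "J \<subseteq> vecs X" and J_zero: "0 \<in> J"
  and J_add: "x \<in> J \<Longrightarrow> y \<in> J \<Longrightarrow> x + y \<in> J" and J_scal: "x \<in> J \<Longrightarrow> scal X c x \<in> J"
  using closed_J unfolding closed_subspace_def by auto

lemma J_vecs: "x \<in> J \<Longrightarrow> x \<in> vecs X" using J_subset by auto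

lemma K_vecs: "x \<in> vecs X \<Longrightarrow> K m x \<in> vecs X" using K_mem J_vecs by auto

definition restr_nrm :: "('v \<Rightarrow> 'k) \<Rightarrow> real" where
  "restr_nrm f = (SUP x\<in>{x \<in> J. nrm X x \<le> 1}. norm (f x))"

context
  fixes f assumes f: "f \<in> vecs (dual X)"
begin

lemma restr_bdd: "bdd_above ((\<lambda>x. norm (f x)) ` {x \<in> J. nrm X x \<le> 1})"
  using dual_nrm_bdd[OF f] by (rule bdd_above_mono) (use J_vecs in auto)

lemma le_restr_nrm_ball: "x \<in> J \<Longrightarrow> nrm X x \<le> 1 \<Longrightarrow> norm (f x) \<le> restr_nrm f"
  unfolding restr_nrm_def by (rule cSUP_upper[OF _ restr_bdd]) auto

lemma le_restr_nrm:
  assumes x: "x \<in> J" and le: "nrm X x \<le> C" and C: "C > 0" shows "norm (f x) \<le> restr_nrm f * C"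
proof -
  have xv: "x \<in> vecs X" using x J_vecs by auto
  have "norm (f (scal X (of_real (inverse C)) x)) \<le> restr_nrm f"
    using x xv le C J_scal
    by (intro le_restr_nrm_ball) (auto simp: nrm_scal norm_divide inverse_eq_divide)
  then show ?thesis using C xv by (simp add: dual_scal[OF f] norm_mult norm_divide divide_simps inverse_eq_divide mult_ac)
qed

lemma restr_nrm_attained:
  assumes "\<delta> > 0"
  obtains s b where "s \<in> J" "nrm X s \<le> 1" "f s = of_real b" "b \<ge> restr_nrm f - \<delta>"
proof -
  have "\<exists>x\<in>{x \<in> J. nrm X x \<le> 1}. restr_nrm f - \<delta> < norm (f x)"
    unfolding restr_nrm_def
    by (subst less_cSUP_iff[symmetric, OF _ restr_bdd]) (use assms J_zero in \<open>auto intro!: exI[of _ 0]\<close>)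
  then obtain x where x: "x \<in> J" "nrm X x \<le> 1" "restr_nrm f - \<delta> < norm (f x)" by auto
  obtain c where c: "norm c = 1" "c * f x = of_real (norm (f x))"
    by (rule unimodular_times_eq_norm)
  show ?thesis
    by (rule that[of "scal X c x" "norm (f x)"])
      (use x c J_vecs in \<open>auto simp: nrm_scal J_scal dual_scal[OF f]\<close>)
qed

lemma norm_avg_diff_le:
  assumes T: "finite T" "T \<noteq> {}" "\<And>m. m \<in> T \<Longrightarrow> norm (f (K m r) - a) \<le> \<delta>" and r: "r \<in> vecs X"
  shows "norm (f (scal X (inverse (of_nat (card T))) (\<Sum>m\<in>T. K m r)) - a) \<le> \<delta>"
proof -
  have T0: "real (card T) > 0" using T by (simp add: card_gt_0_iff)
  have "f (scal X (inverse (of_nat (card T))) (\<Sum>m\<in>T. K m r)) - a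
      = inverse (of_nat (card T)) * (\<Sum>m\<in>T. f (K m r) - a)"
    using r T by (simp add: dual_scal[OF f] dual_sum[OF f] K_vecs sum_subtractf field_simps)
  also have "norm \<dots> \<le> inverse (real (card T)) * (\<Sum>m\<in>T. norm (f (K m r) - a))"
    by (simp add: norm_mult norm_inverse norm_sum mult_left_mono)
  also have "\<dots> \<le> inverse (real (card T)) * (\<Sum>m\<in>T. \<delta>)"
    using T by (intro mult_left_mono sum_mono) auto
  also have "\<dots> = \<delta>" using T0 by simp
  finally show ?thesis .
qed

text \<open>The element \<open>u\<close> is the average of the
  \<open>K m (scal X \<theta> r)\<close> with \<open>m\<close> in \<open>T\<close>. It imitates the
  cluster point, and each later \<open>K m\<close> fixes it, since it fixes the ranges of the
  earlier ones. The rotation \<open>\<theta>\<close> lets the callers align values of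
  \<open>f\<close>.\<close>

lemma avg_functional:
  assumes r: "r \<in> vecs X" "nrm X r \<le> 1" and I: "infinite I" "\<And>m. m \<in> I \<Longrightarrow> norm (f (K m r) - a) \<le> \<delta>"
    and s: "s \<in> J" "nrm X s \<le> 1" and \<epsilon>: "\<epsilon> > 0" and \<theta>: "norm \<theta> = 1"
  obtains T u where "finite T" "T \<subseteq> I" "u \<in> J" "norm (f u - \<theta> * a) \<le> \<delta>"
    "nrm X (s + scal X \<theta> r - u) \<le> 1 + \<epsilon>" "\<And>m. (\<forall>i\<in>T. i \<le> m) \<Longrightarrow> K m u = u"
proof -
  have "nrm X (scal X \<theta> r) \<le> 1" using r \<theta> by (simp add: nrm_scal)
  then obtain T where T: "T \<subseteq> I" "finite T" "T \<noteq> {}"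
      "nrm X (s + scal X \<theta> r - scal X (inverse (of_nat (card T))) (\<Sum>m\<in>T. K m (scal X \<theta> r))) \<le> 1 + \<epsilon>"
    using avg[OF s(1) _ s(2) _ \<epsilon> I(1)] r(1) scal_mem by metis
  define u where "u = scal X (inverse (of_nat (card T))) (\<Sum>m\<in>T. K m (scal X \<theta> r))"
  have uJ: "u \<in> J" unfolding u_def
  proof (rule J_scal)
    show "(\<Sum>m\<in>T. K m (scal X \<theta> r)) \<in> J" using T(2)
      by (induction T rule: finite_induct) (auto simp: J_zero J_add K_mem r)
  qed
  have nf: "norm (f (K m (scal X \<theta> r)) - \<theta> * a) \<le> \<delta>" if "m \<in> T" for m
  proof -
    have "f (K m (scal X \<theta> r)) - \<theta> * a = \<theta> * (f (K m r) - a)"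
      by (simp add: K_scal r dual_scal[OF f] K_vecs algebra_simps)
    then show ?thesis using I(2)[of m] that T(1) \<theta> by (auto simp: norm_mult)
  qed
  have Ku: "K m u = u" if "\<forall>i\<in>T. i \<le> m" for m
  proof -
    have K0: "K m 0 = 0" using K_scal[of 0 m 0] by (simp add: K_vecs)
    have "K m (\<Sum>i\<in>A. K i (scal X \<theta> r)) = (\<Sum>i\<in>A. K m (K i (scal X \<theta> r)))" if "finite A" for A
      using that by (induction A rule: finite_induct) (auto simp: K_add K_vecs r K0)
    then show ?thesis using that T(2) r unfolding u_def by (simp add: K_scal K_vecs K_K)
  qed
  show ?thesis
    by (rule that[OF T(2,1) uJ _ _ Ku])
     (use T(4) norm_avg_diff_le[OF T(2,3) nf] r in \<open>auto simp: u_def\<close>)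
qed

text \<open>\<open>f s\<close> is close to \<open>restr_nrm f\<close> and
  \<open>f (scal X \<theta> r - u)\<close> is close to \<open>norm (f r - a)\<close>. These are
  nonnegative reals, so they add up without cancellation, yet their arguments sum to a vector of
  norm at most \<open>1 + \<delta>\<close>.\<close>

lemma restr_nrm_plus_cluster:
  assumes r: "r \<in> vecs X" "nrm X r \<le> 1" and a: "\<And>\<delta>. \<delta> > 0 \<Longrightarrow> infinite {m. norm (f (K m r) - a) \<le> \<delta>}"
  shows "restr_nrm f + norm (f r - a) \<le> nrm (dual X) f"
proof (rule field_le_epsilon)
  fix e :: real assume "e > 0"
  define N where "N = nrm (dual X) f"
  have N0: "N \<ge> 0" using dual_nrm_nonneg[OF f] by (simp add: N_def)
  define \<delta> where "\<delta> = e / (N + 2)"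
  have \<delta>: "\<delta> > 0" using \<open>e > 0\<close> N0 by (simp add: \<delta>_def)
  obtain s b where s: "s \<in> J" "nrm X s \<le> 1" "f s = of_real b" "b \<ge> restr_nrm f - \<delta>"
    using restr_nrm_attained[OF \<delta>] .
  obtain \<theta> where \<theta>: "norm \<theta> = 1" "\<theta> * (f r - a) = of_real (norm (f r - a))"
    by (rule unimodular_times_eq_norm)
  obtain T u where u: "u \<in> J" "norm (f u - \<theta> * a) \<le> \<delta>" "nrm X (s + scal X \<theta> r - u) \<le> 1 + \<delta>"
    by (rule avg_functional[OF r a[OF \<delta>] _ s(1,2) \<delta> \<theta>(1)]) auto
  have "f (s + scal X \<theta> r - u) = of_real (b + norm (f r - a)) - (f u - \<theta> * a)"
    using s u r J_vecs \<theta>(2) by (simp add: dual_diff[OF f] dual_add[OF f] dual_scal[OF f] algebra_simps)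
  moreover have "norm (f (s + scal X \<theta> r - u)) \<le> N * (1 + \<delta>)"
    unfolding N_def using s u r J_vecs dual_nrm_nonneg[OF f] dual_le_nrm[OF f, of "s + scal X \<theta> r - u"]
    by (smt (verit, best) add_mem diff_mem mult_left_mono scal_mem)
  ultimately have "norm (of_real (b + norm (f r - a)) :: 'k) \<le> N * (1 + \<delta>) + \<delta>"
    using u(2) norm_triangle_sub by (smt (verit) norm_minus_commute)
  then have "b + norm (f r - a) \<le> N * (1 + \<delta>) + \<delta>" by (simp only: norm_of_real)
  then have "restr_nrm f + norm (f r - a) \<le> N + (N + 2) * \<delta>" using s(4) by (simp add: algebra_simps)
  also have "(N + 2) * \<delta> = e" using N0 by (simp add: \<delta>_def)
  finally show "restr_nrm f + norm (f r - a) \<le> nrm (dual X) f + e" by (simp add: N_def)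
qed

lemma cluster_points_equal:
  assumes r: "r \<in> vecs X" "nrm X r \<le> 1"
    and a: "\<And>\<delta>. \<delta> > 0 \<Longrightarrow> infinite {m. norm (f (K m r) - a) \<le> \<delta>}"
    and b: "\<And>\<delta>. \<delta> > 0 \<Longrightarrow> infinite {m. norm (f (K m r) - b) \<le> \<delta>}"
  shows "a = b"
proof -
  have "norm (b - a) \<le> 0 + e" if "e > 0" for e
  proof -
    define N where "N = nrm (dual X) f"
    have N0: "N \<ge> 0" using dual_nrm_nonneg[OF f] by (simp add: N_def)
    define R where "R = restr_nrm f"
    have R0: "R \<ge> 0" using le_restr_nrm_ball[of 0] J_zero by (simp add: R_def dual_zero[OF f])
    \<comment> \<open>One \<open>\<delta>\<close> each for the choice of \<open>s\<close>, for
      \<open>f u\<close> and for \<open>f (K m r)\<close>, then \<open>N * \<delta>\<close> for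
      replacing \<open>s\<close> by \<open>K m s\<close>, and \<open>R * \<delta>\<close> for the
      norm bound \<open>1 + \<delta>\<close> of \<open>K m v\<close>.\<close>
    define \<delta> where "\<delta> = e / (N + R + 3)"
    have \<delta>: "\<delta> > 0" using \<open>e > 0\<close> N0 R0 by (simp add: \<delta>_def)
    obtain s \<beta> where s: "s \<in> J" "nrm X s \<le> 1" "f s = of_real \<beta>" "\<beta> \<ge> restr_nrm f - \<delta>"
      using restr_nrm_attained[OF \<delta>] .
    obtain \<theta> where \<theta>: "norm \<theta> = 1" "\<theta> * (b - a) = of_real (norm (b - a))"
      by (rule unimodular_times_eq_norm)
    obtain T u where T: "finite T" and u: "u \<in> J" "norm (f u - \<theta> * a) \<le> \<delta>"
        "nrm X (s + scal X \<theta> r - u) \<le> 1 + \<delta>" and Ku: "\<And>m. (\<forall>i\<in>T. i \<le> m) \<Longrightarrow> K m u = u"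
      by (rule avg_functional[OF r a[OF \<delta>] _ s(1,2) \<delta> \<theta>(1), of a \<delta>]) blast+
    obtain M where M: "\<And>m. m \<ge> M \<Longrightarrow> nrm X (K m s - s) < \<delta>"
      using order_tendstoD(2)[OF K_tendsto[OF s(1)] \<delta>] unfolding eventually_sequentially by blast
    \<comment> \<open>Beyond \<open>T\<close> the map \<open>K m\<close> fixes \<open>u\<close>,
      which imitates \<open>a\<close>; beyond \<open>M\<close> it almost fixes \<open>s\<close>; and
      \<open>f (K m r)\<close> is near \<open>b\<close>. So \<open>K m v\<close> lies in
      \<open>J\<close>, and \<open>f\<close> takes there almost the value
      \<open>restr_nrm f + norm (b - a)\<close>.\<close>
    obtain m where m: "m \<ge> Max (insert M T)" "norm (f (K m r) - b) \<le> \<delta>"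
      using b[OF \<delta>] unfolding infinite_nat_iff_unbounded_le by auto
    have mM: "m \<ge> M" and mT: "\<forall>i\<in>T. i \<le> m" using m(1) T by auto
    define v where "v = s + scal X \<theta> r - u"
    have vv: "v \<in> vecs X" using s u r J_vecs by (auto simp: v_def)
    have Kv: "K m v = K m s + scal X \<theta> (K m r) - u"
    proof -
      have "K m (v + u) = K m v + K m u" using vv u J_vecs by (intro K_add) auto
      moreover have "v + u = s + scal X \<theta> r" by (simp add: v_def)
      ultimately show ?thesis using Ku[OF mT] s r J_vecs by (simp add: K_add K_scal)
    qed
    have "norm (f (K m v)) \<le> R * (1 + \<delta>)" unfolding R_def
      using u(3) vv \<delta> K_contractive[OF vv, of m] by (intro le_restr_nrm K_mem) (auto simp: v_def)
    moreover have eq: "of_real (\<beta> + norm (b - a)) = f (K m v) - f (K m s - s) - \<theta> * (f (K m r) - b) + (f u - \<theta> * a)"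
      using s u r J_vecs \<theta>(2) K_vecs unfolding Kv
      by (simp add: dual_diff[OF f] dual_add[OF f] dual_scal[OF f] algebra_simps)
    moreover have "norm (f (K m s - s)) \<le> N * \<delta>"
      using dual_le_nrm[OF f, of "K m s - s"] s J_vecs K_vecs M[OF mM] N0
      by (smt (verit, best) N_def diff_mem mult_left_mono)
    moreover have "norm (\<theta> * (f (K m r) - b)) \<le> \<delta>" using m(2) \<theta>(1) by (simp add: norm_mult)
    moreover have norm4: "norm (w - x - y + z) \<le> norm w + norm x + norm y + norm z" for w x y z :: 'k
      by (smt (verit) norm_triangle_ineq norm_triangle_ineq4)
    moreover have "norm (of_real (\<beta> + norm (b - a)) :: 'k)
        \<le> norm (f (K m v)) + norm (f (K m s - s)) + norm (\<theta> * (f (K m r) - b)) + norm (f u - \<theta> * a)"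
      unfolding eq by (rule norm4)
    ultimately have "norm (of_real (\<beta> + norm (b - a)) :: 'k) \<le> R * (1 + \<delta>) + N * \<delta> + \<delta> + \<delta>"
      using u(2) by linarith
    then have "\<beta> + norm (b - a) \<le> R * (1 + \<delta>) + N * \<delta> + \<delta> + \<delta>" by (simp only: norm_of_real)
    then have "norm (b - a) \<le> (N + R + 3) * \<delta>" using s(4) by (simp add: algebra_simps R_def)
    also have "(N + R + 3) * \<delta> = e" using N0 R0 by (simp add: \<delta>_def)
    finally show ?thesis by simp
  qed
  then have "norm (b - a) \<le> 0" by (rule field_le_epsilon)
  then show ?thesis by simp
qed

lemma functional_convergent:
  assumes r: "r \<in> vecs X"
  shows "convergent (\<lambda>m. f (K m r))"
proof -
  have ball: "convergent (\<lambda>m. f (K m r))" if r: "r \<in> vecs X" "nrm X r \<le> 1" for r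
  proof (rule ccontr)
    assume nc: "\<not> ?thesis"
    have "norm (f (K m r)) \<le> nrm (dual X) f" for m
      using r K_contractive[OF r(1), of m] K_vecs by (intro dual_le_nrm_ball[OF f]) auto
    then have "bounded (range (\<lambda>m. f (K m r)))" by (auto simp: bounded_iff)
    then show False
      by (rule bounded_seq_not_convergent[OF _ nc]) (use cluster_points_equal[OF r] in blast)
  qed
  define c where "c = inverse (nrm X r + 1)"
  have c: "c > 0" using nrm_nonneg[OF r] by (simp add: c_def add_nonneg_pos)
  have "nrm X (scal X (of_real c) r) \<le> 1"
    using r nrm_nonneg[OF r] c by (simp add: nrm_scal norm_of_real c_def del: of_real_inverse) (simp add: field_simps)
  then have "convergent (\<lambda>m. f (K m (scal X (of_real c) r)))" using r by (intro ball) auto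
  then have "convergent (\<lambda>m. of_real (inverse c) * f (K m (scal X (of_real c) r)))"
    by (intro convergent_mult convergent_const)
  then show ?thesis using r c by (simp add: K_scal dual_scal[OF f] K_vecs flip: mult.assoc of_real_mult)
qed

definition proj :: "'v \<Rightarrow> 'k" where
  "proj x = (if x \<in> vecs X then lim (\<lambda>m. f (K m x)) else 0)"

lemma proj_tendsto: "r \<in> vecs X \<Longrightarrow> (\<lambda>m. f (K m r)) \<longlonglongrightarrow> proj r"
  using functional_convergent by (simp add: proj_def convergent_LIMSEQ_iff)

lemma proj_eqI: "r \<in> vecs X \<Longrightarrow> (\<lambda>m. f (K m r)) \<longlonglongrightarrow> l \<Longrightarrow> proj r = l"
  using proj_tendsto LIMSEQ_unique by blast

lemma proj_add: "x \<in> vecs X \<Longrightarrow> y \<in> vecs X \<Longrightarrow> proj (x + y) = proj x + proj y"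
  using tendsto_add[OF proj_tendsto proj_tendsto, of x y]
  by (intro proj_eqI) (auto simp: K_add dual_add[OF f] K_vecs)

lemma proj_scal: "x \<in> vecs X \<Longrightarrow> proj (scal X c x) = c * proj x"
  using tendsto_mult[OF tendsto_const proj_tendsto, of x c]
  by (intro proj_eqI) (auto simp: K_scal dual_scal[OF f] K_vecs)

lemma proj_bound:
  assumes x: "x \<in> vecs X" "nrm X x \<le> 1" shows "norm (proj x) \<le> restr_nrm f"
proof (rule LIMSEQ_le_const2[OF tendsto_norm[OF proj_tendsto[OF x(1)]]], intro exI allI impI)
  fix m show "norm (f (K m x)) \<le> restr_nrm f"
    using order_trans[OF K_contractive[OF x(1)] x(2)] K_mem[OF x(1)] by (intro le_restr_nrm_ball)
qed

lemma proj_mem: "proj \<in> vecs (dual X)"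
proof -
  have "norm (proj x) \<le> nrm (dual X) f * nrm X x" if x: "x \<in> vecs X" for x
  proof (rule LIMSEQ_le_const2[OF tendsto_norm[OF proj_tendsto[OF x]]], intro exI allI impI)
    fix m
    have "norm (f (K m x)) \<le> nrm (dual X) f * nrm X (K m x)"
      using x K_vecs by (intro dual_le_nrm[OF f]) auto
    also have "\<dots> \<le> nrm (dual X) f * nrm X x"
      using K_contractive[OF x] dual_nrm_nonneg[OF f] by (intro mult_left_mono) auto
    finally show "norm (f (K m x)) \<le> nrm (dual X) f * nrm X x" .
  qed
  then show ?thesis unfolding mem_dual_iff using proj_add proj_scal by (auto simp: proj_def)
qed

lemma proj_J:
  assumes x: "x \<in> J" shows "proj x = f x"
proof (rule proj_eqI)
  show xv: "x \<in> vecs X" using x J_vecs by auto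
  have "(\<lambda>m. f (K m x) - f x) \<longlonglongrightarrow> 0"
  proof (rule Lim_null_comparison)
    show "(\<lambda>m. nrm (dual X) f * nrm X (K m x - x)) \<longlonglongrightarrow> 0"
      using tendsto_mult[OF tendsto_const K_tendsto[OF x], of "nrm (dual X) f"] by simp
    show "\<forall>\<^sub>F m in sequentially. norm (f (K m x) - f x) \<le> nrm (dual X) f * nrm X (K m x - x)"
      using dual_le_nrm[OF f, of "K _ x - x"] xv K_vecs by (simp add: dual_diff[OF f])
  qed
  then show "(\<lambda>m. f (K m x)) \<longlonglongrightarrow> f x" by (simp add: LIM_zero_iff)
qed

text \<open>One direction is the triangle inequality. For the other, the limit \<open>proj x\<close>
  is a cluster point, so \<open>restr_nrm_plus_cluster\<close> bounds \<open>f - proj\<close> by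
  \<open>nrm (dual X) f - restr_nrm f\<close>, while \<open>proj\<close> is bounded by
  \<open>restr_nrm f\<close> because the \<open>K m\<close> are contractions into
  \<open>J\<close>.\<close>

lemma nrm_proj_split: "nrm (dual X) f = nrm (dual X) proj + nrm (dual X) (f - proj)"
proof (rule antisym)
  show "nrm (dual X) f \<le> nrm (dual X) proj + nrm (dual X) (f - proj)"
  proof (rule dual_nrm_le)
    fix x assume x: "x \<in> vecs X" "nrm X x \<le> 1"
    have "norm (f x) \<le> norm (proj x) + norm ((f - proj) x)"
      using norm_triangle_ineq[of "proj x" "f x - proj x"] by simp
    then show "norm (f x) \<le> nrm (dual X) proj + nrm (dual X) (f - proj)"
      using dual_le_nrm_ball[OF proj_mem x] dual_le_nrm_ball[OF diff_mem_dual[OF f proj_mem] x] by linarith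
  qed
  have "nrm (dual X) (f - proj) \<le> nrm (dual X) f - restr_nrm f"
  proof (rule dual_nrm_le)
    fix x assume x: "x \<in> vecs X" "nrm X x \<le> 1"
    have "infinite {m. norm (f (K m x) - proj x) \<le> \<delta>}" if \<delta>: "\<delta> > 0" for \<delta>
    proof -
      obtain N where "\<And>m. m \<ge> N \<Longrightarrow> norm (f (K m x) - proj x) < \<delta>"
        using proj_tendsto[OF x(1)] \<delta> unfolding LIMSEQ_iff by blast
      then have "{N..} \<subseteq> {m. norm (f (K m x) - proj x) \<le> \<delta>}" by (auto intro: less_imp_le)
      then show ?thesis using infinite_Ici infinite_super by blast
    qed
    from restr_nrm_plus_cluster[OF x this]
    show "norm ((f - proj) x) \<le> nrm (dual X) f - restr_nrm f" by simp
  qed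
  moreover have "nrm (dual X) proj \<le> restr_nrm f" by (rule dual_nrm_le) (rule proj_bound)
  ultimately show "nrm (dual X) proj + nrm (dual X) (f - proj) \<le> nrm (dual X) f" by linarith
qed

end

theorem M_ideal: "M_ideal J X"
proof -
  note pm = proj_mem and pt = proj_tendsto
  have "linear_projection_on (dual X) proj"
    unfolding linear_projection_on_def
  proof (intro conjI ballI allI)
    fix f assume f: "f \<in> vecs (dual X)"
    show "proj f \<in> vecs (dual X)" by (rule pm[OF f])
    show "proj (proj f) = proj f"
    proof
      fix x show "proj (proj f) x = proj f x"
      proof (cases "x \<in> vecs X")
        case True
        then show ?thesis using pt[OF f True] by (intro proj_eqI[OF pm[OF f]]) (simp_all add: proj_J[OF f] K_mem)
      next
        case False
        then show ?thesis using dual_outside[OF pm[OF pm[OF f]]] dual_outside[OF pm[OF f]] by simp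
      qed
    qed
    show "proj (scal (dual X) c f) = scal (dual X) c (proj f)" for c
    proof
      fix x
      have "scal (dual X) c f \<in> vecs (dual X)"
        using f unfolding mem_dual_iff
      proof (elim conjE exE, intro conjI)
        fix C assume C: "\<forall>x\<in>vecs X. norm (f x) \<le> C * nrm X x"
        show "\<exists>C. \<forall>x\<in>vecs X. norm (scal (dual X) c f x) \<le> C * nrm X x"
          using C by (intro exI[of _ "norm c * C"])
            (auto simp: dual_def norm_mult mult.assoc intro!: mult_left_mono)
      qed (auto simp: dual_def algebra_simps)
      then have sm: "scal (dual X) c f \<in> vecs (dual X)" .
      show "proj (scal (dual X) c f) x = scal (dual X) c (proj f) x"
      proof (cases "x \<in> vecs X")
        case True
        have "(\<lambda>m. c * f (K m x)) \<longlonglongrightarrow> c * proj f x"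
          by (intro tendsto_mult tendsto_const pt f True)
        then show ?thesis by (intro proj_eqI[OF sm True]) (simp add: dual_def)
      next
        case False
        then show ?thesis
          using dual_outside[OF pm[OF sm]] dual_outside[OF pm[OF f]] by (simp add: dual_def)
      qed
    qed
  next
    fix f g assume f: "f \<in> vecs (dual X)" and g: "g \<in> vecs (dual X)"
    show "proj (f + g) = proj f + proj g"
    proof
      fix x show "proj (f + g) x = (proj f + proj g) x"
      proof (cases "x \<in> vecs X")
        case True
        have "(\<lambda>m. f (K m x) + g (K m x)) \<longlonglongrightarrow> proj f x + proj g x"
          by (intro tendsto_add pt f g True)
        then show ?thesis by (simp add: proj_eqI[OF add_mem_dual[OF f g] True])
      next
        case False
        then show ?thesis
          using dual_outside[OF pm[OF add_mem_dual[OF f g]]] dual_outside[OF pm[OF f]]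
            dual_outside[OF pm[OF g]] by simp
      qed
    qed
  qed
  moreover have "{f \<in> vecs (dual X). proj f = 0} = annihilator J X"
  proof -
    have "proj f = 0 \<longleftrightarrow> (\<forall>x\<in>J. f x = 0)" if f: "f \<in> vecs (dual X)" for f
    proof
      assume "proj f = 0" then show "\<forall>x\<in>J. f x = 0" using proj_J[OF f] by (metis zero_fun_apply)
    next
      assume J0: "\<forall>x\<in>J. f x = 0"
      show "proj f = 0"
      proof
        fix x show "proj f x = 0 x"
          using J0 K_mem by (cases "x \<in> vecs X") (auto simp: dual_outside[OF pm[OF f]] intro!: proj_eqI[OF f])
      qed
    qed
    then show ?thesis unfolding annihilator_def by auto
  qed
  ultimately show ?thesis
    unfolding M_ideal_def using closed_J nrm_proj_split by blast
qed

end

subsection \<open>Homogeneous polynomials\<close>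

text \<open>Freezes the positions marked \<open>False\<close> at \<open>y\<close> and spends
  \<open>ws\<close> on the others. Composed with a multilinear map, this gives the multilinear maps
  that induce the mixed terms of \<open>P (y + w)\<close>.\<close>

fun fill :: "'v \<Rightarrow> bool list \<Rightarrow> 'v list \<Rightarrow> 'v list" where
  "fill y [] ws = []"
| "fill y (False # bs) ws = y # fill y bs ws"
| "fill y (True # bs) ws = hd ws # fill y bs (tl ws)"

lemma length_fill [simp]: "length (fill y bs ws) = length bs"
  by (induction y bs ws rule: fill.induct) auto

lemma set_fill: "length ws = length (filter (\<lambda>b. b) bs) \<Longrightarrow> set (fill y bs ws) \<subseteq> insert y (set ws)"
proof (induction y bs ws rule: fill.induct)
  case (3 y bs ws)
  then show ?case by (cases ws) auto
qed auto

lemma fill_replicate: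
  "fill y bs (replicate (length (filter (\<lambda>b. b) bs)) w) = map (\<lambda>b. if b then w else y) bs"
proof (induction bs)
  case (Cons b bs)
  then show ?case by (cases b) auto
qed auto

lemma fill_update:
  "i < length (filter (\<lambda>b. b) bs) \<Longrightarrow> \<exists>k<length bs. \<forall>ws u. length ws = length (filter (\<lambda>b. b) bs) \<longrightarrow>
      fill y bs (ws[i := u]) = (fill y bs ws)[k := u]"
proof (induction bs arbitrary: i)
  case (Cons b bs)
  show ?case
  proof (cases b)
    case False
    then obtain k where "k < length bs" "\<forall>ws u. length ws = length (filter (\<lambda>b. b) bs) \<longrightarrow>
      fill y bs (ws[i := u]) = (fill y bs ws)[k := u]" using Cons.IH[of i] Cons.prems by auto
    then show ?thesis using False by (intro exI[of _ "Suc k"]) auto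
  next
    case b: True
    show ?thesis
    proof (cases i)
      case 0
      have "fill y (b # bs) (ws[i := u]) = (fill y (b # bs) ws)[0 := u]"
        if "length ws = length (filter (\<lambda>b. b) (b # bs))" for ws u
        using that b 0 by (cases ws) auto
      then show ?thesis by (intro exI[of _ 0]) auto
    next
      case (Suc i')
      then obtain k where k: "k < length bs" "\<forall>ws u. length ws = length (filter (\<lambda>b. b) bs) \<longrightarrow>
        fill y bs (ws[i' := u]) = (fill y bs ws)[k := u]" using Cons.IH[of i'] Cons.prems b by auto
      have "fill y (b # bs) (ws[i := u]) = (fill y (b # bs) ws)[Suc k := u]"
        if "length ws = length (filter (\<lambda>b. b) (b # bs))" for ws u
        using that b Suc k(2) by (cases ws) auto
      then show ?thesis using k(1) by (intro exI[of _ "Suc k"]) auto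
    qed
  qed
qed auto

lemma finite_bool_lists: "finite {bs :: bool list. length bs = n \<and> Q bs}"
  by (rule finite_subset[OF _ finite_lists_length_eq[of UNIV n]]) auto

text \<open>The coefficients are those of the polynomial \<open>\<Prod>m\<noteq>j. (X - 2^m)\<close>, normalised at \<open>2^j\<close>.\<close>

lemma interpolation_coeffs:
  assumes "j \<le> n"
  obtains c :: "nat \<Rightarrow> 'k::real_normed_field"
  where "\<And>l. l \<le> n \<Longrightarrow> (\<Sum>i\<le>n. c i * (2 ^ i) ^ l) = (if l = j then 1 else 0)"
proof -
  define p :: "'k poly" where "p = (\<Prod>m\<in>{..n} - {j}. [:- (2 ^ m), 1:])"
  have ev: "poly p x = (\<Prod>m\<in>{..n} - {j}. x - 2 ^ m)" for x
    by (simp add: p_def poly_prod)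
  have deg: "degree p \<le> n"
  proof -
    have "degree p \<le> (\<Sum>m\<in>{..n} - {j}. degree [:- (2 ^ m), 1::'k:])"
      unfolding p_def by (rule order_trans[OF degree_prod_sum_le]) auto
    also have "\<dots> = n" using assms by simp
    finally show ?thesis .
  qed
  have neq: "(2::'k) ^ a \<noteq> 2 ^ b" if "a \<noteq> b" for a b
  proof
    assume "(2::'k) ^ a = 2 ^ b"
    then have "norm ((2::'k) ^ a) = norm ((2::'k) ^ b)" by simp
    then show False using that by (simp add: norm_power)
  qed
  have nz: "poly p (2 ^ j) \<noteq> 0" unfolding ev using neq by (auto simp: prod_zero_iff)
  have z: "poly p (2 ^ l) = 0" if "l \<le> n" "l \<noteq> j" for l
    unfolding ev using that by (intro prod_zero) (auto intro!: bexI[of _ l])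
  have "(\<Sum>i\<le>n. (coeff p i / poly p (2 ^ j)) * (2 ^ i) ^ l) = poly p (2 ^ l) / poly p (2 ^ j)" for l
  proof -
    have "poly p (2 ^ l) = (\<Sum>i\<le>n. coeff p i * (2 ^ l) ^ i)"
      using deg unfolding poly_altdef
      by (intro sum.mono_neutral_left) (auto simp: coeff_eq_0)
    then show ?thesis by (simp add: sum_divide_distrib power_mult[symmetric] mult.commute)
  qed
  then show ?thesis using z nz by (intro that[of "\<lambda>i. coeff p i / poly p (2 ^ j)"]) auto
qed

section \<open>Multilinear maps and the polynomials they induce\<close>

locale poly_pair = E: normed_nspace E + F: normed_nspace F
  for E :: "('k::real_normed_field, 'v::ab_group_add) nspace"
    and F :: "('k, 'w::ab_group_add) nspace"
begin

lemma multilinear_mem: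
  "multilinear n E F A \<Longrightarrow> length xs = n \<Longrightarrow> set xs \<subseteq> vecs E \<Longrightarrow> A xs \<in> vecs F"
  unfolding multilinear_def by blast

lemma multilinear_update:
  assumes "multilinear n E F A" "length xs = n" "set xs \<subseteq> vecs E" "i < n" "u \<in> vecs E"
  shows "v \<in> vecs E \<Longrightarrow> A (xs[i := u + v]) = A (xs[i := u]) + A (xs[i := v])"
    and "A (xs[i := scal E c u]) = scal F c (A (xs[i := u]))"
  using assms unfolding multilinear_def by blast+

lemma multilinear_add:
  assumes "multilinear n E F A" "length xs + Suc (length ys) = n"
    "set xs \<subseteq> vecs E" "set ys \<subseteq> vecs E" "u \<in> vecs E" "v \<in> vecs E"
  shows "A (xs @ (u + v) # ys) = A (xs @ u # ys) + A (xs @ v # ys)"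
  using multilinear_update(1)[OF assms(1), of "xs @ u # ys" "length xs" u v] assms by simp

lemma multilinear_scal:
  assumes "multilinear n E F A" "length xs + Suc (length ys) = n"
    "set xs \<subseteq> vecs E" "set ys \<subseteq> vecs E" "u \<in> vecs E"
  shows "A (xs @ scal E c u # ys) = scal F c (A (xs @ u # ys))"
  using multilinear_update(2)[OF assms(1), of "xs @ u # ys" "length xs" u c] assms by simp

lemma multilinear_scal_all:
  assumes A: "multilinear n E F A"
  shows "length xs + length ys = n \<Longrightarrow> set xs \<subseteq> vecs E \<Longrightarrow> set ys \<subseteq> vecs E \<Longrightarrow>
      A (xs @ map (scal E c) ys) = scal F (c ^ length ys) (A (xs @ ys))"
proof (induction ys arbitrary: xs)
  case Nil
  then show ?case using multilinear_mem[OF A, of xs] by simp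
next
  case (Cons y ys)
  have "A (xs @ map (scal E c) (y # ys)) = A ((xs @ [scal E c y]) @ map (scal E c) ys)" by simp
  also have "\<dots> = scal F (c ^ length ys) (A (xs @ scal E c y # ys))"
    using Cons.prems by (subst Cons.IH) auto
  also have "\<dots> = scal F (c ^ length (y # ys)) (A (xs @ y # ys))"
    using Cons.prems multilinear_mem[OF A, of "xs @ y # ys"]
    by (subst multilinear_scal[OF A]) (auto simp: mult.commute)
  finally show ?case .
qed

text \<open>Choice patterns take the place of binomial coefficients, because \<open>A\<close> is not
  assumed to be symmetric. The prefix \<open>xs\<close> holds the arguments already expanded in the
  induction.\<close>

lemma multilinear_expand:
  assumes A: "multilinear n E F A" and y: "y \<in> vecs E" and w: "w \<in> vecs E"
  shows "length xs + m = n \<Longrightarrow> set xs \<subseteq> vecs E \<Longrightarrow>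
      A (xs @ replicate m (y + w)) = (\<Sum>bs | length bs = m. A (xs @ map (\<lambda>b. if b then w else y) bs))"
proof (induction m arbitrary: xs)
  case (Suc m)
  let ?S = "\<lambda>b. {bs :: bool list. \<exists>cs. bs = b # cs \<and> length cs = m}"
  let ?g = "\<lambda>bs. A (xs @ map (\<lambda>b. if b then w else y) bs)"
  have sp: "set (replicate m (y + w)) \<subseteq> vecs E" using y w by (auto simp: set_replicate_conv_if)
  have S: "sum ?g (?S b) = A ((xs @ [if b then w else y]) @ replicate m (y + w))" for b
  proof -
    have "?S b = (#) b ` {cs. length cs = m}" by auto
    then have "sum ?g (?S b) = (\<Sum>cs | length cs = m. ?g (b # cs))"
      by (simp add: sum.reindex)
    also have "\<dots> = A ((xs @ [if b then w else y]) @ replicate m (y + w))"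
      using Suc.prems y w by (subst Suc.IH) auto
    finally show ?thesis .
  qed
  have fin: "finite (?S b)" for b
    by (rule finite_subset[OF _ finite_bool_lists[of "Suc m" "\<lambda>_. True"]]) auto
  have "{bs :: bool list. length bs = Suc m} = ?S False \<union> ?S True"
    by (auto simp: length_Suc_conv)
  then have "(\<Sum>bs | length bs = Suc m. ?g bs) = sum ?g (?S False) + sum ?g (?S True)"
    using fin by (simp only:) (rule sum.union_disjoint, auto)
  also have "\<dots> = A (xs @ replicate (Suc m) (y + w))"
    unfolding S using multilinear_add[OF A _ Suc.prems(2) sp y w] Suc.prems by simp
  finally show ?case by simp
qed simp

lemma hom_poly_mem: "homogeneous_polynomial n E F P \<Longrightarrow> x \<in> vecs E \<Longrightarrow> P x \<in> vecs F"
  unfolding homogeneous_polynomial_def using multilinear_mem by (fastforce simp: set_replicate_conv_if)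

lemma hom_poly_scal:
  assumes "homogeneous_polynomial n E F P" "x \<in> vecs E"
  shows "P (scal E c x) = scal F (c ^ n) (P x)"
proof -
  obtain A where A: "multilinear n E F A" "\<And>x. x \<in> vecs E \<Longrightarrow> P x = A (replicate n x)"
    using assms unfolding homogeneous_polynomial_def by blast
  show ?thesis using multilinear_scal_all[OF A(1), of "[]" "replicate n x" c] assms(2) A(2)
    by (simp add: set_replicate_conv_if split: if_splits)
qed

lemma hom_poly_zero: "homogeneous_polynomial n E F P \<Longrightarrow> n \<noteq> 0 \<Longrightarrow> P 0 = 0"
  using hom_poly_scal[of n P 0 0] hom_poly_mem[of n P 0] by (simp add: power_0_left)

lemma hom_poly_degree_0: "homogeneous_polynomial 0 E F P \<Longrightarrow> x \<in> vecs E \<Longrightarrow> P x = P 0"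
  unfolding homogeneous_polynomial_def by auto

lemma hom_poly_cong:
  "homogeneous_polynomial n E F P \<Longrightarrow> (\<And>x. x \<in> vecs E \<Longrightarrow> P x = Q x) \<Longrightarrow> homogeneous_polynomial n E F Q"
  unfolding homogeneous_polynomial_def by auto

lemma multilinear_sum:
  assumes "\<And>i. i \<in> I \<Longrightarrow> multilinear n E F (A i)"
  shows "multilinear n E F (\<lambda>xs. \<Sum>i\<in>I. A i xs)"
  unfolding multilinear_def
proof (intro allI impI conjI ballI)
  fix xs assume xs: "length xs = n \<and> set xs \<subseteq> vecs E"
  show "(\<Sum>i\<in>I. A i xs) \<in> vecs F" using assms xs by (auto intro!: F.sum_mem multilinear_mem)
  fix l u c assume l: "l < n" and u: "u \<in> vecs E"
  show "(\<Sum>i\<in>I. A i (xs[l := u + v])) = (\<Sum>i\<in>I. A i (xs[l := u])) + (\<Sum>i\<in>I. A i (xs[l := v]))"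
    if "v \<in> vecs E" for v
    using xs l u that by (simp add: multilinear_update[OF assms] flip: sum.distrib)
  have "set (xs[l := u]) \<subseteq> vecs E" using xs u set_update_subset_insert by fastforce
  then have "A i (xs[l := u]) \<in> vecs F" if "i \<in> I" for i
    using multilinear_mem[OF assms[OF that]] xs by simp
  then show "(\<Sum>i\<in>I. A i (xs[l := scal E c u])) = scal F c (\<Sum>i\<in>I. A i (xs[l := u]))"
    using xs l u by (simp add: F.scal_sum multilinear_update[OF assms])
qed

lemma hom_poly_sum:
  assumes "\<And>i. i \<in> I \<Longrightarrow> homogeneous_polynomial n E F (P i)"
  shows "homogeneous_polynomial n E F (\<lambda>x. \<Sum>i\<in>I. P i x)"
proof -
  obtain A where "\<And>i. i \<in> I \<Longrightarrow> multilinear n E F (A i) \<and> (\<forall>x\<in>vecs E. P i x = A i (replicate n x))"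
    using assms unfolding homogeneous_polynomial_def by metis
  then show ?thesis unfolding homogeneous_polynomial_def
    by (intro exI[of _ "\<lambda>xs. \<Sum>i\<in>I. A i xs"] conjI multilinear_sum) auto
qed

lemma hom_poly_add:
  assumes "homogeneous_polynomial n E F P" "homogeneous_polynomial n E F Q"
  shows "homogeneous_polynomial n E F (P + Q)"
  using hom_poly_sum[of "{True, False}" n "\<lambda>b. if b then P else Q"] assms
  by (simp add: plus_fun_def)

lemma hom_poly_scaled:
  assumes "homogeneous_polynomial n E F P"
  shows "homogeneous_polynomial n E F (\<lambda>x. scal F c (P x))"
proof -
  obtain A where A: "multilinear n E F A" "\<And>x. x \<in> vecs E \<Longrightarrow> P x = A (replicate n x)"
    using assms unfolding homogeneous_polynomial_def by blast
  have "multilinear n E F (\<lambda>xs. scal F c (A xs))"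
    unfolding multilinear_def
  proof (intro allI impI conjI ballI)
    fix xs assume xs: "length xs = n \<and> set xs \<subseteq> vecs E"
    show "scal F c (A xs) \<in> vecs F" using A xs by (auto intro!: F.scal_mem multilinear_mem)
    have upd: "A (xs[l := u]) \<in> vecs F" if "u \<in> vecs E" for u l
      by (rule multilinear_mem[OF A(1)]) (use xs that set_update_subset_insert in fastforce)+
    fix l u d assume l: "l < n" and u: "u \<in> vecs E"
    show "scal F c (A (xs[l := u + v])) = scal F c (A (xs[l := u])) + scal F c (A (xs[l := v]))"
      if "v \<in> vecs E" for v
      using xs l u that upd by (simp add: multilinear_update[OF A(1)] flip: F.scal_add)
    show "scal F c (A (xs[l := scal E d u])) = scal F d (scal F c (A (xs[l := u])))"
      using xs l u upd by (simp add: multilinear_update[OF A(1)] mult.commute)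
  qed
  then show ?thesis unfolding homogeneous_polynomial_def using A(2) by auto
qed

lemma hom_poly_fill:
  assumes A: "multilinear (length bs) E F A" and y: "y \<in> vecs E"
  shows "homogeneous_polynomial (length (filter (\<lambda>b. b) bs)) E F (\<lambda>w. A (map (\<lambda>b. if b then w else y) bs))"
proof -
  have "multilinear (length (filter (\<lambda>b. b) bs)) E F (\<lambda>ws. A (fill y bs ws))"
    unfolding multilinear_def
  proof (intro allI impI conjI ballI)
    fix ws assume ws: "length ws = length (filter (\<lambda>b. b) bs) \<and> set ws \<subseteq> vecs E"
    have fs: "set (fill y bs ws) \<subseteq> vecs E" using set_fill[of ws bs y] ws y by auto
    show "A (fill y bs ws) \<in> vecs F" using multilinear_mem[OF A] fs by simp
    fix i u c assume i: "i < length (filter (\<lambda>b. b) bs)" and u: "u \<in> vecs E"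
    obtain k where k: "k < length bs" "\<And>u. fill y bs (ws[i := u]) = (fill y bs ws)[k := u]"
      using fill_update[OF i, of y] ws by auto
    show "A (fill y bs (ws[i := u + v])) = A (fill y bs (ws[i := u])) + A (fill y bs (ws[i := v]))"
      if "v \<in> vecs E" for v
      using fs k(1) u that unfolding k(2) by (simp add: multilinear_update[OF A])
    show "A (fill y bs (ws[i := scal E c u])) = scal F c (A (fill y bs (ws[i := u])))"
      using fs k(1) u unfolding k(2) by (simp add: multilinear_update[OF A])
  qed
  then show ?thesis unfolding homogeneous_polynomial_def fill_replicate[symmetric] by blast
qed

text \<open>\<open>D j y\<close> collects the terms of degree \<open>j\<close> in \<open>w\<close> of \<open>P (y + w)\<close>.\<close>

lemma hom_poly_taylor:
  assumes P: "homogeneous_polynomial n E F P"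
  shows "\<exists>D. (\<forall>j. \<forall>y\<in>vecs E. homogeneous_polynomial j E F (D j y)) \<and>
    (\<forall>y\<in>vecs E. \<forall>w\<in>vecs E. P (y + w) = (\<Sum>j\<le>n. D j y w) \<and> D 0 y w = P y \<and> D n y w = P w)"
proof -
  obtain A where A: "multilinear n E F A" "\<And>x. x \<in> vecs E \<Longrightarrow> P x = A (replicate n x)"
    using P unfolding homogeneous_polynomial_def by blast
  let ?B = "\<lambda>j. {bs :: bool list. length bs = n \<and> length (filter (\<lambda>b. b) bs) = j}"
  let ?g = "\<lambda>y w bs. A (map (\<lambda>b. if b then w else y) bs)"
  define D where "D = (\<lambda>j y w. \<Sum>bs\<in>?B j. ?g y w bs)"
  show ?thesis
  proof (intro exI[of _ D] conjI ballI allI)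
    fix y assume y: "y \<in> vecs E"
    show "homogeneous_polynomial j E F (D j y)" for j
      unfolding D_def
    proof (rule hom_poly_sum)
      fix bs assume "bs \<in> ?B j"
      then show "homogeneous_polynomial j E F (\<lambda>w. ?g y w bs)"
        using hom_poly_fill[of bs A y] A(1) y by auto
    qed
    fix w assume w: "w \<in> vecs E"
    have "P (y + w) = (\<Sum>bs | length bs = n. ?g y w bs)"
      using multilinear_expand[OF A(1) y w, of "[]" n] A(2) y w by simp
    also have "\<dots> = (\<Sum>j\<le>n. \<Sum>bs\<in>{bs \<in> {bs. length bs = n}. length (filter (\<lambda>b. b) bs) = j}. ?g y w bs)"
      by (rule sum.group[symmetric]) (use finite_bool_lists[of n "\<lambda>_. True"] length_filter_le in auto)
    finally show "P (y + w) = (\<Sum>j\<le>n. D j y w)" by (simp add: D_def)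
    have "bs = replicate n False" if "length bs = n" "length (filter (\<lambda>b. b) bs) = 0" for bs
    proof -
      have "\<forall>b\<in>set bs. b = False" using that by (auto simp: filter_empty_conv)
      then show ?thesis using that(1) by (intro replicate_eqI) auto
    qed
    then have "?B 0 = {replicate n False}" by auto
    then show "D 0 y w = P y" using A(2) y by (simp add: D_def)
    have "bs = replicate n True" if "length bs = n" "length (filter (\<lambda>b. b) bs) = n" for bs
    proof -
      have "\<forall>b\<in>set bs. b = True" using length_filter_less[of _ bs "\<lambda>b. b"] that by fastforce
      then show ?thesis using that(1) by (intro replicate_eqI) auto
    qed
    then have "?B n = {replicate n True}" by auto
    then show "D n y w = P w" using A(2) w by (simp add: D_def)
  qed
qed

section \<open>Boundedness and continuity of homogeneous polynomials\<close>

definition ball_bounded :: "('v \<Rightarrow> 'w) \<Rightarrow> bool" where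
  "ball_bounded P \<longleftrightarrow> (\<exists>C. \<forall>x\<in>vecs E. nrm E x \<le> 1 \<longrightarrow> nrm F (P x) \<le> C)"

lemma hom_poly_ball_bound:
  assumes P: "homogeneous_polynomial n E F P" and C: "\<And>x. x \<in> vecs E \<Longrightarrow> nrm E x \<le> 1 \<Longrightarrow> nrm F (P x) \<le> C"
    and x: "x \<in> vecs E"
  shows "nrm F (P x) \<le> C * nrm E x ^ n"
proof (cases "nrm E x = 0")
  case True
  then have "x = 0" using E.nrm_eq_0 x by auto
  then show ?thesis using C[of 0] hom_poly_zero[OF P] by (cases "n = 0") auto
next
  case False
  then have pos: "nrm E x > 0" using E.nrm_nonneg[OF x] by linarith
  have "nrm F (P (scal E (of_real (inverse (nrm E x))) x)) \<le> C"
    using pos x by (intro C) (auto simp: E.nrm_scal norm_inverse)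
  then have "norm (of_real (inverse (nrm E x)) ^ n :: 'k) * nrm F (P x) \<le> C"
    using hom_poly_scal[OF P x] F.nrm_scal[OF hom_poly_mem[OF P x]] by simp
  then show ?thesis using pos by (simp add: norm_power norm_divide inverse_eq_divide divide_simps mult_ac)
qed

text \<open>
  The components of \<open>P (y + w)\<close> are combinations of the values \<open>P (y + 2^i w)\<close>; so they inherit
  the bounds of \<open>P\<close>, without any continuity assumption on a multilinear map inducing \<open>P\<close>.
\<close>

lemma taylor_bounds:
  assumes P: "homogeneous_polynomial n E F P" and b: "ball_bounded P"
    and D: "\<And>j y. y \<in> vecs E \<Longrightarrow> homogeneous_polynomial j E F (D j y)"
      "\<And>y w. y \<in> vecs E \<Longrightarrow> w \<in> vecs E \<Longrightarrow> P (y + w) = (\<Sum>j\<le>n. D j y w)"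
    and j: "j \<le> n"
  obtains K where "K \<ge> 0" "\<And>y w. y \<in> vecs E \<Longrightarrow> w \<in> vecs E \<Longrightarrow> nrm E y \<le> r \<Longrightarrow> nrm F (D j y w) \<le> K * nrm E w ^ j"
proof -
  obtain C0 where C0: "\<And>x. x \<in> vecs E \<Longrightarrow> nrm E x \<le> 1 \<Longrightarrow> nrm F (P x) \<le> C0"
    using b unfolding ball_bounded_def by blast
  have C0': "C0 \<ge> 0" using C0[of 0] F.nrm_nonneg[OF hom_poly_mem[OF P E.zero_mem]] by simp
  obtain c :: "nat \<Rightarrow> 'k" where c: "\<And>l. l \<le> n \<Longrightarrow> (\<Sum>i\<le>n. c i * (2 ^ i) ^ l) = (if l = j then 1 else 0)"
    using interpolation_coeffs[OF j] by blast
  have Dm: "D l y w \<in> vecs F" if "y \<in> vecs E" "w \<in> vecs E" for l y w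
    using hom_poly_mem[OF D(1)] that by blast
  have ext: "D j y w = (\<Sum>i\<le>n. scal F (c i) (P (y + scal E (2 ^ i) w)))"
    if y: "y \<in> vecs E" and w: "w \<in> vecs E" for y w
  proof -
    have "(\<Sum>i\<le>n. scal F (c i) (P (y + scal E (2 ^ i) w))) = (\<Sum>i\<le>n. \<Sum>l\<le>n. scal F (c i * (2 ^ i) ^ l) (D l y w))"
      using y w by (simp add: D(2) hom_poly_scal[OF D(1)] F.scal_sum Dm)
    also have "\<dots> = (\<Sum>l\<le>n. \<Sum>i\<le>n. scal F (c i * (2 ^ i) ^ l) (D l y w))" by (rule sum.swap)
    also have "\<dots> = (\<Sum>l\<le>n. scal F (\<Sum>i\<le>n. c i * (2 ^ i) ^ l) (D l y w))"
    proof (intro sum.cong refl)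
      fix l
      have "(\<Sum>i\<in>I. scal F (d i) z) = scal F (\<Sum>i\<in>I. d i) z" if "finite I" "z \<in> vecs F" for I :: "nat set" and d z
        using that by (induction I rule: finite_induct) (auto simp: F.scal_plus)
      from this[of "{..n}" "D l y w" "\<lambda>i. c i * (2 ^ i) ^ l"]
      show "(\<Sum>i\<le>n. scal F (c i * (2 ^ i) ^ l) (D l y w)) = scal F (\<Sum>i\<le>n. c i * (2 ^ i) ^ l) (D l y w)"
        using Dm[OF y w] by simp
    qed
    also have "\<dots> = (\<Sum>l\<le>n. if l = j then D l y w else 0)"
      using c Dm[OF y w] by (intro sum.cong) auto
    also have "\<dots> = D j y w" using j by simp
    finally show ?thesis by simp
  qed
  \<comment> \<open>For \<open>w\<close> in the unit ball the vectors \<open>y + 2^i w\<close> have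
    norm at most \<open>\<bar>r\<bar> + 2^i\<close>; general \<open>w\<close> follow from
    homogeneity of degree \<open>j\<close>.\<close>
  define K where "K = (\<Sum>i\<le>n. norm (c i) * (C0 * (\<bar>r\<bar> + 2 ^ i) ^ n))"
  show ?thesis
  proof (rule that[of K])
    show "K \<ge> 0" unfolding K_def using C0' by (intro sum_nonneg mult_nonneg_nonneg) auto
    fix y w assume y: "y \<in> vecs E" "nrm E y \<le> r" and w: "w \<in> vecs E"
    show "nrm F (D j y w) \<le> K * nrm E w ^ j"
    proof (rule hom_poly_ball_bound[OF D(1)[OF y(1)] _ w])
      fix w assume w: "w \<in> vecs E" "nrm E w \<le> 1"
      have "nrm F (D j y w) \<le> (\<Sum>i\<le>n. nrm F (scal F (c i) (P (y + scal E (2 ^ i) w))))"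
        unfolding ext[OF y(1) w(1)] using y w hom_poly_mem[OF P] by (intro F.nrm_sum) auto
      also have "\<dots> \<le> K" unfolding K_def
      proof (rule sum_mono)
        fix i
        have m: "y + scal E (2 ^ i) w \<in> vecs E" using y w by auto
        have "nrm E (y + scal E (2 ^ i) w) \<le> nrm E y + 2 ^ i * nrm E w"
          using E.nrm_add[of y "scal E (2 ^ i) w"] y w by (simp add: E.nrm_scal norm_power)
        also have "\<dots> \<le> \<bar>r\<bar> + 2 ^ i * 1" using y w by (intro add_mono mult_left_mono) auto
        finally have le: "nrm E (y + scal E (2 ^ i) w) \<le> \<bar>r\<bar> + 2 ^ i" by simp
        have "nrm F (P (y + scal E (2 ^ i) w)) \<le> C0 * nrm E (y + scal E (2 ^ i) w) ^ n"
          by (rule hom_poly_ball_bound[OF P C0 m])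
        also have "\<dots> \<le> C0 * (\<bar>r\<bar> + 2 ^ i) ^ n"
          using le m C0' by (intro mult_left_mono power_mono) auto
        finally show "nrm F (scal F (c i) (P (y + scal E (2 ^ i) w))) \<le> norm (c i) * (C0 * (\<bar>r\<bar> + 2 ^ i) ^ n)"
          using hom_poly_mem[OF P m] by (simp add: F.nrm_scal mult_left_mono)
      qed
      finally show "nrm F (D j y w) \<le> K" .
    qed
  qed
qed

text \<open>The component of degree 0 in \<open>h\<close> cancels, and each of the others carries a
  factor \<open>nrm E h\<close> while its remaining powers stay bounded on the ball.\<close>

lemma hom_poly_lipschitz:
  assumes P: "homogeneous_polynomial n E F P" and b: "ball_bounded P"
  shows "\<exists>L\<ge>0. \<forall>x\<in>vecs E. \<forall>h\<in>vecs E. nrm E x \<le> r \<longrightarrow> nrm E h \<le> r \<longrightarrow>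
      nrm F (P (x + h) - P x) \<le> L * nrm E h"
proof -
  obtain D where D': "\<forall>j. \<forall>y\<in>vecs E. homogeneous_polynomial j E F (D j y)"
    "\<forall>y\<in>vecs E. \<forall>w\<in>vecs E. P (y + w) = (\<Sum>j\<le>n. D j y w) \<and> D 0 y w = P y \<and> D n y w = P w"
    using hom_poly_taylor[OF P] by auto
  have D: "\<And>j y. y \<in> vecs E \<Longrightarrow> homogeneous_polynomial j E F (D j y)"
    "\<And>y w. y \<in> vecs E \<Longrightarrow> w \<in> vecs E \<Longrightarrow> P (y + w) = (\<Sum>j\<le>n. D j y w)"
    "\<And>y w. y \<in> vecs E \<Longrightarrow> w \<in> vecs E \<Longrightarrow> D 0 y w = P y"
    using D' by blast+
  have "\<exists>K\<ge>0. \<forall>y w. y \<in> vecs E \<longrightarrow> w \<in> vecs E \<longrightarrow> nrm E y \<le> r \<longrightarrow> nrm F (D j y w) \<le> K * nrm E w ^ j"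
    if "j \<le> n" for j
    by (rule taylor_bounds[OF P b D(1,2) that, of r]) blast+
  then obtain K where K: "\<And>j. j \<le> n \<Longrightarrow> K j \<ge> 0"
    "\<And>j y w. j \<le> n \<Longrightarrow> y \<in> vecs E \<Longrightarrow> w \<in> vecs E \<Longrightarrow> nrm E y \<le> r \<Longrightarrow> nrm F (D j y w) \<le> K j * nrm E w ^ j"
    by metis
  define R where "R = max 1 r"
  show ?thesis
  proof (intro exI[of _ "\<Sum>j\<in>{1..n}. K j * R ^ (j - 1)"] conjI ballI impI)
    show "(\<Sum>j\<in>{1..n}. K j * R ^ (j - 1)) \<ge> 0"
      using K(1) by (intro sum_nonneg mult_nonneg_nonneg) (auto simp: R_def)
    fix x h assume x: "x \<in> vecs E" and h: "h \<in> vecs E" and "nrm E x \<le> r" "nrm E h \<le> r"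
    then have x: "x \<in> vecs E" "nrm E x \<le> r" and h: "h \<in> vecs E" "nrm E h \<le> r" by auto
    have Dm: "D j x h \<in> vecs F" for j using hom_poly_mem[OF D(1)] x h by blast
    have "{..n} = insert 0 {1..n}" by auto
    then have "P (x + h) - P x = (\<Sum>j\<in>{1..n}. D j x h)"
      unfolding D(2)[OF x(1) h(1)] using D(3)[OF x(1) h(1)] by simp
    then have "nrm F (P (x + h) - P x) \<le> (\<Sum>j\<in>{1..n}. nrm F (D j x h))"
      using F.nrm_sum[of "{1..n}" "\<lambda>j. D j x h"] Dm by simp
    also have "\<dots> \<le> (\<Sum>j\<in>{1..n}. K j * R ^ (j - 1) * nrm E h)"
    proof (rule sum_mono)
      fix j assume j: "j \<in> {1..n}"
      have "nrm F (D j x h) \<le> K j * nrm E h ^ j" using K(2) j x h by auto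
      also have "nrm E h ^ j = nrm E h ^ (j - 1) * nrm E h" using j by (cases j) auto
      also have "K j * \<dots> \<le> K j * (R ^ (j - 1) * nrm E h)"
        using h j K(1) by (intro mult_left_mono mult_right_mono power_mono) (auto simp: R_def)
      finally show "nrm F (D j x h) \<le> K j * R ^ (j - 1) * nrm E h" by (simp add: mult.assoc)
    qed
    also have "\<dots> = (\<Sum>j\<in>{1..n}. K j * R ^ (j - 1)) * nrm E h" by (rule sum_distrib_right[symmetric])
    finally show "nrm F (P (x + h) - P x) \<le> (\<Sum>j\<in>{1..n}. K j * R ^ (j - 1)) * nrm E h" .
  qed
qed

text \<open>Continuity at \<open>0\<close> bounds \<open>P\<close> on a small ball, and homogeneity
  transports the bound to the unit ball; the converse is the Lipschitz estimate. In degree 0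
  rescaling yields nothing, but \<open>P\<close> is constant.\<close>

lemma norm_continuous_iff_ball_bounded:
  assumes P: "homogeneous_polynomial n E F P"
  shows "norm_continuous E F P \<longleftrightarrow> ball_bounded P"
proof
  assume c: "norm_continuous E F P"
  show "ball_bounded P"
  proof (cases "n = 0")
    case True
    have "nrm F (P x) \<le> nrm F (P 0)" if "x \<in> vecs E" for x
      by (subst hom_poly_degree_0[of P x]) (use P True that in auto)
    then show ?thesis unfolding ball_bounded_def by blast
  next
    case False
    have "\<exists>\<delta>>0. \<forall>y\<in>vecs E. nrm E (y - 0) < \<delta> \<longrightarrow> nrm F (P y - P 0) < 1"
      using c E.zero_mem unfolding norm_continuous_def by (metis zero_less_one)
    then obtain \<delta> where \<delta>: "\<delta> > 0" "\<And>y. y \<in> vecs E \<Longrightarrow> nrm E y < \<delta> \<Longrightarrow> nrm F (P y) < 1"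
      using hom_poly_zero[OF P False] by auto
    have "nrm F (P x) \<le> inverse ((\<delta>/2) ^ n)" if x: "x \<in> vecs E" "nrm E x \<le> 1" for x
    proof -
      have nd: "norm (of_real (\<delta>/2) :: 'k) = \<delta>/2" using \<delta>(1) by (subst norm_of_real) simp
      have "nrm E (scal E (of_real (\<delta>/2)) x) = \<delta>/2 * nrm E x"
        by (simp only: E.nrm_scal[OF x(1)] nd)
      also have "\<dots> \<le> \<delta>/2 * 1" using x \<delta>(1) by (intro mult_left_mono) auto
      finally have "nrm F (P (scal E (of_real (\<delta>/2)) x)) < 1" using x \<delta> by (intro \<delta>(2)) auto
      then have "(\<delta>/2) ^ n * nrm F (P x) < 1"
        by (simp only: hom_poly_scal[OF P x(1)] F.nrm_scal[OF hom_poly_mem[OF P x(1)]] norm_power nd)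
      moreover have "(\<delta>/2) ^ n > 0" using \<delta>(1) by simp
      ultimately show ?thesis by (simp add: field_simps)
    qed
    then show ?thesis unfolding ball_bounded_def by blast
  qed
next
  assume b: "ball_bounded P"
  show "norm_continuous E F P" unfolding norm_continuous_def
  proof (intro ballI allI impI)
    fix x and e :: real assume x: "x \<in> vecs E" and e: "e > 0"
    obtain L where L: "L \<ge> 0" "\<forall>x'\<in>vecs E. \<forall>h\<in>vecs E. nrm E x' \<le> nrm E x + 1 \<longrightarrow>
        nrm E h \<le> nrm E x + 1 \<longrightarrow> nrm F (P (x' + h) - P x') \<le> L * nrm E h"
      using hom_poly_lipschitz[OF P b, of "nrm E x + 1"] by blast
    show "\<exists>\<delta>>0. \<forall>y\<in>vecs E. nrm E (y - x) < \<delta> \<longrightarrow> nrm F (P y - P x) < e"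
    proof (intro exI[of _ "min 1 (e / (L + 1))"] conjI ballI impI)
      show "0 < min 1 (e / (L + 1))" using e L(1) by simp
      fix y assume y: "y \<in> vecs E" "nrm E (y - x) < min 1 (e / (L + 1))"
      have "nrm E (y - x) \<le> nrm E x + 1" using y E.nrm_nonneg[OF x] by simp
      then have "nrm F (P y - P x) \<le> L * nrm E (y - x)"
        using L(2)[rule_format, of x "y - x"] x y by simp
      also have "\<dots> \<le> L * (e / (L + 1))" using y L(1) by (intro mult_left_mono) auto
      also have "\<dots> < e" using L(1) e by (simp add: field_simps)
      finally show "nrm F (P y - P x) < e" .
    qed
  qed
qed

section \<open>The normed space of continuous homogeneous polynomials\<close>

abbreviation "PS n \<equiv> poly_space n E F"

lemma mem_poly_space_iff:
  "P \<in> vecs (PS n) \<longleftrightarrow> homogeneous_polynomial n E F P \<and> ball_bounded P \<and> (\<forall>x. x \<notin> vecs E \<longrightarrow> P x = 0)"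
  using norm_continuous_iff_ball_bounded by (auto simp: poly_space_def)

lemma scal_poly_space: "scal (PS n) c P = (\<lambda>x. scal F c (P x))"
  by (simp add: poly_space_def)

context
  fixes P n assumes P: "P \<in> vecs (PS n)"
begin

lemma ps_hom: "homogeneous_polynomial n E F P" and ps_bounded: "ball_bounded P"
  and ps_outside: "x \<notin> vecs E \<Longrightarrow> P x = 0"
  using P by (auto simp: mem_poly_space_iff)

lemma ps_mem: "x \<in> vecs E \<Longrightarrow> P x \<in> vecs F"
  using hom_poly_mem[OF ps_hom] .

lemma ps_nrm_ball: "x \<in> vecs E \<Longrightarrow> nrm E x \<le> 1 \<Longrightarrow> nrm F (P x) \<le> nrm (PS n) P"
proof -
  assume x: "x \<in> vecs E" "nrm E x \<le> 1"
  have "bdd_above ((\<lambda>x. nrm F (P x)) ` {x \<in> vecs E. nrm E x \<le> 1})"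
    using ps_bounded unfolding ball_bounded_def by (auto simp: bdd_above_def)
  then show ?thesis using x unfolding poly_space_def by (auto intro: cSUP_upper)
qed

lemma ps_nrm: "x \<in> vecs E \<Longrightarrow> nrm F (P x) \<le> nrm (PS n) P * nrm E x ^ n"
  by (rule hom_poly_ball_bound[OF ps_hom ps_nrm_ball])

lemma ps_nrm_nonneg: "0 \<le> nrm (PS n) P"
  using ps_nrm_ball[of 0] F.nrm_nonneg[OF ps_mem[of 0]] by simp

end

lemma ps_nrm_le: "(\<And>x. x \<in> vecs E \<Longrightarrow> nrm E x \<le> 1 \<Longrightarrow> nrm F (P x) \<le> C) \<Longrightarrow> nrm (PS n) P \<le> C"
  unfolding poly_space_def using E.nrm_zero E.zero_mem
  by (simp, intro cSUP_least) (force)+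

lemma ps_zero: "0 \<in> vecs (PS n)"
  unfolding mem_poly_space_iff ball_bounded_def
  using hom_poly_sum[of "{}" n] by (auto elim!: hom_poly_cong intro!: exI[of _ 0])

lemma ps_add:
  assumes P: "P \<in> vecs (PS n)" and Q: "Q \<in> vecs (PS n)" shows "P + Q \<in> vecs (PS n)"
proof -
  have "nrm F ((P + Q) x) \<le> nrm (PS n) P + nrm (PS n) Q" if "x \<in> vecs E" "nrm E x \<le> 1" for x
    using F.nrm_add[OF ps_mem[OF P] ps_mem[OF Q]] ps_nrm_ball[OF P that] ps_nrm_ball[OF Q that] that(1)
    by (fastforce intro: order_trans)
  then show ?thesis
    using hom_poly_add[OF ps_hom[OF P] ps_hom[OF Q]] ps_outside[OF P] ps_outside[OF Q]
    unfolding mem_poly_space_iff ball_bounded_def by auto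
qed

lemma ps_scal:
  assumes P: "P \<in> vecs (PS n)" shows "scal (PS n) c P \<in> vecs (PS n)"
proof -
  have "nrm F (scal F c (P x)) \<le> norm c * nrm (PS n) P" if "x \<in> vecs E" "nrm E x \<le> 1" for x
    using F.nrm_scal[OF ps_mem[OF P that(1)]] ps_nrm_ball[OF P that] by (simp add: mult_left_mono)
  then show ?thesis
    using hom_poly_scaled[OF ps_hom[OF P]] ps_outside[OF P]
    unfolding mem_poly_space_iff ball_bounded_def scal_poly_space by auto
qed

lemma ps_eqI:
  assumes P: "P \<in> vecs (PS n)" and Q: "Q \<in> vecs (PS n)" and eq: "\<And>x. x \<in> vecs E \<Longrightarrow> P x = Q x"
  shows "P = Q"
  using ps_outside[OF P] ps_outside[OF Q] eq by (metis ext)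

lemma normed_poly_space: "normed_nspace (PS n)"
proof
  show "0 \<in> vecs (PS n)" by (rule ps_zero)
  fix P Q assume P: "P \<in> vecs (PS n)"
  show "scal (PS n) c P \<in> vecs (PS n)" for c by (rule ps_scal[OF P])
  show "scal (PS n) (c + d) P = scal (PS n) c P + scal (PS n) d P" for c d
    by (rule ps_eqI[OF ps_scal[OF P] ps_add[OF ps_scal[OF P] ps_scal[OF P]]])
      (use ps_mem[OF P] in \<open>simp add: scal_poly_space F.scal_plus\<close>)
  show "scal (PS n) c (scal (PS n) d P) = scal (PS n) (c * d) P" for c d
    by (rule ps_eqI[OF ps_scal[OF ps_scal[OF P]] ps_scal[OF P]])
      (use ps_mem[OF P] in \<open>simp add: scal_poly_space\<close>)
  show "scal (PS n) 1 P = P"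
    by (rule ps_eqI[OF ps_scal[OF P] P]) (use ps_mem[OF P] in \<open>simp add: scal_poly_space\<close>)
  have le: "nrm (PS n) (scal (PS n) c P) \<le> norm c * nrm (PS n) P" if P: "P \<in> vecs (PS n)" for c P
    using ps_nrm_ball[OF P] F.nrm_scal[OF ps_mem[OF P]]
    by (intro ps_nrm_le) (simp add: scal_poly_space mult_left_mono)
  show "nrm (PS n) (scal (PS n) c P) = norm c * nrm (PS n) P" for c
  proof (cases "c = 0")
    case True
    then show ?thesis using le[OF P, of c] ps_nrm_nonneg[OF ps_scal[OF P], of c] by auto
  next
    case False
    have inv: "scal (PS n) (inverse c) (scal (PS n) c P) = P"
      by (rule ps_eqI[OF ps_scal[OF ps_scal[OF P]] P])
        (use ps_mem[OF P] False in \<open>simp add: scal_poly_space\<close>)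
    have "nrm (PS n) P \<le> norm (inverse c) * nrm (PS n) (scal (PS n) c P)"
      using le[OF ps_scal[OF P, of c], of "inverse c"] inv by simp
    then have "norm c * nrm (PS n) P \<le> nrm (PS n) (scal (PS n) c P)"
      using False by (simp add: norm_divide inverse_eq_divide divide_simps mult_ac)
    then show ?thesis using le[OF P, of c] by simp
  qed
  show "P = 0" if "nrm (PS n) P = 0"
  proof (rule ps_eqI[OF P ps_zero])
    fix x assume x: "x \<in> vecs E"
    show "P x = 0 x" using ps_nrm[OF P x] that F.nrm_nonneg[OF ps_mem[OF P x]]
        F.nrm_eq_0[OF ps_mem[OF P x]] by simp
  qed
  assume Q: "Q \<in> vecs (PS n)"
  show "P + Q \<in> vecs (PS n)" by (rule ps_add[OF P Q])
  show "scal (PS n) c (P + Q) = scal (PS n) c P + scal (PS n) c Q" for c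
    by (rule ps_eqI[OF ps_scal[OF ps_add[OF P Q]] ps_add[OF ps_scal[OF P] ps_scal[OF Q]]])
      (use ps_mem[OF P] ps_mem[OF Q] in \<open>simp add: scal_poly_space F.scal_add\<close>)
  show "nrm (PS n) (P + Q) \<le> nrm (PS n) P + nrm (PS n) Q"
    using F.nrm_add[OF ps_mem[OF P] ps_mem[OF Q]] ps_nrm_ball[OF P] ps_nrm_ball[OF Q]
    by (intro ps_nrm_le) (fastforce intro: order_trans)
qed

lemma hom_poly_comp:
  assumes P: "homogeneous_polynomial n E F P"
    and T: "\<And>x. x \<in> vecs E \<Longrightarrow> T x \<in> vecs E"
      "\<And>x y. x \<in> vecs E \<Longrightarrow> y \<in> vecs E \<Longrightarrow> T (x + y) = T x + T y"
      "\<And>c x. x \<in> vecs E \<Longrightarrow> T (scal E c x) = scal E c (T x)"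
  shows "homogeneous_polynomial n E F (\<lambda>x. P (T x))"
proof -
  obtain A where A: "multilinear n E F A" "\<And>x. x \<in> vecs E \<Longrightarrow> P x = A (replicate n x)"
    using P unfolding homogeneous_polynomial_def by blast
  have "multilinear n E F (\<lambda>xs. A (map T xs))"
    unfolding multilinear_def
  proof (intro allI impI conjI ballI)
    fix xs assume xs: "length xs = n \<and> set xs \<subseteq> vecs E"
    then have Txs: "length (map T xs) = n" "set (map T xs) \<subseteq> vecs E" using T(1) by auto
    show "A (map T xs) \<in> vecs F" using multilinear_mem[OF A(1) Txs] .
    fix i u c assume i: "i < n" and u: "u \<in> vecs E"
    show "A (map T (xs[i := u + v])) = A (map T (xs[i := u])) + A (map T (xs[i := v]))"
      if v: "v \<in> vecs E" for v
      using multilinear_update(1)[OF A(1) Txs i T(1) T(1), OF u v] u v by (simp add: map_update T)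
    show "A (map T (xs[i := scal E c u])) = scal F c (A (map T (xs[i := u])))"
      using multilinear_update(2)[OF A(1) Txs i T(1), OF u] u by (simp add: map_update T)
  qed
  then show ?thesis unfolding homogeneous_polynomial_def using A(2) T(1) by auto
qed

lemma ps_comp:
  assumes P: "P \<in> vecs (PS n)"
    and T: "\<And>x. x \<in> vecs E \<Longrightarrow> T x \<in> vecs E"
      "\<And>x y. x \<in> vecs E \<Longrightarrow> y \<in> vecs E \<Longrightarrow> T (x + y) = T x + T y"
      "\<And>c x. x \<in> vecs E \<Longrightarrow> T (scal E c x) = scal E c (T x)"
    and le: "\<And>x. x \<in> vecs E \<Longrightarrow> nrm E (T x) \<le> nrm E x"
  shows "(\<lambda>x. if x \<in> vecs E then P (T x) else 0) \<in> vecs (PS n)" (is "?Q \<in> _")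
    and "nrm (PS n) (\<lambda>x. if x \<in> vecs E then P (T x) else 0) \<le> nrm (PS n) P"
proof -
  have b: "nrm F (?Q x) \<le> nrm (PS n) P" if "x \<in> vecs E" "nrm E x \<le> 1" for x
    using ps_nrm_ball[OF P T(1)[OF that(1)]] le[OF that(1)] that by simp
  then show "nrm (PS n) ?Q \<le> nrm (PS n) P" by (rule ps_nrm_le)
  have "homogeneous_polynomial n E F ?Q"
    by (rule hom_poly_cong[OF hom_poly_comp[OF ps_hom[OF P] T]]) auto
  then show "?Q \<in> vecs (PS n)" unfolding mem_poly_space_iff ball_bounded_def using b by auto
qed

section \<open>Weakly continuous polynomials as a closed subspace\<close>

lemma weakly_continuous_add:
  assumes P: "P \<in> polys_w n E F" and Q: "Q \<in> polys_w n E F"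
  shows "P + Q \<in> polys_w n E F"
proof -
  have PQ: "P \<in> vecs (PS n)" "Q \<in> vecs (PS n)" using P Q by (auto simp: polys_w_def)
  have "weakly_continuous_on_bounded E F (P + Q)"
    unfolding weakly_continuous_on_bounded_def
  proof (intro allI ballI impI)
    fix G M x assume x: "x \<in> vecs E"
      and h: "(\<forall>\<^sub>F y in G. y \<in> vecs E \<and> nrm E y \<le> M) \<and> weakly_converges E G x"
    have "((\<lambda>y. nrm F (P y - P x) + nrm F (Q y - Q x)) \<longlongrightarrow> 0 + 0) G"
      using P Q x h unfolding polys_w_def weakly_continuous_on_bounded_def by (intro tendsto_add) blast+
    then show "((\<lambda>y. nrm F ((P + Q) y - (P + Q) x)) \<longlongrightarrow> 0) G"
    proof (rule Lim_null_comparison[rotated, OF tendsto_eq_rhs])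
      show "\<forall>\<^sub>F y in G. norm (nrm F ((P + Q) y - (P + Q) x)) \<le> nrm F (P y - P x) + nrm F (Q y - Q x)"
        using conjunct1[OF h]
      proof eventually_elim
        case (elim y)
        have "(P + Q) y - (P + Q) x = (P y - P x) + (Q y - Q x)" by simp
        then show ?case using elim x ps_mem[OF PQ(1)] ps_mem[OF PQ(2)]
          by (metis F.nrm_add F.diff_mem F.add_mem F.nrm_nonneg real_norm_def abs_of_nonneg)
      qed
    qed simp
  qed
  then show ?thesis using ps_add[OF PQ] by (simp add: polys_w_def)
qed

lemma weakly_continuous_scal:
  assumes P: "P \<in> polys_w n E F" shows "scal (PS n) c P \<in> polys_w n E F"
proof -
  have P': "P \<in> vecs (PS n)" using P by (auto simp: polys_w_def)
  have "weakly_continuous_on_bounded E F (scal (PS n) c P)"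
    unfolding weakly_continuous_on_bounded_def
  proof (intro allI ballI impI)
    fix G M x assume x: "x \<in> vecs E"
      and h: "(\<forall>\<^sub>F y in G. y \<in> vecs E \<and> nrm E y \<le> M) \<and> weakly_converges E G x"
    have "((\<lambda>y. norm c * nrm F (P y - P x)) \<longlongrightarrow> norm c * 0) G"
      using P x h unfolding polys_w_def weakly_continuous_on_bounded_def
      by (intro tendsto_mult tendsto_const) blast
    moreover have "\<forall>\<^sub>F y in G. norm c * nrm F (P y - P x) = nrm F (scal (PS n) c P y - scal (PS n) c P x)"
      using conjunct1[OF h] by eventually_elim
        (use x ps_mem[OF P'] in \<open>simp add: scal_poly_space F.scal_diff[symmetric] F.nrm_scal\<close>)
    ultimately show "((\<lambda>y. nrm F (scal (PS n) c P y - scal (PS n) c P x)) \<longlongrightarrow> 0) G"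
      by (simp add: tendsto_cong)
  qed
  then show ?thesis using ps_scal[OF P'] by (simp add: polys_w_def)
qed

lemma closed_subspace_polys_w: "closed_subspace (polys_w n E F) (PS n)"
  unfolding closed_subspace_def
proof (intro conjI ballI allI impI)
  interpret S: normed_nspace "PS n" by (rule normed_poly_space)
  show "polys_w n E F \<subseteq> vecs (PS n)" by (auto simp: polys_w_def)
  show "0 \<in> polys_w n E F"
    by (simp add: polys_w_def ps_zero weakly_continuous_on_bounded_def)
  fix P
  show "P + Q \<in> polys_w n E F" if "P \<in> polys_w n E F" "Q \<in> polys_w n E F" for Q
    using weakly_continuous_add that .
  show "scal (PS n) c P \<in> polys_w n E F" if "P \<in> polys_w n E F" for c
    using weakly_continuous_scal that .
  assume P: "P \<in> vecs (PS n)" and lim: "\<forall>\<epsilon>>0. \<exists>Q\<in>polys_w n E F. nrm (PS n) (Q - P) < \<epsilon>"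
  have "weakly_continuous_on_bounded E F P"
    unfolding weakly_continuous_on_bounded_def
  proof (intro allI ballI impI)
    fix G M x assume x: "x \<in> vecs E"
      and h: "(\<forall>\<^sub>F y in G. y \<in> vecs E \<and> nrm E y \<le> M) \<and> weakly_converges E G x"
    \<comment> \<open>Bounds the \<open>n\<close>-th power of the norm at \<open>x\<close> and along
      the net, so that a norm-close \<open>Q\<close> is within \<open>e/3\<close> of
      \<open>P\<close> at all these points.\<close>
    define R where "R = max \<bar>M\<bar> (nrm E x) ^ n"
    have R: "R \<ge> 0" by (simp add: R_def)
    show "((\<lambda>y. nrm F (P y - P x)) \<longlongrightarrow> 0) G"
    proof (rule tendstoI)
      fix e :: real assume e: "e > 0"
      obtain Q where Q: "Q \<in> polys_w n E F" "nrm (PS n) (Q - P) < e / (3 * (R + 1))"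
        using lim e R by (metis add_nonneg_pos divide_pos_pos mult_pos_pos zero_less_numeral zero_less_one)
      have Q': "Q \<in> vecs (PS n)" and QP: "Q - P \<in> vecs (PS n)"
        using Q P S.diff_mem by (auto simp: polys_w_def)
      have close: "nrm F (Q y - P y) < e/3" if y: "y \<in> vecs E" "nrm E y \<le> max \<bar>M\<bar> (nrm E x)" for y
      proof -
        have "nrm F (Q y - P y) \<le> nrm (PS n) (Q - P) * nrm E y ^ n"
          using ps_nrm[OF QP y(1)] by simp
        also have "\<dots> \<le> (e / (3 * (R + 1))) * R"
          unfolding R_def[symmetric] using Q(2) e R y ps_nrm_nonneg[OF QP]
          by (intro mult_mono) (auto simp: R_def intro!: power_mono)
        also have "\<dots> < e/3" using e R by (simp add: field_simps)
        finally show ?thesis .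
      qed
      have "((\<lambda>y. nrm F (Q y - Q x)) \<longlongrightarrow> 0) G"
        using Q(1) x h unfolding polys_w_def weakly_continuous_on_bounded_def by blast
      then have "\<forall>\<^sub>F y in G. nrm F (Q y - Q x) < e/3" using e by (intro order_tendstoD(2)) auto
      then show "\<forall>\<^sub>F y in G. dist (nrm F (P y - P x)) 0 < e"
        using conjunct1[OF h]
      proof eventually_elim
        case (elim y)
        have m: "P y \<in> vecs F" "P x \<in> vecs F" "Q y \<in> vecs F" "Q x \<in> vecs F"
          using ps_mem[OF P] ps_mem[OF Q'] elim x by auto
        have "P y - P x = (Q x - P x) - ((Q y - P y) - (Q y - Q x))" by simp
        moreover have "nrm F ((Q x - P x) - ((Q y - P y) - (Q y - Q x)))
            \<le> nrm F (Q x - P x) + (nrm F (Q y - P y) + nrm F (Q y - Q x))"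
          using m F.nrm_diff[of "Q x - P x" "(Q y - P y) - (Q y - Q x)"]
            F.nrm_diff[of "Q y - P y" "Q y - Q x"] by simp
        moreover have "nrm F (Q y - P y) < e/3" "nrm F (Q x - P x) < e/3"
          using close elim x by auto
        ultimately have "nrm F (P y - P x) < e" using elim by simp
        then show ?case using m by simp
      qed
    qed
  qed
  then show "P \<in> polys_w n E F" using P by (simp add: polys_w_def)
qed

end

subsection \<open>The spaces of p-summable sequences\<close>

text \<open>The case of positive \<open>a\<close> and \<open>b\<close> is convexity of the power
  function. If one of them vanishes, the claim reduces to \<open>s powr p \<le> s\<close> for
  \<open>s\<close> in the unit interval.\<close>

lemma powr_convex_nonneg:
  fixes a b t p :: real
  assumes "p \<ge> 1" "0 \<le> a" "0 \<le> b" "0 \<le> t" "t \<le> 1"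
  shows "(t * a + (1 - t) * b) powr p \<le> t * a powr p + (1 - t) * b powr p"
proof -
  have le: "s powr p \<le> s" if "0 \<le> s" "s \<le> 1" for s :: real
    using powr_mono'[of 1 p s] assms(1) that by (cases "s = 0") auto
  consider "a = 0" | "b = 0" | "a > 0" "b > 0" using assms by linarith
  then show ?thesis
  proof cases
    case 1
    then show ?thesis using le[of "1 - t"] assms by (simp add: powr_mult mult_right_mono)
  next
    case 2
    then show ?thesis using le[of t] assms by (simp add: powr_mult mult_right_mono)
  next
    case 3
    then show ?thesis using convex_onD[OF powr_convex[OF assms(1)], of "1 - t" a b] assms by simp
  qed
qed

definition trunc :: "nat \<Rightarrow> (nat \<Rightarrow> 'k::zero) \<Rightarrow> nat \<Rightarrow> 'k" where
  "trunc N x = (\<lambda>i. if i < N then x i else 0)"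

definition single :: "nat \<Rightarrow> 'k::zero \<Rightarrow> nat \<Rightarrow> 'k" where
  "single i c = (\<lambda>j. if j = i then c else 0)"

lemma trunc_apply [simp]: "trunc N x i = (if i < N then x i else 0)"
  by (simp add: trunc_def)

lemma single_apply [simp]: "single i c j = (if j = i then c else 0)"
  by (simp add: single_def)

lemma trunc_add: "trunc N (x + y) = trunc N x + trunc N y" for x :: "nat \<Rightarrow> 'k::monoid_add"
  by auto

lemma trunc_diff: "trunc N (x - y) = trunc N x - trunc N y" for x :: "nat \<Rightarrow> 'k::group_add"
  by auto

lemma trunc_trunc [simp]: "trunc N (trunc M x) = trunc (min M N) x"
  by auto

definition pnorm2 :: "real \<Rightarrow> real \<Rightarrow> real \<Rightarrow> real" where
  "pnorm2 p a b = (a powr p + b powr p) powr (1 / p)"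

locale ell_exponent =
  fixes p :: real
  assumes p: "1 < p"
begin

lemma mem_ell: "x \<in> vecs (ell p) \<longleftrightarrow> summable (\<lambda>i. norm (x i) powr p)"
  by (simp add: ell_def)

lemma scal_ell: "scal (ell p) c x = (\<lambda>i. c * x i)"
  by (simp add: ell_def)

lemma nrm_ell: "nrm (ell p) x = (\<Sum>i. norm (x i) powr p) powr (1 / p)"
  by (simp add: ell_def)

lemma powr_inverse_cancel [simp]: "0 \<le> a \<Longrightarrow> (a powr (1 / p)) powr p = a" "0 \<le> a \<Longrightarrow> (a powr p) powr (1 / p) = a"
  using p by (auto simp: powr_powr)

lemma powr_p_le_iff: "0 \<le> a \<Longrightarrow> 0 \<le> b \<Longrightarrow> a powr p \<le> b powr p \<longleftrightarrow> a \<le> b"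
  using p powr_mono2[of p a b] powr_less_mono2[of p b a] by (meson not_le less_eq_real_def order_trans zero_le_one)

lemma nrm_ell_powr: "x \<in> vecs (ell p) \<Longrightarrow> nrm (ell p) x powr p = (\<Sum>i. norm (x i) powr p)"
  unfolding nrm_ell by (rule powr_inverse_cancel) (auto simp: mem_ell suminf_nonneg)

lemma ell_nonneg: "0 \<le> nrm (ell p) x"
  by (simp add: nrm_ell)

lemma nrm_ell_le_iff: "x \<in> vecs (ell p) \<Longrightarrow> 0 \<le> C \<Longrightarrow> nrm (ell p) x \<le> C \<longleftrightarrow> (\<Sum>i. norm (x i) powr p) \<le> C powr p"
  using powr_p_le_iff[OF ell_nonneg, of C x] by (simp add: nrm_ell_powr)

lemma ell_scal_nrm:
  fixes x :: "nat \<Rightarrow> 'k::real_normed_field"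
  assumes "x \<in> vecs (ell p)"
  shows "nrm (ell p) (scal (ell p) c x) = norm c * nrm (ell p) x"
proof -
  have "(\<Sum>i. norm (c * x i) powr p) = norm c powr p * (\<Sum>i. norm (x i) powr p)"
    using assms by (simp add: norm_mult powr_mult mem_ell suminf_mult)
  then show ?thesis by (simp add: nrm_ell scal_ell powr_mult)
qed

lemma ell_coord:
  assumes "x \<in> vecs (ell p)" shows "norm (x i) \<le> nrm (ell p) x"
proof -
  have "norm (x i) powr p \<le> (\<Sum>i. norm (x i) powr p)"
    using sum_le_suminf[of "\<lambda>i. norm (x i) powr p" "{i}"] assms by (simp add: mem_ell)
  then show ?thesis using assms by (simp add: nrm_ell_powr[symmetric] powr_p_le_iff ell_nonneg)
qed

text \<open>With \<open>t = a / (a + b)\<close>, the sum is \<open>a + b\<close> times a convex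
  combination of the normalised vectors. Convexity then gives the majorant \<open>g\<close> of the
  terms, whose sum \<open>(a + b) powr p\<close> yields both summability and the norm bound.\<close>

lemma ell_add:
  fixes x y :: "nat \<Rightarrow> 'k::real_normed_field"
  assumes x: "x \<in> vecs (ell p)" and y: "y \<in> vecs (ell p)"
  shows "x + y \<in> vecs (ell p)" "nrm (ell p) (x + y) \<le> nrm (ell p) x + nrm (ell p) y"
proof -
  define a where "a = nrm (ell p) x" define b where "b = nrm (ell p) y"
  have ab: "a \<ge> 0" "b \<ge> 0" by (auto simp: a_def b_def ell_nonneg)
  have "x + y \<in> vecs (ell p) \<and> nrm (ell p) (x + y) \<le> a + b"
  proof (cases "a = 0 \<or> b = 0")
    case True
    have "x = 0" if "a = 0" using ell_coord[OF x] that by (auto simp: a_def)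
    moreover have "y = 0" if "b = 0" using ell_coord[OF y] that by (auto simp: b_def)
    ultimately show ?thesis using True x y ab by (auto simp: a_def b_def)
  next
    case False
    then have pos: "a > 0" "b > 0" using ab by auto
    define t where "t = a / (a + b)"
    have t: "0 \<le> t" "t \<le> 1" "1 - t = b / (a + b)" using pos by (auto simp: t_def field_simps)
    define g where "g = (\<lambda>i. (a + b) powr p * (t * (norm (x i) powr p / a powr p) + (1 - t) * (norm (y i) powr p / b powr p)))"
    have bound: "norm (x i + y i) powr p \<le> g i" for i
    proof -
      have "norm (x i + y i) \<le> norm (x i) + norm (y i)" by (rule norm_triangle_ineq)
      also have "\<dots> = (a + b) * (t * (norm (x i) / a) + (1 - t) * (norm (y i) / b))"
      proof -
        have "(a + b) * t = a" "(a + b) * (1 - t) = b" using pos unfolding t(3) by (simp_all add: t_def)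
        then have "(a + b) * (t * (norm (x i) / a) + (1 - t) * (norm (y i) / b))
            = a * (norm (x i) / a) + b * (norm (y i) / b)"
          by (simp only: distrib_left mult.assoc[symmetric])
        then show ?thesis using pos by simp
      qed
      finally have "norm (x i + y i) powr p \<le> ((a + b) * (t * (norm (x i) / a) + (1 - t) * (norm (y i) / b))) powr p"
        using p by (intro powr_mono2) auto
      also have "\<dots> \<le> (a + b) powr p * (t * (norm (x i) / a) powr p + (1 - t) * (norm (y i) / b) powr p)"
        unfolding powr_mult[of "a + b"] using p t pos by (intro mult_left_mono powr_convex_nonneg) auto
      finally show ?thesis by (simp add: g_def powr_divide)
    qed
    have sx: "(\<lambda>i. norm (x i) powr p) sums a powr p" and sy: "(\<lambda>i. norm (y i) powr p) sums b powr p"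
      using x y by (auto simp: a_def b_def nrm_ell_powr mem_ell summable_sums)
    have "g sums ((a + b) powr p * (t * (a powr p / a powr p) + (1 - t) * (b powr p / b powr p)))"
      unfolding g_def by (intro sums_mult sums_add sums_divide sx sy)
    also have "t * (a powr p / a powr p) + (1 - t) * (b powr p / b powr p) = 1" using pos by simp
    finally have g: "g sums ((a + b) powr p)" by simp
    have mem: "x + y \<in> vecs (ell p)" unfolding mem_ell
      by (rule summable_comparison_test'[OF sums_summable[OF g], of 0]) (use bound in simp)
    moreover have "(\<Sum>i. norm ((x + y) i) powr p) \<le> (a + b) powr p"
      using mem bound unfolding mem_ell sums_unique[OF g]
      by (intro suminf_le) (auto intro: sums_summable[OF g])
    ultimately show ?thesis using pos by (simp add: nrm_ell_le_iff)
  qed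
  then show "x + y \<in> vecs (ell p)" "nrm (ell p) (x + y) \<le> nrm (ell p) x + nrm (ell p) y"
    by (auto simp: a_def b_def)
qed

lemma normed_ell: "normed_nspace (ell p :: ('k::real_normed_field, nat \<Rightarrow> 'k) nspace)"
proof
  show "(0 :: nat \<Rightarrow> 'k) \<in> vecs (ell p)" by (simp add: mem_ell)
  fix x y :: "nat \<Rightarrow> 'k" and c d
  assume x: "x \<in> vecs (ell p)"
  show "scal (ell p) c x \<in> vecs (ell p)"
    using x by (simp add: mem_ell scal_ell norm_mult powr_mult summable_mult)
  show "x = 0" if "nrm (ell p) x = 0" using ell_coord[OF x] that by auto
  show "x + y \<in> vecs (ell p)" "nrm (ell p) (x + y) \<le> nrm (ell p) x + nrm (ell p) y" if "y \<in> vecs (ell p)"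
    using ell_add[OF x that] by auto
  show "nrm (ell p) (scal (ell p) c x) = norm c * nrm (ell p) x" by (rule ell_scal_nrm[OF x])
qed (auto simp: scal_ell algebra_simps)

end

sublocale ell_exponent \<subseteq> ell: normed_nspace "ell p :: ('k::real_normed_field, nat \<Rightarrow> 'k) nspace"
  by (rule normed_ell)

section \<open>Disjoint supports, truncations and tails\<close>

context ell_exponent
begin

lemma ell_disjoint_add:
  fixes x y :: "nat \<Rightarrow> 'k::real_normed_field"
  assumes "x \<in> vecs (ell p)" "y \<in> vecs (ell p)" "\<And>i. x i = 0 \<or> y i = 0"
  shows "nrm (ell p) (x + y) powr p = nrm (ell p) x powr p + nrm (ell p) y powr p"
proof -
  have "norm ((x + y) i) powr p = norm (x i) powr p + norm (y i) powr p" for i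
    using assms(3)[of i] by auto
  then have "(\<Sum>i. norm ((x + y) i) powr p) = (\<Sum>i. norm (x i) powr p) + (\<Sum>i. norm (y i) powr p)"
    using assms(1,2) by (simp add: suminf_add mem_ell)
  then show ?thesis using assms(1,2) ell_add(1)[OF assms(1,2)] by (simp add: nrm_ell_powr)
qed

lemma ell_mono:
  fixes x y :: "nat \<Rightarrow> 'k::real_normed_field"
  assumes y: "y \<in> vecs (ell p)" and le: "\<And>i. norm (x i) \<le> norm (y i)"
  shows "x \<in> vecs (ell p)" "nrm (ell p) x \<le> nrm (ell p) y"
proof -
  have b: "norm (x i) powr p \<le> norm (y i) powr p" for i using le p by (intro powr_mono2) auto
  show x: "x \<in> vecs (ell p)" unfolding mem_ell
    by (rule summable_comparison_test'[of "\<lambda>i. norm (y i) powr p" 0]) (use y b in \<open>auto simp: mem_ell\<close>)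
  have "(\<Sum>i. norm (x i) powr p) \<le> (\<Sum>i. norm (y i) powr p)"
    using x y b unfolding mem_ell by (intro suminf_le) auto
  then show "nrm (ell p) x \<le> nrm (ell p) y" using x y by (simp add: nrm_ell_le_iff ell_nonneg nrm_ell_powr)
qed

lemma trunc_mem [simp]: "x \<in> vecs (ell p) \<Longrightarrow> trunc N x \<in> vecs (ell p)" for x :: "nat \<Rightarrow> 'k::real_normed_field"
  by (rule ell_mono(1)) auto

lemma nrm_trunc_le: "x \<in> vecs (ell p) \<Longrightarrow> nrm (ell p) (trunc N x) \<le> nrm (ell p) x" for x :: "nat \<Rightarrow> 'k::real_normed_field"
  by (rule ell_mono(2)) auto

lemma nrm_tail_le: "x \<in> vecs (ell p) \<Longrightarrow> nrm (ell p) (x - trunc N x) \<le> nrm (ell p) x" for x :: "nat \<Rightarrow> 'k::real_normed_field"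
  by (rule ell_mono(2)) auto

lemma trunc_scal: "trunc N (scal (ell p) c x) = scal (ell p) c (trunc N x)" for x :: "nat \<Rightarrow> 'k::real_normed_field"
  by (auto simp: scal_ell)

lemma nrm_split:
  fixes x :: "nat \<Rightarrow> 'k::real_normed_field"
  assumes "x \<in> vecs (ell p)"
  shows "nrm (ell p) x powr p = nrm (ell p) (trunc N x) powr p + nrm (ell p) (x - trunc N x) powr p"
  using ell_disjoint_add[of "trunc N x" "x - trunc N x"] assms by auto

lemma single_sums: "(\<lambda>j. norm (single i c j) powr p) sums (norm c powr p)" for c :: "'k::real_normed_field"
  using sums_If_finite_set'[of "\<lambda>_. 0" 0 "{i}" "norm c powr p" "\<lambda>_. norm c powr p"]
  by (rule sums_cong[THEN iffD1, rotated]) auto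

lemma single_mem [simp]: "single i c \<in> vecs (ell p)" for c :: "'k::real_normed_field"
  using sums_summable[OF single_sums] by (simp only: mem_ell)

lemma nrm_single [simp]: "nrm (ell p) (single i c) = norm c" for c :: "'k::real_normed_field"
  using single_sums[of i c] by (simp only: nrm_ell sums_unique[symmetric] powr_inverse_cancel norm_ge_zero)

lemma nrm_trunc_le_sum: "x \<in> vecs (ell p) \<Longrightarrow> nrm (ell p) (trunc N x) \<le> (\<Sum>i<N. norm (x i))"
  for x :: "nat \<Rightarrow> 'k::real_normed_field"
proof (induction N)
  case 0
  have "trunc 0 x = 0" by auto
  then show ?case by (simp only: ell.nrm_zero) simp
next
  case (Suc N)
  have "trunc (Suc N) x = trunc N x + single N (x N)" by auto
  moreover have "nrm (ell p) (trunc N x + single N (x N)) \<le> nrm (ell p) (trunc N x) + norm (x N)"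
    using ell_add(2)[of "trunc N x" "single N (x N)"] Suc.prems by (simp only: trunc_mem single_mem nrm_single)
  ultimately have "nrm (ell p) (trunc (Suc N) x) \<le> nrm (ell p) (trunc N x) + norm (x N)" by (simp only:)
  then show ?case using Suc.IH[OF Suc.prems] by (simp only: sum.lessThan_Suc)
qed

lemma trunc_null:
  fixes w :: "nat \<Rightarrow> nat \<Rightarrow> 'k::real_normed_field"
  assumes "\<And>m. w m \<in> vecs (ell p)" "\<And>i. i < N \<Longrightarrow> (\<lambda>m. w m i) \<longlonglongrightarrow> 0"
  shows "(\<lambda>m. nrm (ell p) (trunc N (w m))) \<longlonglongrightarrow> 0"
proof (rule Lim_null_comparison)
  show "\<forall>\<^sub>F m in sequentially. norm (nrm (ell p) (trunc N (w m))) \<le> (\<Sum>i<N. norm (w m i))"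
    by (simp only: real_norm_def abs_of_nonneg[OF ell_nonneg]) (simp add: nrm_trunc_le_sum assms(1))
  show "(\<lambda>m. \<Sum>i<N. norm (w m i)) \<longlonglongrightarrow> 0"
    using assms(2) by (intro tendsto_null_sum tendsto_norm_zero) auto
qed

lemma tail_null:
  fixes x :: "nat \<Rightarrow> 'k::real_normed_field"
  assumes x: "x \<in> vecs (ell p)"
  shows "(\<lambda>N. nrm (ell p) (x - trunc N x)) \<longlonglongrightarrow> 0"
proof -
  have s: "(\<lambda>i. norm (x i) powr p) sums (nrm (ell p) x powr p)"
    using x by (simp add: nrm_ell_powr mem_ell summable_sums)
  have tr: "nrm (ell p) (trunc N x) powr p = (\<Sum>i<N. norm (x i) powr p)" for N
  proof -
    have "(\<lambda>i. norm (trunc N x i) powr p) sums (\<Sum>i<N. norm (x i) powr p)"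
      by (rule sums_cong[THEN iffD1, OF _ sums_If_finite_set[of "{..<N}" "\<lambda>i. norm (x i) powr p"]]) auto
    then show ?thesis unfolding nrm_ell_powr[OF trunc_mem[OF x]] by (rule sums_unique[symmetric])
  qed
  have "(\<lambda>N. nrm (ell p) x powr p - (\<Sum>i<N. norm (x i) powr p)) \<longlonglongrightarrow> 0"
    using tendsto_diff[OF tendsto_const s[unfolded sums_def], of "nrm (ell p) x powr p"] by simp
  then have "(\<lambda>N. nrm (ell p) (x - trunc N x) powr p) \<longlonglongrightarrow> 0"
  proof -
    have "nrm (ell p) (x - trunc N x) powr p = nrm (ell p) x powr p - (\<Sum>i<N. norm (x i) powr p)" for N
      using nrm_split[OF x, of N] tr[of N] by linarith
    then show ?thesis using \<open>(\<lambda>N. nrm (ell p) x powr p - (\<Sum>i<N. norm (x i) powr p)) \<longlonglongrightarrow> 0\<close> by (simp only:)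
  qed
  then have "(\<lambda>N. (nrm (ell p) (x - trunc N x) powr p) powr (1 / p)) \<longlonglongrightarrow> 0 powr (1 / p)"
    using p by (intro tendsto_powr') auto
  then show ?thesis by (simp add: ell_nonneg)
qed

lemma pnorm2_eq_nrm: "0 \<le> a \<Longrightarrow> 0 \<le> b \<Longrightarrow> pnorm2 p a b = nrm (ell p) (single 0 a + single 1 b)"
proof -
  assume ab: "0 \<le> a" "0 \<le> b"
  have "nrm (ell p) (single 0 a + single 1 b) powr p = a powr p + b powr p"
    using ab by (subst ell_disjoint_add) auto
  then show ?thesis unfolding pnorm2_def by (metis ell_nonneg powr_inverse_cancel(2))
qed

text \<open>This is the triangle inequality for sequences supported on two coordinates, where
  \<open>pnorm2\<close> is the norm.\<close>

lemma pnorm2_lipschitz: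
  assumes "0 \<le> a" "0 \<le> b" "0 \<le> a'" "0 \<le> b'"
  shows "pnorm2 p a b \<le> pnorm2 p a' b' + \<bar>a - a'\<bar> + \<bar>b - b'\<bar>"
proof -
  have eq: "single 0 a + single 1 b = (single 0 a' + single 1 b') + (single 0 (a - a') + single 1 (b - b'))"
    by auto
  have "nrm (ell p) (single 0 a + single 1 b) \<le> nrm (ell p) (single 0 a' + single 1 b')
      + nrm (ell p) (single 0 (a - a') + single 1 (b - b'))"
    unfolding eq by (intro ell_add) (auto intro!: ell_add(1))
  also have "nrm (ell p) (single 0 (a - a') + single 1 (b - b')) \<le> \<bar>a - a'\<bar> + \<bar>b - b'\<bar>"
    using ell_add(2)[of "single 0 (a - a')" "single 1 (b - b')"] by simp
  finally show ?thesis unfolding pnorm2_eq_nrm[OF assms(1,2)] pnorm2_eq_nrm[OF assms(3,4)] by linarith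
qed

lemma pnorm2_mono: "0 \<le> a \<Longrightarrow> 0 \<le> b \<Longrightarrow> a \<le> a' \<Longrightarrow> b \<le> b' \<Longrightarrow> pnorm2 p a b \<le> pnorm2 p a' b'"
  unfolding pnorm2_def using p by (intro powr_mono2 add_mono) auto

lemma nrm_disjoint:
  fixes x y :: "nat \<Rightarrow> 'k::real_normed_field"
  assumes "x \<in> vecs (ell p)" "y \<in> vecs (ell p)" "\<And>i. x i = 0 \<or> y i = 0"
  shows "nrm (ell p) (x + y) = pnorm2 p (nrm (ell p) x) (nrm (ell p) y)"
  using ell_disjoint_add[OF assms] unfolding pnorm2_def by (metis ell_nonneg powr_inverse_cancel(2))

text \<open>The head of \<open>u\<close> and the tail of \<open>w\<close> have disjoint supports, so
  for them the formula is exact. The factor 2 arises because passing to them changes the norm of the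
  sum and also the two arguments of \<open>pnorm2\<close>.\<close>

lemma almost_disjoint:
  fixes u w :: "nat \<Rightarrow> 'k::real_normed_field"
  assumes u: "u \<in> vecs (ell p)" and w: "w \<in> vecs (ell p)"
  shows "\<bar>nrm (ell p) (u + w) - pnorm2 p (nrm (ell p) u) (nrm (ell p) w)\<bar>
      \<le> 2 * (nrm (ell p) (u - trunc N u) + nrm (ell p) (trunc N w))"
proof -
  define u' where "u' = trunc N u" define w' where "w' = w - trunc N w"
  have m: "u' \<in> vecs (ell p)" "w' \<in> vecs (ell p)" "u - u' \<in> vecs (ell p)" "w - w' \<in> vecs (ell p)"
    using u w by (auto simp: u'_def w'_def)
  have du: "\<bar>nrm (ell p) u - nrm (ell p) u'\<bar> \<le> nrm (ell p) (u - u')"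
    using ell.nrm_triangle_sub[OF u m(1)] ell.nrm_triangle_sub[OF m(1) u] ell.nrm_diff_commute[OF u m(1)] by linarith
  have dw: "\<bar>nrm (ell p) w - nrm (ell p) w'\<bar> \<le> nrm (ell p) (w - w')"
    using ell.nrm_triangle_sub[OF w m(2)] ell.nrm_triangle_sub[OF m(2) w] ell.nrm_diff_commute[OF w m(2)] by linarith
  have "\<bar>nrm (ell p) (u + w) - nrm (ell p) (u' + w')\<bar> \<le> nrm (ell p) ((u + w) - (u' + w'))"
    using ell.nrm_triangle_sub[of "u + w" "u' + w'"] ell.nrm_triangle_sub[of "u' + w'" "u + w"]
      ell.nrm_diff_commute[of "u + w" "u' + w'"] u w m by auto
  also have "(u + w) - (u' + w') = (u - u') + (w - w')" by simp
  also have "nrm (ell p) \<dots> \<le> nrm (ell p) (u - u') + nrm (ell p) (w - w')" by (rule ell_add(2)[OF m(3,4)])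
  finally have d: "\<bar>nrm (ell p) (u + w) - nrm (ell p) (u' + w')\<bar> \<le> nrm (ell p) (u - u') + nrm (ell p) (w - w')" .
  have "nrm (ell p) (u' + w') = pnorm2 p (nrm (ell p) u') (nrm (ell p) w')"
    by (rule nrm_disjoint[OF m(1,2)]) (auto simp: u'_def w'_def)
  moreover have "w - w' = trunc N w" by (simp add: w'_def)
  ultimately show ?thesis
    using d du dw pnorm2_lipschitz[of "nrm (ell p) u" "nrm (ell p) w" "nrm (ell p) u'" "nrm (ell p) w'"]
      pnorm2_lipschitz[of "nrm (ell p) u'" "nrm (ell p) w'" "nrm (ell p) u" "nrm (ell p) w"]
    unfolding u'_def by (simp add: ell_nonneg)
qed

lemma almost_disjoint_seq:
  fixes w :: "nat \<Rightarrow> nat \<Rightarrow> 'k::real_normed_field"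
  assumes u: "u \<in> vecs (ell p)" and w: "\<And>m. w m \<in> vecs (ell p)" "\<And>i. (\<lambda>m. w m i) \<longlonglongrightarrow> 0"
  shows "(\<lambda>m. nrm (ell p) (u + w m) - pnorm2 p (nrm (ell p) u) (nrm (ell p) (w m))) \<longlonglongrightarrow> 0"
proof (rule LIMSEQ_I)
  fix e :: real assume e: "e > 0"
  have "\<forall>\<^sub>F N in sequentially. nrm (ell p) (u - trunc N u) < e / 4"
    using order_tendstoD(2)[OF tail_null[OF u], of "e / 4"] e by simp
  then obtain N where N: "nrm (ell p) (u - trunc N u) < e / 4"
    using eventually_happens'[OF sequentially_bot] by blast
  have "\<forall>\<^sub>F m in sequentially. nrm (ell p) (trunc N (w m)) < e / 4"
    using order_tendstoD(2)[OF trunc_null[OF w], of "e / 4"] e by simp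
  then obtain M where M: "\<And>m. m \<ge> M \<Longrightarrow> nrm (ell p) (trunc N (w m)) < e / 4"
    unfolding eventually_sequentially by blast
  show "\<exists>no. \<forall>n\<ge>no. norm (nrm (ell p) (u + w n) - pnorm2 p (nrm (ell p) u) (nrm (ell p) (w n)) - 0) < e"
  proof (intro exI[of _ M] allI impI)
    fix m assume "m \<ge> M"
    then show "norm (nrm (ell p) (u + w m) - pnorm2 p (nrm (ell p) u) (nrm (ell p) (w m)) - 0) < e"
      using almost_disjoint[OF u w(1)[of m], of N] N M[of m] by simp
  qed
qed

section \<open>Coordinatewise limits and compactness of balls\<close>

lemma ell_coordwise_limit:
  fixes X :: "nat \<Rightarrow> nat \<Rightarrow> 'k::real_normed_field"
  assumes X: "\<And>m. X m \<in> vecs (ell p)" "\<And>m. nrm (ell p) (X m) \<le> C" and lim: "\<And>i. (\<lambda>m. X m i) \<longlonglongrightarrow> x i"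
  shows "x \<in> vecs (ell p)" "nrm (ell p) x \<le> C"
proof -
  have C: "C \<ge> 0" using ell_nonneg[of "X 0"] X(2)[of 0] by linarith
  have part: "(\<Sum>i<N. norm (x i) powr p) \<le> C powr p" for N
  proof (rule LIMSEQ_le_const2)
    show "(\<lambda>m. \<Sum>i<N. norm (X m i) powr p) \<longlonglongrightarrow> (\<Sum>i<N. norm (x i) powr p)"
      using p by (intro tendsto_sum tendsto_powr' tendsto_norm lim tendsto_const) auto
    have "(\<Sum>i<N. norm (X m i) powr p) \<le> C powr p" for m
    proof -
      have "(\<Sum>i<N. norm (X m i) powr p) \<le> (\<Sum>i. norm (X m i) powr p)"
        using X(1)[of m] by (intro sum_le_suminf) (auto simp: mem_ell)
      also have "\<dots> \<le> C powr p" using X C by (simp add: nrm_ell_le_iff[symmetric])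
      finally show ?thesis .
    qed
    then show "\<exists>N'. \<forall>m\<ge>N'. (\<Sum>i<N. norm (X m i) powr p) \<le> C powr p" by blast
  qed
  show x: "x \<in> vecs (ell p)" unfolding mem_ell
    by (rule summableI_nonneg_bounded[OF _ part]) simp
  show "nrm (ell p) x \<le> C"
    using x C part unfolding nrm_ell_le_iff[OF x C] mem_ell by (intro suminf_le_const) auto
qed

text \<open>Each coordinate is bounded, so a diagonal subsequence converges in all of them, and the
  norm bound passes to the limit. This plays the role of weak sequential compactness of the
  ball.\<close>

lemma ell_ball_seq_compact:
  fixes X :: "nat \<Rightarrow> nat \<Rightarrow> 'k::{real_normed_field,heine_borel}"
  assumes X: "\<And>m. X m \<in> vecs (ell p)" "\<And>m. nrm (ell p) (X m) \<le> C"
  obtains x r where "strict_mono r" "x \<in> vecs (ell p)" "nrm (ell p) x \<le> C" "\<And>i. (\<lambda>m. X (r m) i) \<longlonglongrightarrow> x i"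
proof -
  interpret subseqs "\<lambda>n s. convergent (\<lambda>m. X (s m) n)"
  proof
    fix n and s :: "nat \<Rightarrow> nat"
    have "bounded (range (\<lambda>m. X (s m) n))"
      unfolding bounded_iff using order_trans[OF ell_coord[OF X(1)] X(2)] by auto
    then obtain l r where "strict_mono r" "((\<lambda>m. X (s m) n) \<circ> r) \<longlonglongrightarrow> l"
      using bounded_imp_convergent_subsequence by blast
    then show "\<exists>r'. strict_mono r' \<and> convergent (\<lambda>m. X ((s \<circ> r') m) n)"
      unfolding convergent_def by (auto simp: o_def)
  qed
  have "convergent (\<lambda>m. X (diagseq m) k)" for k
  proof -
    \<comment> \<open>The diagonal sequence is a subsequence of the one chosen for coordinate
      \<open>k\<close> only from index \<open>Suc k\<close> on.\<close>
    have "convergent (\<lambda>m. X ((diagseq \<circ> (+) (Suc k)) m) k)"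
    proof (rule diagseq_holds)
      fix r s :: "nat \<Rightarrow> nat" and n assume "strict_mono r" "convergent (\<lambda>m. X (s m) n)"
      then show "convergent (\<lambda>m. X ((s \<circ> r) m) n)"
        using convergent_subseq_convergent[of "\<lambda>m. X (s m) n" r] by (simp add: o_def)
    qed
    then have "convergent (\<lambda>m. X (diagseq (m + Suc k)) k)" by (simp add: o_def add.commute)
    then show ?thesis using convergent_ignore_initial_segment[of "\<lambda>m. X (diagseq m) k" "Suc k"] by simp
  qed
  then have x: "(\<lambda>m. X (diagseq m) i) \<longlonglongrightarrow> lim (\<lambda>m. X (diagseq m) i)" for i
    by (simp add: convergent_LIMSEQ_iff)
  show ?thesis
    by (rule that[OF subseq_diagseq ell_coordwise_limit[OF X(1) X(2) x] x])
qed

subsection \<open>Sums of sparse weakly null sequences\<close>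

text \<open>\<open>Inv L\<close> records what the sum of \<open>L\<close> terms \<open>w m\<close>, chosen one after the other, is known to satisfy.\<close>

lemma sparse_sums:
  fixes w :: "nat \<Rightarrow> nat \<Rightarrow> 'k::real_normed_field"
  assumes w: "\<And>m. w m \<in> vecs (ell p)" "\<And>m. nrm (ell p) (w m) \<le> C" "\<And>i. (\<lambda>m. w m i) \<longlonglongrightarrow> 0"
    and base: "Inv 0 0"
    and step: "\<And>L x. x \<in> vecs (ell p) \<Longrightarrow> Inv L x \<Longrightarrow> \<exists>\<^sub>F m in sequentially. Inv (Suc L) (x + w m)"
  shows "\<exists>x\<in>vecs (ell p). nrm (ell p) x powr p \<le> real L * (C powr p + 1) \<and> Inv L x"
proof (induction L)
  case 0
  have "nrm (ell p) (0 :: nat \<Rightarrow> 'k) powr p \<le> real 0 * (C powr p + 1) \<and> Inv 0 0" using base by simp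
  then show ?case using ell.zero_mem by blast
next
  case (Suc L)
  then obtain x where x: "x \<in> vecs (ell p)" "nrm (ell p) x powr p \<le> real L * (C powr p + 1)" "Inv L x" by blast
  have C: "C \<ge> 0" using ell_nonneg[of "w 0"] w(2)[of 0] by linarith
  define a where "a = nrm (ell p) x"
  \<comment> \<open>The summand 1 puts \<open>b\<close> strictly above the asymptotic bound
    \<open>pnorm2 p a C\<close>, so the \<open>p\<close>-th power of the norm grows by at most
    \<open>C powr p + 1\<close> when a late enough term is added.\<close>
  define b where "b = (a powr p + C powr p + 1) powr (1 / p)"
  have bp: "b powr p = a powr p + C powr p + 1" unfolding b_def by (rule powr_inverse_cancel) (simp add: add_nonneg_nonneg)
  have "pnorm2 p a C < b"
    unfolding pnorm2_def b_def using p by (intro powr_less_mono2) (auto simp: add_nonneg_nonneg)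
  then have "\<forall>\<^sub>F m in sequentially. nrm (ell p) (x + w m) - pnorm2 p a (nrm (ell p) (w m)) < b - pnorm2 p a C"
    using order_tendstoD(2)[OF almost_disjoint_seq[OF x(1) w(1,3)]] by (simp add: a_def)
  then have "\<forall>\<^sub>F m in sequentially. nrm (ell p) (x + w m) powr p \<le> b powr p"
  proof eventually_elim
    case (elim m)
    have "pnorm2 p a (nrm (ell p) (w m)) \<le> pnorm2 p a C"
      using w(2) by (intro pnorm2_mono) (auto simp: a_def ell_nonneg)
    then show ?case using elim p by (intro powr_mono2) (auto simp: ell_nonneg)
  qed
  \<comment> \<open>\<open>Inv\<close> holds for infinitely many \<open>m\<close> and the norm bound
    for all large \<open>m\<close>, so some \<open>m\<close> has both.\<close>
  then obtain m where m: "Inv (Suc L) (x + w m)" "nrm (ell p) (x + w m) powr p \<le> b powr p"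
    using frequently_eventually_frequently[OF step[OF x(1,3)]] by (auto dest: frequently_ex)
  have "b powr p \<le> real (Suc L) * (C powr p + 1)" unfolding bp using x(2) by (simp add: a_def algebra_simps)
  then have "nrm (ell p) (x + w m) powr p \<le> real (Suc L) * (C powr p + 1)" using m(2) by linarith
  then show ?case using m(1) ell_add(1)[OF x(1) w(1)] by blast
qed

text \<open>Applied with \<open>t = 1\<close>: a quantity that grows linearly with the number
  \<open>L\<close> of sparse terms cannot obey a norm estimate that only allows a power of
  \<open>L\<close> with exponent below 1.\<close>

lemma sparse_growth_contradiction:
  assumes s: "s < t" and c: "c > 0" and K: "K > 0"
    and le: "\<And>L::nat. L \<ge> 1 \<Longrightarrow> c * real L powr t \<le> B * (real L * K) powr s"
  shows False
proof -
  \<comment> \<open>Larger than the bound that the hypothesis imposes on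
    \<open>L powr (t - s)\<close> for every \<open>L\<close>.\<close>
  define D where "D = (\<bar>B\<bar> * K powr s + 1) / c"
  have D: "D > 0" using c by (auto simp: D_def intro!: divide_pos_pos add_nonneg_pos)
  obtain L :: nat where L: "real L \<ge> max 1 (D powr (1 / (t - s)))" using real_arch_simple by blast
  then have L1: "L \<ge> 1" by simp
  have "D = (D powr (1 / (t - s))) powr (t - s)" using s D by (simp add: powr_powr)
  also have "\<dots> \<le> real L powr (t - s)" using L s by (intro powr_mono2) auto
  finally have DL: "D \<le> real L powr (t - s)" .
  have "c * (real L powr (t - s) * real L powr s) \<le> B * (real L powr s * K powr s)"
    using le[OF L1] by (simp add: powr_mult flip: powr_add)
  then have "(c * real L powr (t - s)) * real L powr s \<le> (B * K powr s) * real L powr s"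
    by (simp add: mult_ac)
  then have "c * real L powr (t - s) \<le> B * K powr s" using L1 by simp
  moreover have "c * D \<le> c * real L powr (t - s)" using DL c by simp
  moreover have "B * K powr s \<le> \<bar>B\<bar> * K powr s" by (intro mult_right_mono) auto
  moreover have "c * D = \<bar>B\<bar> * K powr s + 1" using c by (simp add: D_def)
  ultimately show False by linarith
qed

end

subsection \<open>Weak convergence of bounded sequences\<close>

context ell_exponent
begin

text \<open>By \<open>dual_null\<close> and the coordinate functionals these are exactly the weakly
  null sequences in the ball of radius \<open>C\<close>.\<close>

definition bounded_null :: "real \<Rightarrow> (nat \<Rightarrow> nat \<Rightarrow> 'k::real_normed_field) \<Rightarrow> bool" where
  "bounded_null C w \<longleftrightarrow> (\<forall>m. w m \<in> vecs (ell p) \<and> nrm (ell p) (w m) \<le> C) \<and> (\<forall>i. (\<lambda>m. w m i) \<longlonglongrightarrow> 0)"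

lemma bounded_nullD:
  "bounded_null C w \<Longrightarrow> w m \<in> vecs (ell p)" "bounded_null C w \<Longrightarrow> nrm (ell p) (w m) \<le> C"
  "bounded_null C w \<Longrightarrow> (\<lambda>m. w m i) \<longlonglongrightarrow> 0"
  by (auto simp: bounded_null_def)

lemma bounded_null_subseq:
  assumes w: "bounded_null C w" and r: "strict_mono r" shows "bounded_null C (\<lambda>m. w (r m))"
  unfolding bounded_null_def
proof (intro conjI allI)
  fix i show "(\<lambda>m. w (r m) i) \<longlonglongrightarrow> 0"
    using LIMSEQ_subseq_LIMSEQ[OF bounded_nullD(3)[OF w] r] by (simp only: o_def)
qed (use bounded_nullD[OF w] in blast)+

lemma bounded_null_unimodular:
  assumes w: "bounded_null C w" and c: "\<And>m. norm (c m) = 1"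
  shows "bounded_null C (\<lambda>m. scal (ell p) (c m) (w m))"
proof -
  have "(\<lambda>m. c m * w m i) \<longlonglongrightarrow> 0" for i
    using tendsto_norm_zero[OF bounded_nullD(3)[OF w, of i]] c
    by (subst tendsto_norm_zero_iff[symmetric]) (simp add: norm_mult)
  then show ?thesis using w c by (simp add: bounded_null_def ell.nrm_scal) (simp add: scal_ell)
qed

lemma bounded_null_diff:
  fixes X :: "nat \<Rightarrow> nat \<Rightarrow> 'k::real_normed_field"
  assumes X: "\<And>m. X m \<in> vecs (ell p)" "\<And>m. nrm (ell p) (X m) \<le> C" and x: "x \<in> vecs (ell p)"
    and lim: "\<And>i. (\<lambda>m. X m i) \<longlonglongrightarrow> x i"
  shows "bounded_null (C + nrm (ell p) x) (\<lambda>m. X m - x)"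
  unfolding bounded_null_def
proof (intro conjI allI)
  fix m i
  show "X m - x \<in> vecs (ell p)" using X x by auto
  show "nrm (ell p) (X m - x) \<le> C + nrm (ell p) x" using ell.nrm_diff[OF X(1) x, of m] X(2)[of m] by linarith
  show "(\<lambda>m. (X m - x) i) \<longlonglongrightarrow> 0" using lim[of i] by (simp add: LIM_zero_iff)
qed

lemma frequently_ge_of_not_null:
  fixes a :: "nat \<Rightarrow> real"
  assumes "\<not> a \<longlonglongrightarrow> 0" "\<And>m. a m \<ge> 0"
  obtains \<delta> where "\<delta> > 0" "\<exists>\<^sub>F m in sequentially. a m \<ge> \<delta>"
proof -
  obtain \<delta> where "\<delta> > 0" "\<not> (\<forall>\<^sub>F m in sequentially. dist (a m) 0 < \<delta>)"
    using assms(1) unfolding tendsto_iff by blast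
  then show ?thesis using that[of \<delta>] assms(2) by (simp add: not_eventually not_less)
qed

text \<open>Otherwise rotate the terms so that \<open>f\<close> takes nonnegative real values,
  infinitely many of them at least \<open>\<delta>\<close>. On a sparse sum of \<open>L\<close> such
  terms \<open>f\<close> is at least \<open>L * \<delta>\<close>, while the norm is only of order
  \<open>L powr (1 / p)\<close>, and \<open>p > 1\<close>.\<close>

lemma dual_null:
  fixes w :: "nat \<Rightarrow> nat \<Rightarrow> 'k::real_normed_field"
  assumes f: "f \<in> vecs (dual (ell p))" and w: "bounded_null C w"
  shows "(\<lambda>m. f (w m)) \<longlonglongrightarrow> 0"
proof (rule ccontr)
  assume "\<not> ?thesis"
  then have "\<not> (\<lambda>m. norm (f (w m))) \<longlonglongrightarrow> 0" by (subst tendsto_norm_zero_iff)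
  from frequently_ge_of_not_null[OF this norm_ge_zero]
  obtain \<delta> where \<delta>: "\<delta> > 0" "\<exists>\<^sub>F m in sequentially. norm (f (w m)) \<ge> \<delta>" .
  have "\<exists>c. norm c = 1 \<and> c * f (w m) = of_real (norm (f (w m)))" for m
    using unimodular_times_eq_norm by metis
  then obtain c where c: "\<And>m. norm (c m) = 1" "\<And>m. c m * f (w m) = of_real (norm (f (w m)))" by metis
  define v where "v = (\<lambda>m. scal (ell p) (c m) (w m))"
  have v: "bounded_null C v" unfolding v_def by (rule bounded_null_unimodular[OF w c(1)])
  have fv: "f (v m) = of_real (norm (f (w m)))" for m
    unfolding v_def using bounded_nullD(1)[OF w] c(2) by (simp add: ell.dual_scal[OF f])
  define Inv where "Inv = (\<lambda>(L::nat) x. \<exists>r. f x = of_real r \<and> r \<ge> real L * \<delta>)"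
  have K: "C powr p + 1 > 0" by (simp add: add_nonneg_pos)
  show False
  proof (rule sparse_growth_contradiction[of "1 / p" 1 \<delta> "C powr p + 1"])
    fix L :: nat
    have "\<exists>x\<in>vecs (ell p). nrm (ell p) x powr p \<le> real L * (C powr p + 1) \<and> Inv L x"
    proof (rule sparse_sums[OF bounded_nullD(1)[OF v] bounded_nullD(2)[OF v] bounded_nullD(3)[OF v]])
      show "Inv 0 0" unfolding Inv_def using ell.dual_zero[OF f] by (intro exI[of _ 0]) auto
      fix L x assume x: "x \<in> vecs (ell p)" "Inv L x"
      then obtain r where r: "f x = of_real r" "r \<ge> real L * \<delta>" by (auto simp: Inv_def)
      show "\<exists>\<^sub>F m in sequentially. Inv (Suc L) (x + v m)"
        using \<delta>(2)
      proof (rule frequently_elim1)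
        fix m assume "\<delta> \<le> norm (f (w m))"
        then show "Inv (Suc L) (x + v m)" unfolding Inv_def
          using r by (intro exI[of _ "r + norm (f (w m))"])
            (simp add: ell.dual_add[OF f x(1) bounded_nullD(1)[OF v]] fv algebra_simps)
      qed
    qed
    then obtain x r where x: "x \<in> vecs (ell p)" "nrm (ell p) x powr p \<le> real L * (C powr p + 1)"
      "f x = of_real r" "r \<ge> real L * \<delta>" by (auto simp: Inv_def)
    have "real L * \<delta> \<le> norm (f x)" using x(3,4) by (simp add: norm_of_real)
    also have "\<dots> \<le> nrm (dual (ell p)) f * nrm (ell p) x" by (rule ell.dual_le_nrm[OF f x(1)])
    also have "nrm (ell p) x = (nrm (ell p) x powr p) powr (1 / p)" by (simp add: ell_nonneg)
    also have "nrm (dual (ell p)) f * \<dots> \<le> nrm (dual (ell p)) f * (real L * (C powr p + 1)) powr (1 / p)"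
      using x(2) p ell.dual_nrm_nonneg[OF f] by (intro mult_left_mono powr_mono2) auto
    finally show "\<delta> * real L powr 1 \<le> nrm (dual (ell p)) f * (real L * (C powr p + 1)) powr (1 / p)"
      by (simp add: mult.commute)
  qed (use p \<delta> K in auto)
qed

lemma coordinate_mem_dual:
  "(\<lambda>y. if y \<in> vecs (ell p) then y i else 0) \<in> vecs (dual (ell p :: ('k::real_normed_field, nat \<Rightarrow> 'k) nspace))"
  unfolding ell.mem_dual_iff
proof (intro conjI ballI allI impI exI[of _ 1])
  fix c and x :: "nat \<Rightarrow> 'k" assume "x \<in> vecs (ell p)"
  then show "(if scal (ell p) c x \<in> vecs (ell p) then scal (ell p) c x i else 0) = c * (if x \<in> vecs (ell p) then x i else 0)"
    by (simp only: ell.scal_mem if_True) (simp only: scal_ell)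
qed (auto simp: ell_coord ell_add)

lemma weakly_converges_coordinate:
  fixes x :: "nat \<Rightarrow> 'k::real_normed_field"
  assumes "weakly_converges (ell p) G x" "x \<in> vecs (ell p)" "\<forall>\<^sub>F y in G. y \<in> vecs (ell p)"
  shows "((\<lambda>y. y i) \<longlongrightarrow> x i) G"
proof -
  have "((\<lambda>y. if y \<in> vecs (ell p) then y i else 0) \<longlongrightarrow> x i) G"
    using assms(1,2) coordinate_mem_dual[of i] unfolding weakly_converges_def by fastforce
  moreover have "\<forall>\<^sub>F y in G. (if y \<in> vecs (ell p) then y i else 0) = y i"
    using assms(3) by eventually_elim simp
  ultimately show ?thesis by (simp add: tendsto_cong)
qed

definition seq_weakly_continuous :: "('k::real_normed_field, 'w::ab_group_add) nspace \<Rightarrow> ((nat \<Rightarrow> 'k) \<Rightarrow> 'w) \<Rightarrow> bool" where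
  "seq_weakly_continuous F P \<longleftrightarrow> (\<forall>X x C. (\<forall>m. X m \<in> vecs (ell p) \<and> nrm (ell p) (X m) \<le> C) \<and> x \<in> vecs (ell p) \<and>
     (\<forall>i. (\<lambda>m. X m i) \<longlonglongrightarrow> x i) \<longrightarrow> (\<lambda>m. nrm F (P (X m) - P x)) \<longlonglongrightarrow> 0)"

text \<open>On bounded sets coordinates determine weak convergence, and being within
  \<open>1 / Suc N\<close> in the first \<open>N\<close> coordinates gives countably many test
  neighbourhoods. So a failure along a net already produces a bounded, coordinatewise convergent
  sequence along which \<open>P\<close> fails.\<close>

lemma weakly_continuous_on_bounded_iff_seq:
  fixes F :: "('k::real_normed_field, 'w::ab_group_add) nspace"
  shows "weakly_continuous_on_bounded (ell p) F P \<longleftrightarrow> seq_weakly_continuous F P"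
proof
  assume wc: "weakly_continuous_on_bounded (ell p) F P"
  show "seq_weakly_continuous F P" unfolding seq_weakly_continuous_def
  proof (intro allI impI, elim conjE)
    fix X :: "nat \<Rightarrow> nat \<Rightarrow> 'k" and x C assume X: "\<forall>m. X m \<in> vecs (ell p) \<and> nrm (ell p) (X m) \<le> C" and x: "x \<in> vecs (ell p)"
      and lim: "\<forall>i. (\<lambda>m. X m i) \<longlonglongrightarrow> x i"
    have "weakly_converges (ell p) (filtermap X sequentially) x"
      unfolding weakly_converges_def
    proof
      fix f assume f: "f \<in> vecs (dual (ell p :: ('k, nat \<Rightarrow> 'k) nspace))"
      have "(\<lambda>m. f (X m - x)) \<longlonglongrightarrow> 0"
        by (rule dual_null[OF f bounded_null_diff]) (use X x lim in auto)
      then show "(f \<longlongrightarrow> f x) (filtermap X sequentially)"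
        using X x by (simp add: filterlim_filtermap ell.dual_diff[OF f] LIM_zero_iff)
    qed
    moreover have "\<forall>\<^sub>F y in filtermap X sequentially. y \<in> vecs (ell p) \<and> nrm (ell p) y \<le> C"
      using X by (simp add: eventually_filtermap)
    ultimately have "((\<lambda>y. nrm F (P y - P x)) \<longlongrightarrow> 0) (filtermap X sequentially)"
      using wc x unfolding weakly_continuous_on_bounded_def by blast
    then show "(\<lambda>m. nrm F (P (X m) - P x)) \<longlonglongrightarrow> 0" by (simp add: filterlim_filtermap)
  qed
next
  assume sc: "seq_weakly_continuous F P"
  show "weakly_continuous_on_bounded (ell p) F P" unfolding weakly_continuous_on_bounded_def
  proof (intro allI ballI impI, elim conjE)
    fix G M and x :: "nat \<Rightarrow> 'k" assume x: "x \<in> vecs (ell p)" and b: "\<forall>\<^sub>F y in G. y \<in> vecs (ell p) \<and> nrm (ell p) y \<le> M"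
      and G: "weakly_converges (ell p) G x"
    show "((\<lambda>y. nrm F (P y - P x)) \<longlongrightarrow> 0) G"
    proof (rule tendstoI)
      fix e :: real assume e: "e > 0"
      have "\<exists>N. \<forall>y. y \<in> vecs (ell p) \<longrightarrow> nrm (ell p) y \<le> M \<longrightarrow> (\<forall>i<N. norm (y i - x i) < 1 / real (Suc N)) \<longrightarrow>
          dist (nrm F (P y - P x)) 0 < e"
      proof (rule ccontr)
        assume "\<not> ?thesis"
        then have "\<forall>N. \<exists>y. y \<in> vecs (ell p) \<and> nrm (ell p) y \<le> M \<and> (\<forall>i<N. norm (y i - x i) < 1 / real (Suc N)) \<and>
          \<not> dist (nrm F (P y - P x)) 0 < e" by metis
        then obtain X where X: "\<And>N. X N \<in> vecs (ell p)" "\<And>N. nrm (ell p) (X N) \<le> M"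
          "\<And>N i. i < N \<Longrightarrow> norm (X N i - x i) < 1 / real (Suc N)" "\<And>N. \<not> dist (nrm F (P (X N) - P x)) 0 < e"
          by metis
        have "(\<lambda>N. X N i) \<longlonglongrightarrow> x i" for i
        proof (rule LIM_zero_cancel, rule Lim_null_comparison)
          show "\<forall>\<^sub>F N in sequentially. norm (X N i - x i) \<le> 1 / real (Suc N)"
            using eventually_gt_at_top[of i] by eventually_elim (use X(3) less_imp_le in blast)
        qed (rule LIMSEQ_Suc[OF lim_1_over_n])
        then have "(\<lambda>m. nrm F (P (X m) - P x)) \<longlonglongrightarrow> 0"
          using sc X(1,2) x unfolding seq_weakly_continuous_def by blast
        then have "\<forall>\<^sub>F m in sequentially. dist (nrm F (P (X m) - P x)) 0 < e" using e by (rule tendstoD)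
        then show False using X(4) by (simp add: eventually_const)
      qed
      then obtain N where N: "\<And>y. y \<in> vecs (ell p) \<Longrightarrow> nrm (ell p) y \<le> M \<Longrightarrow> \<forall>i<N. norm (y i - x i) < 1 / real (Suc N) \<Longrightarrow>
          dist (nrm F (P y - P x)) 0 < e" by blast
      have mem: "\<forall>\<^sub>F y in G. y \<in> vecs (ell p)" using b by eventually_elim simp
      have "\<forall>\<^sub>F y in G. \<forall>i\<in>{..<N}. norm (y i - x i) < 1 / real (Suc N)"
      proof (intro eventually_ball_finite ballI)
        fix i
        have "\<forall>\<^sub>F y in G. dist (y i) (x i) < 1 / real (Suc N)"
          by (rule tendstoD[OF weakly_converges_coordinate[OF G x mem]]) simp
        then show "\<forall>\<^sub>F y in G. norm (y i - x i) < 1 / real (Suc N)" by (simp add: dist_norm)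
      qed simp
      with b show "\<forall>\<^sub>F y in G. dist (nrm F (P y - P x)) 0 < e"
        by eventually_elim (use N in auto)
    qed
  qed
qed

end

subsection \<open>Polynomials of critical degree\<close>

locale ell_pair = dom: ell_exponent p + cod: ell_exponent q for p q :: real

sublocale ell_pair \<subseteq> poly_pair "ell p :: ('k::real_normed_field, nat \<Rightarrow> 'k) nspace" "ell q :: ('k, nat \<Rightarrow> 'k) nspace"
  by (intro poly_pair.intro dom.normed_ell cod.normed_ell)

context ell_pair
begin

text \<open>The \<open>itself\<close> argument carries the scalar field, which the degree does not
  determine.\<close>

definition all_weakly_continuous_below :: "'k::real_normed_field itself \<Rightarrow> nat \<Rightarrow> bool" where
  "all_weakly_continuous_below T n \<longleftrightarrow> (\<forall>k. 1 \<le> k \<and> k < n \<longrightarrow>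
     polys_w k (ell p :: ('k, nat \<Rightarrow> 'k) nspace) (ell q) = vecs (PS k))"

context
  fixes n :: nat and P :: "(nat \<Rightarrow> 'k::{real_normed_field,heine_borel}) \<Rightarrow> nat \<Rightarrow> 'k"
  assumes n: "1 \<le> n" and below: "all_weakly_continuous_below TYPE('k) n"
    and P: "P \<in> vecs (PS n)"
begin

text \<open>The mixed terms have degree less than \<open>n\<close> in \<open>w m\<close>, hence are weakly continuous.\<close>

lemma asymptotically_additive:
  assumes y: "y \<in> vecs (ell p)" and w: "dom.bounded_null C w"
  shows "(\<lambda>m. nrm (ell q) (P (y + w m) - P y - P (w m))) \<longlonglongrightarrow> 0"
proof -
  obtain D where D: "\<forall>j. \<forall>y\<in>vecs (ell p). homogeneous_polynomial j (ell p) (ell q) (D j y)"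
    "\<forall>y\<in>vecs (ell p). \<forall>w\<in>vecs (ell p). P (y + w) = (\<Sum>j\<le>n. D j y w) \<and> D 0 y w = P y \<and> D n y w = P w"
    using hom_poly_taylor[OF ps_hom[OF P]] by blast
  have Dm: "D j y (w m) \<in> vecs (ell q)" for j m
    using hom_poly_mem D(1) y dom.bounded_nullD(1)[OF w] by blast
  have null: "(\<lambda>m. nrm (ell q) (D j y (w m))) \<longlonglongrightarrow> 0" if j: "j \<in> {1..<n}" for j
  proof -
    \<comment> \<open>Setting the component to 0 outside the carrier makes it an element of the
      polynomial space of degree \<open>j\<close>, to which \<open>below\<close> applies.\<close>
    define Q where "Q = (\<lambda>x. if x \<in> vecs (ell p) then D j y x else 0)"
    have hD: "homogeneous_polynomial j (ell p) (ell q) (D j y)" using D(1) y by blast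
    have hQ: "homogeneous_polynomial j (ell p) (ell q) Q"
      by (rule hom_poly_cong[OF hD]) (simp add: Q_def)
    obtain K where K: "K \<ge> 0" "\<And>y' w. y' \<in> vecs (ell p) \<Longrightarrow> w \<in> vecs (ell p) \<Longrightarrow> nrm (ell p) y' \<le> nrm (ell p) y \<Longrightarrow>
        nrm (ell q) (D j y' w) \<le> K * nrm (ell p) w ^ j"
      by (rule taylor_bounds[OF ps_hom[OF P] ps_bounded[OF P], of D j "nrm (ell p) y"]) (use D j in auto)
    have "nrm (ell q) (Q x) \<le> K" if "x \<in> vecs (ell p)" "nrm (ell p) x \<le> 1" for x
    proof -
      have "nrm (ell q) (D j y x) \<le> K * nrm (ell p) x ^ j" using K(2)[OF y that(1)] by simp
      also have "\<dots> \<le> K * 1" using K(1) that by (intro mult_left_mono power_le_one) (auto simp: dom.ell_nonneg)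
      finally show ?thesis using that by (simp add: Q_def)
    qed
    then have "Q \<in> vecs (PS j)"
      unfolding mem_poly_space_iff ball_bounded_def using hQ by (auto simp: Q_def)
    then have "Q \<in> polys_w j (ell p) (ell q)" using below j unfolding all_weakly_continuous_below_def by auto
    then have "dom.seq_weakly_continuous (ell q) Q"
      unfolding polys_w_def dom.weakly_continuous_on_bounded_iff_seq by simp
    moreover have "\<forall>i. (\<lambda>m. w m i) \<longlonglongrightarrow> 0 i" using dom.bounded_nullD(3)[OF w] by simp
    moreover have "\<forall>m. w m \<in> vecs (ell p) \<and> nrm (ell p) (w m) \<le> C" using dom.bounded_nullD[OF w] by blast
    ultimately have "(\<lambda>m. nrm (ell q) (Q (w m) - Q 0)) \<longlonglongrightarrow> 0"
      unfolding dom.seq_weakly_continuous_def using dom.ell.zero_mem by blast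
    moreover have "Q 0 = 0" using hom_poly_zero[OF hQ] j by simp
    ultimately show ?thesis using dom.bounded_nullD(1)[OF w] by (simp add: Q_def)
  qed
  have eq: "P (y + w m) - P y - P (w m) = (\<Sum>j\<in>{1..<n}. D j y (w m))" for m
  proof -
    have "{..n} = insert 0 (insert n {1..<n})" using n by auto
    then have "P (y + w m) = D 0 y (w m) + (D n y (w m) + (\<Sum>j\<in>{1..<n}. D j y (w m)))"
      using D(2) y dom.bounded_nullD(1)[OF w] n by simp
    then show ?thesis using D(2) y dom.bounded_nullD(1)[OF w] by simp
  qed
  show ?thesis
  proof (rule Lim_null_comparison)
    show "\<forall>\<^sub>F m in sequentially. norm (nrm (ell q) (P (y + w m) - P y - P (w m))) \<le> (\<Sum>j\<in>{1..<n}. nrm (ell q) (D j y (w m)))"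
      unfolding eq using cod.ell.nrm_sum[of "{1..<n}" "\<lambda>j. D j y (w _)"] Dm by (simp add: cod.ell_nonneg)
    show "(\<lambda>m. \<Sum>j\<in>{1..<n}. nrm (ell q) (D j y (w m))) \<longlonglongrightarrow> 0"
      by (intro tendsto_null_sum null)
  qed
qed

text \<open>Phrased in terms of \<open>nrm (ell p) x powr p\<close>, the quantity that
  \<open>sparse_sums\<close> controls.\<close>

lemma bound_powr:
  assumes x: "x \<in> vecs (ell p)" "nrm (ell p) x powr p \<le> b"
  shows "nrm (ell q) (P x) \<le> nrm (PS n) P * b powr (real n / p)"
proof -
  have "nrm (ell p) x ^ n = (nrm (ell p) x powr p) powr (real n / p)"
    using dom.p n by (cases "nrm (ell p) x = 0") (auto simp: powr_powr powr_realpow' dom.ell_nonneg)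
  also have "\<dots> \<le> b powr (real n / p)" using x(2) dom.p by (intro powr_mono2) auto
  finally have "nrm (PS n) P * nrm (ell p) x ^ n \<le> nrm (PS n) P * b powr (real n / p)"
    using ps_nrm_nonneg[OF P] by (intro mult_left_mono)
  then show ?thesis using ps_nrm[OF P x(1)] by linarith
qed

text \<open>If coordinate \<open>i\<close> accumulated at some \<open>a \<noteq> 0\<close>, then on
  a sparse sum of \<open>L\<close> terms it would be about \<open>L * a\<close>, against a norm
  bound of order \<open>L powr (n / p)\<close>. A convergent subsequence replaces the rotation used
  for functionals, because a scalar acts on \<open>P\<close> by its \<open>n\<close>-th power and
  cannot change the sign for real scalars and even \<open>n\<close>.\<close>

lemma coordinates_null:
  assumes np: "real n < p" and w: "dom.bounded_null C w"
  shows "(\<lambda>m. P (w m) i) \<longlonglongrightarrow> 0"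
proof (rule ccontr)
  assume "\<not> ?thesis"
  then have "\<not> (\<lambda>m. norm (P (w m) i)) \<longlonglongrightarrow> 0" by (subst tendsto_norm_zero_iff)
  from dom.frequently_ge_of_not_null[OF this norm_ge_zero]
  obtain \<delta> where \<delta>: "\<delta> > 0" "\<exists>\<^sub>F m in sequentially. norm (P (w m) i) \<ge> \<delta>" .
  then have "infinite {m. norm (P (w m) i) \<ge> \<delta>}"
    by (simp add: frequently_cofinite[symmetric] cofinite_eq_sequentially)
  from infinite_enumerate[OF this] obtain r :: "nat \<Rightarrow> nat"
    where r: "strict_mono r" "\<And>m. norm (P (w (r m)) i) \<ge> \<delta>" by auto
  define B where "B = nrm (PS n) P * (C powr p) powr (real n / p)"
  have "norm (P (w (r m)) i) \<le> B" for m
  proof -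
    have "nrm (ell p) (w (r m)) powr p \<le> C powr p"
      using dom.bounded_nullD(2)[OF w] dom.p by (intro powr_mono2) (auto simp: dom.ell_nonneg)
    from bound_powr[OF dom.bounded_nullD(1)[OF w] this] show ?thesis
      using cod.ell_coord[OF ps_mem[OF P dom.bounded_nullD(1)[OF w]], of "r m" i]
      unfolding B_def by linarith
  qed
  then have "bounded (range (\<lambda>m. P (w (r m)) i))" by (auto simp: bounded_iff)
  then obtain a s where s: "strict_mono s" "((\<lambda>m. P (w (r m)) i) \<circ> s) \<longlonglongrightarrow> a"
    using bounded_imp_convergent_subsequence by blast
  define v where "v = (\<lambda>m. w (r (s m)))"
  have v: "dom.bounded_null C v" unfolding v_def
    using dom.bounded_null_subseq[OF dom.bounded_null_subseq[OF w r(1)] s(1)] .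
  have va: "(\<lambda>m. P (v m) i) \<longlonglongrightarrow> a" using s(2) by (simp add: v_def o_def)
  have "norm a \<ge> \<delta>" by (rule LIMSEQ_le_const[OF tendsto_norm[OF va]]) (use r(2) in \<open>auto simp: v_def\<close>)
  then have a: "norm a > 0" using \<delta>(1) by linarith
  \<comment> \<open>Each step may add an error \<open>norm a / 4\<close> from the value at
    \<open>v m\<close> and another from the additivity defect; this still leaves
    \<open>P x i\<close> of size at least \<open>L * norm a / 2\<close>.\<close>
  define Inv where "Inv = (\<lambda>(L::nat) x. norm (P x i - of_nat L * a) \<le> real L * (norm a / 2))"
  have K: "C powr p + 1 > 0" by (simp add: add_nonneg_pos)
  show False
  proof (rule dom.sparse_growth_contradiction[of "real n / p" 1 "norm a / 2" "C powr p + 1"])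
    fix L :: nat
    have "\<exists>x\<in>vecs (ell p). nrm (ell p) x powr p \<le> real L * (C powr p + 1) \<and> Inv L x"
    proof (rule dom.sparse_sums[OF dom.bounded_nullD(1)[OF v] dom.bounded_nullD(2)[OF v] dom.bounded_nullD(3)[OF v]])
      show "Inv 0 0" unfolding Inv_def using hom_poly_zero[OF ps_hom[OF P]] n by simp
      fix L x assume x: "x \<in> vecs (ell p)" "Inv L x"
      have e1: "\<forall>\<^sub>F m in sequentially. norm (P (v m) i - a) < norm a / 4"
        using tendstoD[OF va, of "norm a / 4"] a by (simp add: dist_norm)
      have e2: "\<forall>\<^sub>F m in sequentially. nrm (ell q) (P (x + v m) - P x - P (v m)) < norm a / 4"
        using order_tendstoD(2)[OF asymptotically_additive[OF x(1) v], of "norm a / 4"] a by simp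
      have "\<forall>\<^sub>F m in sequentially. Inv (Suc L) (x + v m)"
        using e1 e2
      proof eventually_elim
        case (elim m)
        have vm: "v m \<in> vecs (ell p)" by (rule dom.bounded_nullD(1)[OF v])
        have "P (x + v m) - P x - P (v m) \<in> vecs (ell q)"
          using ps_mem[OF P] x(1) vm by (intro cod.ell.diff_mem) auto
        from cod.ell_coord[OF this, of i] have c: "norm (P (x + v m) i - P x i - P (v m) i) < norm a / 4"
          using elim(2) by simp
        have "P (x + v m) i - of_nat (Suc L) * a
            = (P x i - of_nat L * a) + (P (v m) i - a) + (P (x + v m) i - P x i - P (v m) i)"
          by (simp add: algebra_simps)
        then have "norm (P (x + v m) i - of_nat (Suc L) * a) \<le> norm (P x i - of_nat L * a) + norm (P (v m) i - a)
            + norm (P (x + v m) i - P x i - P (v m) i)"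
          by (simp only:) (intro order_trans[OF norm_triangle_ineq] add_right_mono norm_triangle_ineq)
        then show ?case using c elim(1) x(2) unfolding Inv_def by (simp add: algebra_simps)
      qed
      then show "\<exists>\<^sub>F m in sequentially. Inv (Suc L) (x + v m)"
        by (rule eventually_frequently[OF sequentially_bot])
    qed
    then obtain x where x: "x \<in> vecs (ell p)" "nrm (ell p) x powr p \<le> real L * (C powr p + 1)"
      "norm (P x i - of_nat L * a) \<le> real L * (norm a / 2)" by (auto simp: Inv_def)
    have "real L * norm a = norm (of_nat L * a)" by (simp add: norm_mult)
    also have "\<dots> \<le> norm (P x i) + norm (P x i - of_nat L * a)"
      using norm_triangle_sub[of "of_nat L * a" "P x i"] by (simp add: norm_minus_commute)
    finally have "norm a / 2 * real L \<le> norm (P x i)" using x(3) by (simp add: algebra_simps)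
    also have "\<dots> \<le> nrm (ell q) (P x)" by (rule cod.ell_coord[OF ps_mem[OF P x(1)]])
    also have "\<dots> \<le> nrm (PS n) P * (real L * (C powr p + 1)) powr (real n / p)"
      by (rule bound_powr[OF x(1,2)])
    finally show "norm a / 2 * real L powr 1 \<le> nrm (PS n) P * (real L * (C powr p + 1)) powr (real n / p)"
      by simp
  qed (use np dom.p a K in auto)
qed

text \<open>Since \<open>n < p\<close> as well, the values \<open>P (w m)\<close> are coordinatewise
  null, so on sparse sums the \<open>q\<close>-th powers of their norms add up asymptotically. This
  gives linear growth in \<open>L\<close> against the exponent \<open>n * q / p < 1\<close>.\<close>

lemma null_if_subcritical:
  assumes nqp: "real n * q < p" and w: "dom.bounded_null C w"
  shows "(\<lambda>m. nrm (ell q) (P (w m))) \<longlonglongrightarrow> 0"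
proof (rule ccontr)
  assume "\<not> ?thesis"
  from dom.frequently_ge_of_not_null[OF this cod.ell_nonneg]
  obtain \<delta> where \<delta>: "\<delta> > 0" "\<exists>\<^sub>F m in sequentially. nrm (ell q) (P (w m)) \<ge> \<delta>" .
  have np: "real n < p"
  proof -
    have "real n * 1 \<le> real n * q" using cod.p by (intro mult_left_mono) auto
    then show ?thesis using nqp by simp
  qed
  \<comment> \<open>Halving leaves a strict gap between \<open>b\<close> and
    \<open>pnorm2 q u \<delta>\<close>, which is shared by the two asymptotic errors.\<close>
  define d where "d = \<delta> powr q / 2"
  have d: "d > 0" using \<delta>(1) by (simp add: d_def)
  define Inv where "Inv = (\<lambda>(L::nat) x. nrm (ell q) (P x) powr q \<ge> real L * d)"
  have K: "C powr p + 1 > 0" by (simp add: add_nonneg_pos)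
  define N where "N = nrm (PS n) P"
  have N: "N \<ge> 0" using ps_nrm_nonneg[OF P] by (simp add: N_def)
  show False
  proof (rule dom.sparse_growth_contradiction[of "real n * q / p" 1 d "C powr p + 1"])
    fix L :: nat
    have "\<exists>x\<in>vecs (ell p). nrm (ell p) x powr p \<le> real L * (C powr p + 1) \<and> Inv L x"
    proof (rule dom.sparse_sums[OF dom.bounded_nullD(1)[OF w] dom.bounded_nullD(2)[OF w] dom.bounded_nullD(3)[OF w]])
      show "Inv 0 0" unfolding Inv_def using hom_poly_zero[OF ps_hom[OF P]] n by simp
      fix L x assume x: "x \<in> vecs (ell p)" "Inv L x"
      define u where "u = nrm (ell q) (P x)"
      define b where "b = (u powr q + d) powr (1 / q)"
      have bq: "b powr q = u powr q + d" unfolding b_def using d by (intro cod.powr_inverse_cancel) (simp add: add_nonneg_nonneg)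
      have gap: "pnorm2 q u \<delta> - b > 0"
        unfolding pnorm2_def b_def using cod.p d
        by (simp, intro powr_less_mono2) (auto simp: d_def add_nonneg_nonneg)
      have Pw: "P (w m) \<in> vecs (ell q)" for m using ps_mem[OF P dom.bounded_nullD(1)[OF w]] .
      have e1: "\<forall>\<^sub>F m in sequentially. nrm (ell q) (P x + P (w m)) - pnorm2 q u (nrm (ell q) (P (w m))) > - (pnorm2 q u \<delta> - b) / 2"
        using order_tendstoD(1)[OF cod.almost_disjoint_seq[OF ps_mem[OF P x(1)] Pw coordinates_null[OF np w]],
            of "- (pnorm2 q u \<delta> - b) / 2"] gap by (simp add: u_def)
      have e2: "\<forall>\<^sub>F m in sequentially. nrm (ell q) (P (x + w m) - P x - P (w m)) < (pnorm2 q u \<delta> - b) / 2"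
        using order_tendstoD(2)[OF asymptotically_additive[OF x(1) w], of "(pnorm2 q u \<delta> - b) / 2"] gap by simp
      have ev: "\<forall>\<^sub>F m in sequentially. nrm (ell q) (P (w m)) \<ge> \<delta> \<longrightarrow> Inv (Suc L) (x + w m)"
        using e1 e2
      proof eventually_elim
        case (elim m)
        show ?case
        proof
          assume ge: "nrm (ell q) (P (w m)) \<ge> \<delta>"
          have "pnorm2 q u \<delta> \<le> pnorm2 q u (nrm (ell q) (P (w m)))"
            using ge \<delta>(1) by (intro cod.pnorm2_mono) (auto simp: u_def cod.ell_nonneg)
          moreover have "nrm (ell q) (P x + P (w m)) \<le> nrm (ell q) (P (x + w m)) + nrm (ell q) (P (x + w m) - P x - P (w m))"
          proof -
            have m: "P (x + w m) \<in> vecs (ell q)" "P x \<in> vecs (ell q)"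
              using ps_mem[OF P] x(1) dom.bounded_nullD(1)[OF w] by auto
            have "P x + P (w m) = P (x + w m) - (P (x + w m) - P x - P (w m))" by simp
            then show ?thesis using cod.ell.nrm_diff[of "P (x + w m)" "P (x + w m) - P x - P (w m)"] m Pw
              by (metis cod.ell.diff_mem)
          qed
          moreover have "b \<le> D" if "A \<le> B" "C \<le> D + E" "- (A - b) / 2 < C - B" "E < (A - b) / 2" for A B C D E :: real
            using that by argo
          ultimately have "b \<le> nrm (ell q) (P (x + w m))" using elim by blast
          then have "b powr q \<le> nrm (ell q) (P (x + w m)) powr q"
            using cod.p by (intro powr_mono2) (auto simp: b_def)
          then show "Inv (Suc L) (x + w m)" using x(2) bq unfolding Inv_def u_def by (simp add: algebra_simps)
        qed
      qed
      show "\<exists>\<^sub>F m in sequentially. Inv (Suc L) (x + w m)"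
        by (rule frequently_mp[OF ev \<delta>(2)])
    qed
    then obtain x where x: "x \<in> vecs (ell p)" "nrm (ell p) x powr p \<le> real L * (C powr p + 1)"
      "nrm (ell q) (P x) powr q \<ge> real L * d" by (auto simp: Inv_def)
    have "d * real L \<le> nrm (ell q) (P x) powr q" using x(3) by (simp add: mult.commute)
    also have "\<dots> \<le> (N * (real L * (C powr p + 1)) powr (real n / p)) powr q"
      using bound_powr[OF x(1,2)] cod.p by (intro powr_mono2) (auto simp: cod.ell_nonneg N_def)
    also have "\<dots> = N powr q * (real L * (C powr p + 1)) powr (real n * q / p)"
      by (simp add: powr_mult powr_powr)
    finally show "d * real L powr 1 \<le> N powr q * (real L * (C powr p + 1)) powr (real n * q / p)"
      by simp
  qed (use nqp dom.p d K in auto)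
qed

lemma weakly_continuous_if_subcritical:
  assumes nqp: "real n * q < p"
  shows "P \<in> polys_w n (ell p) (ell q)"
proof -
  have "dom.seq_weakly_continuous (ell q) P" unfolding dom.seq_weakly_continuous_def
  proof (intro allI impI, elim conjE)
    fix X :: "nat \<Rightarrow> nat \<Rightarrow> 'k" and x C assume X: "\<forall>m. X m \<in> vecs (ell p) \<and> nrm (ell p) (X m) \<le> C" and x: "x \<in> vecs (ell p)"
      and lim: "\<forall>i. (\<lambda>m. X m i) \<longlonglongrightarrow> x i"
    define w where "w = (\<lambda>m. X m - x)"
    have w: "dom.bounded_null (C + nrm (ell p) x) w"
      unfolding w_def by (rule dom.bounded_null_diff) (use X x lim in auto)
    have Xw: "X m = x + w m" for m by (simp add: w_def)
    show "(\<lambda>m. nrm (ell q) (P (X m) - P x)) \<longlonglongrightarrow> 0"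
    proof (rule Lim_null_comparison)
      show "(\<lambda>m. nrm (ell q) (P (x + w m) - P x - P (w m)) + nrm (ell q) (P (w m))) \<longlonglongrightarrow> 0"
        using tendsto_add[OF asymptotically_additive[OF x w] null_if_subcritical[OF nqp w]] by simp
      show "\<forall>\<^sub>F m in sequentially. norm (nrm (ell q) (P (X m) - P x)) \<le> nrm (ell q) (P (x + w m) - P x - P (w m)) + nrm (ell q) (P (w m))"
      proof (rule always_eventually, rule allI)
        fix m
        have m: "P (x + w m) - P x - P (w m) \<in> vecs (ell q)" "P (w m) \<in> vecs (ell q)"
          using ps_mem[OF P] x dom.bounded_nullD(1)[OF w] by (auto intro!: cod.ell.diff_mem)
        show "norm (nrm (ell q) (P (X m) - P x)) \<le> nrm (ell q) (P (x + w m) - P x - P (w m)) + nrm (ell q) (P (w m))"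
          using cod.ell_add(2)[OF m] by (simp add: Xw cod.ell_nonneg)
      qed
    qed
  qed
  then show ?thesis using P by (simp add: polys_w_def dom.weakly_continuous_on_bounded_iff_seq)
qed

text \<open>The additivity is uniform on blocks, by compactness of the finite-dimensional balls.\<close>

lemma uniformly_additive:
  assumes e: "e > 0"
  shows "\<exists>N. \<forall>y\<in>vecs (ell p). \<forall>w\<in>vecs (ell p). nrm (ell p) y \<le> 1 \<longrightarrow> nrm (ell p) w \<le> 1 \<longrightarrow>
    trunc M y = y \<longrightarrow> trunc N w = 0 \<longrightarrow> nrm (ell q) (P (y + w) - P y - P w) \<le> e"
proof (rule ccontr)
  assume "\<not> ?thesis"
  then have "\<forall>N. \<exists>y w. y \<in> vecs (ell p) \<and> w \<in> vecs (ell p) \<and> nrm (ell p) y \<le> 1 \<and> nrm (ell p) w \<le> 1 \<and>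
    trunc M y = y \<and> trunc N w = 0 \<and> \<not> nrm (ell q) (P (y + w) - P y - P w) \<le> e" by blast
  then obtain Y W where YW: "\<And>N. Y N \<in> vecs (ell p)" "\<And>N. W N \<in> vecs (ell p)" "\<And>N. nrm (ell p) (Y N) \<le> 1"
    "\<And>N. nrm (ell p) (W N) \<le> 1" "\<And>N. trunc M (Y N) = Y N" "\<And>N. trunc N (W N) = 0"
    "\<And>N. \<not> nrm (ell q) (P (Y N + W N) - P (Y N) - P (W N)) \<le> e" by metis
  obtain y r where r: "strict_mono r" and y: "y \<in> vecs (ell p)" "nrm (ell p) y \<le> 1" "\<And>i. (\<lambda>m. Y (r m) i) \<longlonglongrightarrow> y i"
    using dom.ell_ball_seq_compact[of Y 1] YW(1,3) by metis
  define w where "w = (\<lambda>m. W (r m))"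
  have w: "dom.bounded_null 1 w" unfolding dom.bounded_null_def
  proof (intro conjI allI)
    fix i
    have "\<forall>\<^sub>F m in sequentially. w m i = 0"
      using eventually_gt_at_top[of i]
    proof eventually_elim
      case (elim m)
      then have "i < r m" using seq_suble[OF r, of m] by linarith
      then show ?case using fun_cong[OF YW(6)[of "r m"], of i] by (simp add: w_def)
    qed
    then show "(\<lambda>m. w m i) \<longlonglongrightarrow> 0" by (rule tendsto_eventually)
  qed (use YW in \<open>auto simp: w_def\<close>)
  have yM: "trunc M y = y"
  proof
    fix i
    show "trunc M y i = y i"
    proof (cases "i < M")
      case False
      then have "Y (r m) i = 0" for m using fun_cong[OF YW(5)[of "r m"], of i] by simp
      then show ?thesis using False y(3)[of i] by (simp add: LIMSEQ_const_iff)
    qed simp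
  qed
  define h where "h = (\<lambda>m. Y (r m) - y)"
  have hm: "h m \<in> vecs (ell p)" for m using YW(1) y(1) by (auto simp: h_def)
  have h2: "nrm (ell p) (h m) \<le> 2" for m
    using dom.ell.nrm_diff[OF YW(1) y(1), of "r m"] YW(3)[of "r m"] y(2) by (simp add: h_def)
  have hM: "trunc M (h m) = h m" for m using YW(5) yM by (simp add: h_def trunc_diff)
  \<comment> \<open>The vectors \<open>h m\<close> live on the first \<open>M\<close> coordinates,
    where coordinatewise convergence is norm convergence. So the limit \<open>y\<close> can replace
    \<open>Y (r m)\<close> at the Lipschitz cost of \<open>2 * (L * nrm (ell p) (h m))\<close>,
    which reduces the claim to a fixed \<open>y\<close>.\<close>
  have "(\<lambda>m. nrm (ell p) (trunc M (h m))) \<longlonglongrightarrow> 0"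
    using y(3) by (intro dom.trunc_null hm) (simp add: h_def LIM_zero_iff)
  then have h0: "(\<lambda>m. nrm (ell p) (h m)) \<longlonglongrightarrow> 0" by (simp only: hM)
  obtain L where L: "L \<ge> 0" "\<forall>x\<in>vecs (ell p). \<forall>h\<in>vecs (ell p). nrm (ell p) x \<le> 2 \<longrightarrow> nrm (ell p) h \<le> 2 \<longrightarrow>
      nrm (ell q) (P (x + h) - P x) \<le> L * nrm (ell p) h"
    using hom_poly_lipschitz[OF ps_hom[OF P] ps_bounded[OF P], of 2] by blast
  have "(\<lambda>m. 2 * (L * nrm (ell p) (h m)) + nrm (ell q) (P (y + w m) - P y - P (w m))) \<longlonglongrightarrow> 2 * (L * 0) + 0"
    by (intro tendsto_intros h0 asymptotically_additive[OF y(1) w])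
  then have "\<forall>\<^sub>F m in sequentially. 2 * (L * nrm (ell p) (h m)) + nrm (ell q) (P (y + w m) - P y - P (w m)) < e"
    using e by (intro order_tendstoD(2)) auto
  then obtain m where m: "2 * (L * nrm (ell p) (h m)) + nrm (ell q) (P (y + w m) - P y - P (w m)) < e"
    using eventually_happens'[OF sequentially_bot] by blast
  have wm: "w m \<in> vecs (ell p)" "nrm (ell p) (w m) \<le> 1" using dom.bounded_nullD[OF w] by auto
  have ywm: "nrm (ell p) (y + w m) \<le> 2" using dom.ell_add(2)[OF y(1) wm(1)] y(2) wm(2) by linarith
  have Yr: "Y (r m) = y + h m" by (simp add: h_def)
  have l1: "nrm (ell q) (P ((y + w m) + h m) - P (y + w m)) \<le> L * nrm (ell p) (h m)"
    using L(2) hm h2 ywm dom.ell_add(1)[OF y(1) wm(1)] by blast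
  have "nrm (ell p) y \<le> 2" using y(2) by simp
  then have l2: "nrm (ell q) (P (y + h m) - P y) \<le> L * nrm (ell p) (h m)"
    using L(2) hm h2 y(1) by blast
  define A where "A = P ((y + w m) + h m) - P (y + w m)"
  define B where "B = P (y + h m) - P y"
  define D where "D = P (y + w m) - P y - P (w m)"
  have mem: "A \<in> vecs (ell q)" "B \<in> vecs (ell q)" "D \<in> vecs (ell q)"
    unfolding A_def B_def D_def using ps_mem[OF P] y(1) wm(1) hm by (auto intro!: cod.ell.diff_mem dom.ell.add_mem)
  have "Y (r m) + W (r m) = (y + w m) + h m" by (simp add: Yr w_def)
  then have "P (Y (r m) + W (r m)) - P (Y (r m)) - P (W (r m)) = (A - B) + D"
    unfolding A_def B_def D_def Yr by (simp add: w_def add_ac)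
  then have "nrm (ell q) (P (Y (r m) + W (r m)) - P (Y (r m)) - P (W (r m))) \<le> nrm (ell q) A + nrm (ell q) B + nrm (ell q) D"
    using cod.ell_add(2)[of "A - B" D] cod.ell.nrm_diff[of A B] mem by auto
  then show False using YW(7)[of "r m"] l1 l2 m unfolding A_def B_def D_def by linarith
qed

end

end

subsection \<open>The M-ideal in critical degree\<close>

lemma sum_fun_apply: "(\<Sum>i\<in>I. f i) x = (\<Sum>i\<in>I. f i x)" for f :: "'i \<Rightarrow> 'a \<Rightarrow> 'b::comm_monoid_add"
  by (induction I rule: infinite_finite_induct) auto

context ell_pair
begin

definition cutoff :: "nat \<Rightarrow> ((nat \<Rightarrow> 'k::real_normed_field) \<Rightarrow> nat \<Rightarrow> 'k) \<Rightarrow> (nat \<Rightarrow> 'k) \<Rightarrow> nat \<Rightarrow> 'k" where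
  "cutoff m P = (\<lambda>x. if x \<in> vecs (ell p) then P (trunc m x) else 0)"

lemma polys_w_seq:
  fixes P :: "(nat \<Rightarrow> 'k::real_normed_field) \<Rightarrow> nat \<Rightarrow> 'k"
  assumes "P \<in> polys_w n (ell p) (ell q)" "\<And>m. X m \<in> vecs (ell p)" "\<And>m. nrm (ell p) (X m) \<le> C"
    "x \<in> vecs (ell p)" "\<And>i. (\<lambda>m. X m i) \<longlonglongrightarrow> x i"
  shows "(\<lambda>m. nrm (ell q) (P (X m) - P x)) \<longlonglongrightarrow> 0"
  using assms unfolding polys_w_def dom.weakly_continuous_on_bounded_iff_seq dom.seq_weakly_continuous_def
  by blast

lemma cutoff_ps:
  fixes P :: "(nat \<Rightarrow> 'k::real_normed_field) \<Rightarrow> nat \<Rightarrow> 'k"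
  assumes "P \<in> vecs (PS n)"
  shows "cutoff m P \<in> vecs (PS n)"
    and "nrm (PS n) (cutoff m P) \<le> nrm (PS n) P"
  unfolding cutoff_def
  by (rule ps_comp[OF assms], auto simp: trunc_add dom.trunc_scal dom.nrm_trunc_le)+

text \<open>The cut-off depends on finitely many coordinates, for which coordinatewise convergence
  is norm convergence.\<close>

lemma cutoff_polys_w:
  fixes P :: "(nat \<Rightarrow> 'k::real_normed_field) \<Rightarrow> nat \<Rightarrow> 'k"
  assumes P: "P \<in> vecs (PS n)"
  shows "cutoff m P \<in> polys_w n (ell p) (ell q)"
proof -
  have "dom.seq_weakly_continuous (ell q) (cutoff m P)" unfolding dom.seq_weakly_continuous_def
  proof (intro allI impI, elim conjE)
    fix X :: "nat \<Rightarrow> nat \<Rightarrow> 'k" and x C assume X: "\<forall>m. X m \<in> vecs (ell p) \<and> nrm (ell p) (X m) \<le> C"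
      and x: "x \<in> vecs (ell p)" and lim: "\<forall>i. (\<lambda>m. X m i) \<longlonglongrightarrow> x i"
    have "(\<lambda>j. nrm (ell p) (trunc m (X j - x))) \<longlonglongrightarrow> 0"
      using X x lim by (intro dom.trunc_null) (auto simp: LIM_zero_iff)
    then have h: "(\<lambda>j. nrm (ell p) (trunc m (X j) - trunc m x)) \<longlonglongrightarrow> 0" by (simp only: trunc_diff)
    have c: "norm_continuous (ell p) (ell q) P" using P by (simp add: poly_space_def)
    show "(\<lambda>j. nrm (ell q) (cutoff m P (X j) - cutoff m P x)) \<longlonglongrightarrow> 0"
    proof (rule tendstoI)
      fix e :: real assume "e > 0"
      then obtain d where d: "d > 0" "\<forall>y\<in>vecs (ell p). nrm (ell p) (y - trunc m x) < d \<longrightarrow> nrm (ell q) (P y - P (trunc m x)) < e"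
        using c dom.trunc_mem[OF x] unfolding norm_continuous_def by meson
      have "\<forall>\<^sub>F j in sequentially. nrm (ell p) (trunc m (X j) - trunc m x) < d"
        using order_tendstoD(2)[OF h d(1)] .
      then show "\<forall>\<^sub>F j in sequentially. dist (nrm (ell q) (cutoff m P (X j) - cutoff m P x)) 0 < e"
      proof eventually_elim
        case (elim j)
        then have "nrm (ell q) (P (trunc m (X j)) - P (trunc m x)) < e" using d(2) X by simp
        then show ?case using X x by (simp add: cutoff_def cod.ell_nonneg)
      qed
    qed
  qed
  then show ?thesis using cutoff_ps(1)[OF P] by (simp add: polys_w_def dom.weakly_continuous_on_bounded_iff_seq)
qed

text \<open>Bad vectors would have a coordinatewise convergent subsequence, and their truncations at
  growing positions converge to the same limit; \<open>S\<close> is continuous along both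
  sequences.\<close>

lemma polys_w_trunc_uniform:
  fixes S :: "(nat \<Rightarrow> 'k::{real_normed_field,heine_borel}) \<Rightarrow> nat \<Rightarrow> 'k"
  assumes S: "S \<in> polys_w n (ell p) (ell q)" and e: "e > 0"
  shows "\<exists>M. \<forall>m\<ge>M. \<forall>x\<in>vecs (ell p). nrm (ell p) x \<le> 1 \<longrightarrow> nrm (ell q) (S (trunc m x) - S x) \<le> e"
proof (rule ccontr)
  assume "\<not> ?thesis"
  then have "\<forall>M. \<exists>m x. m \<ge> M \<and> x \<in> vecs (ell p) \<and> nrm (ell p) x \<le> 1 \<and> \<not> nrm (ell q) (S (trunc m x) - S x) \<le> e" by meson
  then obtain f X where X: "\<And>M. f M \<ge> M" "\<And>M. X M \<in> vecs (ell p)" "\<And>M. nrm (ell p) (X M) \<le> 1"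
    "\<And>M. \<not> nrm (ell q) (S (trunc (f M) (X M)) - S (X M)) \<le> e" by metis
  obtain x r where r: "strict_mono r" and x: "x \<in> vecs (ell p)" "\<And>i. (\<lambda>m. X (r m) i) \<longlonglongrightarrow> x i"
    using dom.ell_ball_seq_compact[of X 1] X(2,3) by metis
  have Sm: "S y \<in> vecs (ell q)" if "y \<in> vecs (ell p)" for y
    using ps_mem[of S n] S that by (simp add: polys_w_def)
  have l1: "(\<lambda>m. nrm (ell q) (S (X (r m)) - S x)) \<longlonglongrightarrow> 0"
    using X(2,3) x by (intro polys_w_seq[OF S]) auto
  have "(\<lambda>m. trunc (f (r m)) (X (r m)) i) \<longlonglongrightarrow> x i" for i
  proof (rule Lim_transform_eventually[OF x(2)])
    show "\<forall>\<^sub>F m in sequentially. X (r m) i = trunc (f (r m)) (X (r m)) i"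
      using eventually_gt_at_top[of i]
    proof eventually_elim
      case (elim m)
      then have "i < f (r m)" using seq_suble[OF r, of m] X(1)[of "r m"] by linarith
      then show ?case by simp
    qed
  qed
  then have l2: "(\<lambda>m. nrm (ell q) (S (trunc (f (r m)) (X (r m))) - S x)) \<longlonglongrightarrow> 0"
    using X(2,3) x dom.nrm_trunc_le order_trans by (intro polys_w_seq[OF S]) (auto, blast)
  have "\<forall>\<^sub>F m in sequentially. nrm (ell q) (S (trunc (f (r m)) (X (r m))) - S x) + nrm (ell q) (S (X (r m)) - S x) < e"
    using tendsto_add[OF l2 l1] e by (intro order_tendstoD(2)) auto
  then obtain m where m: "nrm (ell q) (S (trunc (f (r m)) (X (r m))) - S x) + nrm (ell q) (S (X (r m)) - S x) < e"
    using eventually_happens'[OF sequentially_bot] by blast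
  define A where "A = S (trunc (f (r m)) (X (r m))) - S x"
  define B where "B = S (X (r m)) - S x"
  have AB: "A \<in> vecs (ell q)" "B \<in> vecs (ell q)" unfolding A_def B_def using Sm X(2) x(1) by auto
  have "S (trunc (f (r m)) (X (r m))) - S (X (r m)) = A - B" by (simp add: A_def B_def)
  then have "nrm (ell q) (S (trunc (f (r m)) (X (r m))) - S (X (r m))) < e"
    using cod.ell.nrm_diff[OF AB] m unfolding A_def B_def by simp
  then show False using X(4)[of "r m"] by simp
qed

lemma cutoff_tendsto:
  fixes S :: "(nat \<Rightarrow> 'k::{real_normed_field,heine_borel}) \<Rightarrow> nat \<Rightarrow> 'k"
  assumes S: "S \<in> polys_w n (ell p) (ell q)"
  shows "(\<lambda>m. nrm (PS n) (cutoff m S - S)) \<longlonglongrightarrow> 0"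
proof (rule LIMSEQ_I)
  fix e :: real assume e: "e > 0"
  have S': "S \<in> vecs (PS n)" using S by (simp add: polys_w_def)
  interpret PSn: normed_nspace "PS n :: ('k, _) nspace" by (rule normed_poly_space)
  obtain M where M: "\<forall>m\<ge>M. \<forall>x\<in>vecs (ell p). nrm (ell p) x \<le> 1 \<longrightarrow> nrm (ell q) (S (trunc m x) - S x) \<le> e / 2"
    using polys_w_trunc_uniform[OF S, of "e / 2"] e by auto
  have "nrm (PS n) (cutoff m S - S) \<le> e / 2" if "m \<ge> M" for m
    using M that by (intro ps_nrm_le) (simp add: cutoff_def)
  moreover have "cutoff m S - S \<in> vecs (PS n)" for m
    using cutoff_ps(1)[OF S'] S' by blast
  ultimately show "\<exists>no. \<forall>m\<ge>no. norm (nrm (PS n) (cutoff m S - S) - 0) < e"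
    using e by (intro exI[of _ M]) fastforce
qed

text \<open>Compactness of the ball for coordinatewise convergence makes its image under
  \<open>S\<close> relatively compact in norm, and tails are uniformly small on such sets.\<close>

lemma polys_w_tail_uniform:
  fixes S :: "(nat \<Rightarrow> 'k::{real_normed_field,heine_borel}) \<Rightarrow> nat \<Rightarrow> 'k"
  assumes S: "S \<in> polys_w n (ell p) (ell q)" and e: "e > 0"
  shows "\<exists>a. \<forall>x\<in>vecs (ell p). nrm (ell p) x \<le> 1 \<longrightarrow> nrm (ell q) (S x - trunc a (S x)) \<le> e"
proof (rule ccontr)
  assume "\<not> ?thesis"
  then have "\<forall>a. \<exists>x. x \<in> vecs (ell p) \<and> nrm (ell p) x \<le> 1 \<and> \<not> nrm (ell q) (S x - trunc a (S x)) \<le> e" by meson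
  then obtain X where X: "\<And>a. X a \<in> vecs (ell p)" "\<And>a. nrm (ell p) (X a) \<le> 1"
    "\<And>a. \<not> nrm (ell q) (S (X a) - trunc a (S (X a))) \<le> e" by metis
  obtain x r where r: "strict_mono r" and x: "x \<in> vecs (ell p)" "\<And>i. (\<lambda>m. X (r m) i) \<longlonglongrightarrow> x i"
    using dom.ell_ball_seq_compact[of X 1] X(1,2) by metis
  have Sm: "S y \<in> vecs (ell q)" if "y \<in> vecs (ell p)" for y
    using ps_mem[of S n] S that by (simp add: polys_w_def)
  have l1: "(\<lambda>m. nrm (ell q) (S (X (r m)) - S x)) \<longlonglongrightarrow> 0"
    using X(1,2) x by (intro polys_w_seq[OF S]) auto
  have l2: "(\<lambda>m. nrm (ell q) (S x - trunc (r m) (S x))) \<longlonglongrightarrow> 0"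
    using LIMSEQ_subseq_LIMSEQ[OF cod.tail_null[OF Sm[OF x(1)]] r] by (simp only: o_def)
  have "\<forall>\<^sub>F m in sequentially. nrm (ell q) (S (X (r m)) - S x) + nrm (ell q) (S x - trunc (r m) (S x)) < e"
    using tendsto_add[OF l1 l2] e by (intro order_tendstoD(2)) auto
  then obtain m where m: "nrm (ell q) (S (X (r m)) - S x) + nrm (ell q) (S x - trunc (r m) (S x)) < e"
    using eventually_happens'[OF sequentially_bot] by blast
  define D where "D = S (X (r m)) - S x"
  have D: "D \<in> vecs (ell q)" unfolding D_def using Sm X(1) x(1) by auto
  have "S (X (r m)) - trunc (r m) (S (X (r m))) = (D - trunc (r m) D) + (S x - trunc (r m) (S x))"
    unfolding D_def trunc_diff by simp
  then have "nrm (ell q) (S (X (r m)) - trunc (r m) (S (X (r m)))) \<le> nrm (ell q) D + nrm (ell q) (S x - trunc (r m) (S x))"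
    using cod.ell_add(2)[of "D - trunc (r m) D" "S x - trunc (r m) (S x)"] cod.nrm_tail_le[OF D, of "r m"] D Sm[OF x(1)] by auto
  then show False using X(3)[of "r m"] m unfolding D_def by linarith
qed

section \<open>The norm of \<open>S + R\<close> minus an average of cut-offs of
  \<open>R\<close>\<close>

context
  fixes n :: nat and R S :: "(nat \<Rightarrow> 'k::{real_normed_field,heine_borel}) \<Rightarrow> nat \<Rightarrow> 'k"
  assumes n: "1 \<le> n" and below: "all_weakly_continuous_below TYPE('k) n" and npq: "p \<le> real n * q"
    and R: "R \<in> vecs (PS n)" "nrm (PS n) R \<le> 1"
    and S: "S \<in> polys_w n (ell p) (ell q)" "nrm (PS n) S \<le> 1"
begin

text \<open>Vectors starting ever later form a bounded null sequence, so a failure would contradict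
  \<open>coordinates_null\<close>. With the small tails of the values of \<open>S\<close>, this
  makes \<open>S\<close> on a head and \<open>R\<close> on a far tail almost disjoint.\<close>

lemma head_uniform:
  assumes np: "real n < p" and e: "e > 0"
  shows "\<exists>b. \<forall>w\<in>vecs (ell p). nrm (ell p) w \<le> 1 \<longrightarrow> trunc b w = 0 \<longrightarrow> nrm (ell q) (trunc a (R w)) \<le> e"
proof (rule ccontr)
  assume "\<not> ?thesis"
  then have "\<forall>b. \<exists>w. w \<in> vecs (ell p) \<and> nrm (ell p) w \<le> 1 \<and> trunc b w = 0 \<and> \<not> nrm (ell q) (trunc a (R w)) \<le> e" by meson
  then obtain W where W: "\<And>b. W b \<in> vecs (ell p)" "\<And>b. nrm (ell p) (W b) \<le> 1" "\<And>b. trunc b (W b) = 0"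
    "\<And>b. \<not> nrm (ell q) (trunc a (R (W b))) \<le> e" by metis
  have null: "dom.bounded_null 1 W" unfolding dom.bounded_null_def
  proof (intro conjI allI)
    fix i
    have "\<forall>\<^sub>F b in sequentially. W b i = 0" using eventually_gt_at_top[of i]
    proof eventually_elim
      case (elim b)
      then show ?case using fun_cong[OF W(3)[of b], of i] by simp
    qed
    then show "(\<lambda>b. W b i) \<longlonglongrightarrow> 0" by (rule tendsto_eventually)
  qed (use W in auto)
  have "(\<lambda>b. nrm (ell q) (trunc a (R (W b)))) \<longlonglongrightarrow> 0"
    using W(1) coordinates_null[OF n below R(1) np null] by (intro cod.trunc_null ps_mem[OF R(1)])
  then have "\<forall>\<^sub>F b in sequentially. nrm (ell q) (trunc a (R (W b))) < e" using e by (rule order_tendstoD(2))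
  then obtain b where "nrm (ell q) (trunc a (R (W b))) < e" using eventually_happens'[OF sequentially_bot] by blast
  then show False using W(4)[of b] by simp
qed

lemma head_tail_bound:
  assumes e: "e > 0"
  shows "\<exists>b. \<forall>m\<ge>b. \<forall>x\<in>vecs (ell p). nrm (ell p) x \<le> 1 \<longrightarrow> nrm (ell q) (S (trunc m x) + R (x - trunc m x)) \<le> 1 + e"
proof -
  have S': "S \<in> vecs (PS n)" using S(1) by (simp add: polys_w_def)
  have comp: "nrm (ell q) (S (trunc m x)) \<le> nrm (ell p) (trunc m x) ^ n"
    "nrm (ell q) (R (x - trunc m x)) \<le> nrm (ell p) (x - trunc m x) ^ n"
    "nrm (ell p) (trunc m x) \<le> 1" "nrm (ell p) (x - trunc m x) \<le> 1"
    "nrm (ell p) (trunc m x) powr p + nrm (ell p) (x - trunc m x) powr p \<le> 1"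
    if x: "x \<in> vecs (ell p)" "nrm (ell p) x \<le> 1" for x m
  proof -
    have "nrm (PS n) S * nrm (ell p) (trunc m x) ^ n \<le> 1 * nrm (ell p) (trunc m x) ^ n"
      using S(2) by (intro mult_right_mono) (auto simp: dom.ell_nonneg)
    then show "nrm (ell q) (S (trunc m x)) \<le> nrm (ell p) (trunc m x) ^ n"
      using ps_nrm[OF S' dom.trunc_mem[OF x(1)], of m] by simp
    have t: "x - trunc m x \<in> vecs (ell p)" using x by auto
    have "nrm (PS n) R * nrm (ell p) (x - trunc m x) ^ n \<le> 1 * nrm (ell p) (x - trunc m x) ^ n"
      using R(2) by (intro mult_right_mono) (auto simp: dom.ell_nonneg)
    then show "nrm (ell q) (R (x - trunc m x)) \<le> nrm (ell p) (x - trunc m x) ^ n"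
      using ps_nrm[OF R(1) t] by simp
    show "nrm (ell p) (trunc m x) \<le> 1" "nrm (ell p) (x - trunc m x) \<le> 1"
      using dom.nrm_trunc_le[OF x(1), of m] dom.nrm_tail_le[OF x(1), of m] x(2) by auto
    have "nrm (ell p) x powr p \<le> 1 powr p" using x(2) dom.p by (intro powr_mono2) (auto simp: dom.ell_nonneg)
    then show "nrm (ell p) (trunc m x) powr p + nrm (ell p) (x - trunc m x) powr p \<le> 1"
      using dom.nrm_split[OF x(1), of m] by simp
  qed
  \<comment> \<open>Used with \<open>s = 1\<close> if \<open>n \<ge> p\<close>, and with
    \<open>s = q\<close> otherwise: in both cases the \<open>p\<close>-th powers of the norms of
    head and tail, whose sum is at most 1, dominate.\<close>
  have pw: "(a ^ n) powr s \<le> a powr p" if "0 \<le> a" "a \<le> 1" "p \<le> real n * s" for a s :: real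
  proof (cases "a = 0")
    case True
    then show ?thesis using n by simp
  next
    case False
    then have "(a ^ n) powr s = a powr (real n * s)" using that(1) by (simp add: powr_powr powr_realpow[symmetric])
    also have "\<dots> \<le> a powr p" using that by (intro powr_mono') auto
    finally show ?thesis .
  qed
  show ?thesis
  proof (cases "real n < p")
    case False
    have "nrm (ell q) (S (trunc m x) + R (x - trunc m x)) \<le> 1 + e" if x: "x \<in> vecs (ell p)" "nrm (ell p) x \<le> 1" for m x
    proof -
      have m: "S (trunc m x) \<in> vecs (ell q)" "R (x - trunc m x) \<in> vecs (ell q)"
        using x by (auto intro!: ps_mem[OF S'] ps_mem[OF R(1)])
      have "(nrm (ell p) (trunc m x) ^ n) powr 1 + (nrm (ell p) (x - trunc m x) ^ n) powr 1
          \<le> nrm (ell p) (trunc m x) powr p + nrm (ell p) (x - trunc m x) powr p"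
        using comp(3,4)[OF x, of m] False by (intro add_mono pw) (auto simp: dom.ell_nonneg)
      then show ?thesis using cod.ell_add(2)[OF m] comp(1,2,5)[OF x, of m] e by (simp add: dom.ell_nonneg)
    qed
    then show ?thesis by blast
  next
    case True
    obtain a where a: "\<forall>x\<in>vecs (ell p). nrm (ell p) x \<le> 1 \<longrightarrow> nrm (ell q) (S x - trunc a (S x)) \<le> e / 4"
      using polys_w_tail_uniform[OF S(1), of "e / 4"] e by auto
    obtain b where b: "\<forall>w\<in>vecs (ell p). nrm (ell p) w \<le> 1 \<longrightarrow> trunc b w = 0 \<longrightarrow> nrm (ell q) (trunc a (R w)) \<le> e / 4"
      using head_uniform[OF True, of "e / 4" a] e by auto
    have "nrm (ell q) (S (trunc m x) + R (x - trunc m x)) \<le> 1 + e"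
      if x: "x \<in> vecs (ell p)" "nrm (ell p) x \<le> 1" and mb: "m \<ge> b" for m x
    proof -
      have m: "S (trunc m x) \<in> vecs (ell q)" "R (x - trunc m x) \<in> vecs (ell q)"
        using x by (auto intro!: ps_mem[OF S'] ps_mem[OF R(1)])
      have "trunc b (x - trunc m x) = 0" using mb by auto
      then have h: "nrm (ell q) (trunc a (R (x - trunc m x))) \<le> e / 4"
        using b comp(4)[OF x, of m] x(1) by auto
      have t: "nrm (ell q) (S (trunc m x) - trunc a (S (trunc m x))) \<le> e / 4"
        using a comp(3)[OF x, of m] x(1) by auto
      have "pnorm2 q (nrm (ell q) (S (trunc m x))) (nrm (ell q) (R (x - trunc m x)))
          \<le> pnorm2 q (nrm (ell p) (trunc m x) ^ n) (nrm (ell p) (x - trunc m x) ^ n)"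
        using comp(1,2)[OF x, of m] by (intro cod.pnorm2_mono) (auto simp: cod.ell_nonneg)
      also have "\<dots> \<le> (nrm (ell p) (trunc m x) powr p + nrm (ell p) (x - trunc m x) powr p) powr (1 / q)"
        unfolding pnorm2_def using comp(3,4)[OF x, of m] npq cod.p
        by (intro powr_mono2 add_mono pw) (auto simp: dom.ell_nonneg)
      also have "\<dots> \<le> 1 powr (1 / q)"
        using comp(5)[OF x, of m] cod.p by (intro powr_mono2) auto
      finally show ?thesis using cod.almost_disjoint[OF m, of a] h t by simp
    qed
    then show ?thesis by blast
  qed
qed

text \<open>
  Cutting \<open>R\<close> at \<open>s k\<close> is harmless when \<open>x\<close> is small between \<open>s k\<close> and \<open>s (k + 1)\<close>, since \<open>R\<close> does
  not couple coordinates that far apart; this holds for most \<open>k\<close>.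
\<close>

lemma cutoff_error:
  assumes L: "\<forall>x\<in>vecs (ell p). \<forall>h\<in>vecs (ell p). nrm (ell p) x \<le> 1 \<longrightarrow> nrm (ell p) h \<le> 1 \<longrightarrow>
      nrm (ell q) (R (x + h) - R x) \<le> L * nrm (ell p) h"
    and add: "\<forall>y\<in>vecs (ell p). \<forall>w\<in>vecs (ell p). nrm (ell p) y \<le> 1 \<longrightarrow> nrm (ell p) w \<le> 1 \<longrightarrow>
      trunc a y = y \<longrightarrow> trunc b w = 0 \<longrightarrow> nrm (ell q) (R (y + w) - R y - R w) \<le> e1"
    and ht: "nrm (ell q) (S (trunc a x) + R (x - trunc a x)) \<le> 1 + e2"
    and tr: "nrm (ell q) (S (trunc a x) - S x) \<le> e3"
    and x: "x \<in> vecs (ell p)" "nrm (ell p) x \<le> 1" and ab: "a \<le> c" "b \<le> c"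
  shows "nrm (ell q) (S x + R x - R (trunc a x)) \<le> 1 + e1 + e2 + e3 + 2 * (L * nrm (ell p) (trunc c x - trunc a x))"
proof -
  have S': "S \<in> vecs (PS n)" using S(1) by (simp add: polys_w_def)
  define y where "y = trunc a x" define h where "h = trunc c x - trunc a x" define w where "w = x - trunc c x"
  have mem: "y \<in> vecs (ell p)" "h \<in> vecs (ell p)" "w \<in> vecs (ell p)" "y + w \<in> vecs (ell p)" "w + h \<in> vecs (ell p)"
    "(y + w) + h \<in> vecs (ell p)"
    using x(1) by (auto simp: y_def h_def w_def intro!: dom.ell.add_mem dom.ell.diff_mem)
  have small: "nrm (ell p) z \<le> 1" if "\<And>i. norm (z i) \<le> norm (x i)" for z :: "nat \<Rightarrow> 'k"
    using dom.ell_mono(2)[OF x(1) that] x(2) by linarith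
  have nb: "nrm (ell p) y \<le> 1" "nrm (ell p) h \<le> 1" "nrm (ell p) w \<le> 1" "nrm (ell p) (y + w) \<le> 1"
    by (rule small, use ab in \<open>auto simp: y_def h_def w_def\<close>)+
  have xe: "x = (y + w) + h" "x - trunc a x = w + h" by (simp_all add: y_def h_def w_def)
  \<comment> \<open>\<open>A\<close> is the head-tail term, \<open>B\<close> replaces
    \<open>S y\<close> by \<open>S x\<close>, and \<open>C\<close> is the additivity defect across
    the gap. \<open>D\<close> and \<open>E\<close> put the block \<open>h\<close> back, once beside
    \<open>y + w\<close> and once beside \<open>w\<close>; hence the factor 2 in front of
    \<open>L\<close>.\<close>
  define A where "A = S y + R (w + h)" define B where "B = S x - S y"
  define C where "C = R (y + w) - R y - R w" define D where "D = R ((y + w) + h) - R (y + w)"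
  define E where "E = R (w + h) - R w"
  have Sm: "S z \<in> vecs (ell q)" "R z \<in> vecs (ell q)" if "z \<in> vecs (ell p)" for z
    using that ps_mem[OF S'] ps_mem[OF R(1)] by auto
  have m: "A \<in> vecs (ell q)" "B \<in> vecs (ell q)" "C \<in> vecs (ell q)" "D \<in> vecs (ell q)" "E \<in> vecs (ell q)"
    unfolding A_def B_def C_def D_def E_def using Sm mem x(1) by (auto intro!: cod.ell.add_mem cod.ell.diff_mem)
  have bA: "nrm (ell q) A \<le> 1 + e2" using ht unfolding A_def xe(2) y_def .
  have bB: "nrm (ell q) B \<le> e3"
    using tr cod.ell.nrm_diff_commute[OF Sm(1)[OF x(1)] Sm(1)[OF mem(1)]] by (simp add: B_def y_def)
  have "trunc a y = y" "trunc b w = 0" using ab by (auto simp: y_def w_def)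
  then have bC: "nrm (ell q) C \<le> e1" using add mem nb unfolding C_def by blast
  have bD: "nrm (ell q) D \<le> L * nrm (ell p) h" using L mem nb unfolding D_def by blast
  have bE: "nrm (ell q) E \<le> L * nrm (ell p) h" using L mem nb unfolding E_def by blast
  have eq: "S x + R x - R (trunc a x) = A + B + C + D - E"
    unfolding A_def B_def C_def D_def E_def xe(1)[symmetric] y_def[symmetric] by simp
  have "nrm (ell q) (A + B + C + D - E) \<le> nrm (ell q) A + nrm (ell q) B + nrm (ell q) C + nrm (ell q) D + nrm (ell q) E"
    using cod.ell_add(2)[OF m(1,2)] cod.ell_add(2)[of "A + B" C] cod.ell_add(2)[of "A + B + C" D]
      cod.ell.nrm_diff[of "A + B + C + D" E] m cod.ell.add_mem by (smt (verit, del_insts))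
  then show ?thesis using bA bB bC bD bE unfolding h_def eq by linarith
qed

text \<open>A block norm above \<open>\<theta>\<close> is at most its \<open>p\<close>-th power
  divided by \<open>\<theta> powr (p - 1)\<close>, and the \<open>p\<close>-th powers telescope to
  at most 1. So the blocks above \<open>\<theta>\<close> contribute a bound independent of
  \<open>N\<close>, which disappears in the average.\<close>

lemma sum_blocks_le:
  assumes s: "\<And>k. s k < s (Suc k)" and x: "x \<in> vecs (ell p)" "nrm (ell p) x \<le> 1" and \<theta>: "\<theta> > 0"
  shows "(\<Sum>k<N. nrm (ell p) (trunc (s (Suc k)) x - trunc (s k) x)) \<le> real N * \<theta> + 1 / \<theta> powr (p - 1)"
proof -
  define d where "d = (\<lambda>k. nrm (ell p) (trunc (s (Suc k)) x - trunc (s k) x))"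
  have dp: "d k powr p = nrm (ell p) (trunc (s (Suc k)) x) powr p - nrm (ell p) (trunc (s k) x) powr p" for k
  proof -
    have "trunc (s k) (trunc (s (Suc k)) x) = trunc (s k) x" using s[of k] by auto
    then show ?thesis using dom.nrm_split[OF dom.trunc_mem[OF x(1)], of "s (Suc k)" "s k"] by (simp add: d_def)
  qed
  have "(\<Sum>k<N. d k powr p) = nrm (ell p) (trunc (s N) x) powr p - nrm (ell p) (trunc (s 0) x) powr p"
    unfolding dp by (rule sum_lessThan_telescope)
  also have "\<dots> \<le> nrm (ell p) (trunc (s N) x) powr p" by simp
  also have "\<dots> \<le> 1 powr p"
    using dom.nrm_trunc_le[OF x(1), of "s N"] x(2) dom.p by (intro powr_mono2) (auto simp: dom.ell_nonneg)
  finally have sum1: "(\<Sum>k<N. d k powr p) \<le> 1" by simp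
  have each: "d k \<le> \<theta> + d k powr p / \<theta> powr (p - 1)" for k
  proof (cases "d k \<le> \<theta>")
    case True
    then show ?thesis by (simp add: add_increasing2)
  next
    case False
    then have "\<theta> powr (p - 1) \<le> d k powr (p - 1)" using \<theta> dom.p by (intro powr_mono2) auto
    then have "d k * \<theta> powr (p - 1) \<le> d k * d k powr (p - 1)" using False \<theta> by (intro mult_left_mono) auto
    also have "\<dots> = d k powr 1 * d k powr (p - 1)" using False \<theta> by simp
    also have "\<dots> = d k powr p" unfolding powr_add[symmetric] by simp
    finally have "d k \<le> d k powr p / \<theta> powr (p - 1)" using \<theta> by (simp add: field_simps)
    then show ?thesis using \<theta> by linarith
  qed
  have "(\<Sum>k<N. d k) \<le> (\<Sum>k<N. \<theta> + d k powr p / \<theta> powr (p - 1))" by (rule sum_mono) (rule each)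
  also have "\<dots> = real N * \<theta> + (\<Sum>k<N. d k powr p) / \<theta> powr (p - 1)" by (simp add: sum.distrib sum_divide_distrib)
  also have "\<dots> \<le> real N * \<theta> + 1 / \<theta> powr (p - 1)" using sum1 by (simp add: divide_right_mono)
  finally show ?thesis by (simp add: d_def)
qed

text \<open>The cuts in \<open>T\<close> are fixed before \<open>x\<close>. For each
  \<open>x\<close> the error at a cut is governed by the norm of \<open>x\<close> on the block after
  it, and these norms are small on average.\<close>

lemma cutoff_average:
  assumes e: "e > 0" and I: "infinite I"
  shows "\<exists>T\<subseteq>I. finite T \<and> T \<noteq> {} \<and> nrm (PS n)
    (S + R - scal (PS n) (inverse (of_nat (card T))) (\<Sum>m\<in>T. cutoff m R)) \<le> 1 + e"
proof -
  have S': "S \<in> vecs (PS n)" using S(1) by (simp add: polys_w_def)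
  obtain L where L: "L \<ge> 0" "\<forall>x\<in>vecs (ell p). \<forall>h\<in>vecs (ell p). nrm (ell p) x \<le> 1 \<longrightarrow> nrm (ell p) h \<le> 1 \<longrightarrow>
      nrm (ell q) (R (x + h) - R x) \<le> L * nrm (ell p) h"
    using hom_poly_lipschitz[OF ps_hom[OF R(1)] ps_bounded[OF R(1)], of 1] by blast
  obtain b0 where b0: "\<forall>m\<ge>b0. \<forall>x\<in>vecs (ell p). nrm (ell p) x \<le> 1 \<longrightarrow>
      nrm (ell q) (S (trunc m x) + R (x - trunc m x)) \<le> 1 + e / 4"
    using head_tail_bound[of "e / 4"] e by auto
  obtain M0 where M0: "\<forall>m\<ge>M0. \<forall>x\<in>vecs (ell p). nrm (ell p) x \<le> 1 \<longrightarrow> nrm (ell q) (S (trunc m x) - S x) \<le> e / 4"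
    using polys_w_trunc_uniform[OF S(1), of "e / 4"] e by auto
  have "\<forall>M. \<exists>N. \<forall>y\<in>vecs (ell p). \<forall>w\<in>vecs (ell p). nrm (ell p) y \<le> 1 \<longrightarrow> nrm (ell p) w \<le> 1 \<longrightarrow>
      trunc M y = y \<longrightarrow> trunc N w = 0 \<longrightarrow> nrm (ell q) (R (y + w) - R y - R w) \<le> e / 4"
    using uniformly_additive[OF n below R(1), of "e / 4"] e by auto
  then obtain g where g: "\<And>M. \<forall>y\<in>vecs (ell p). \<forall>w\<in>vecs (ell p). nrm (ell p) y \<le> 1 \<longrightarrow> nrm (ell p) w \<le> 1 \<longrightarrow>
      trunc M y = y \<longrightarrow> trunc (g M) w = 0 \<longrightarrow> nrm (ell q) (R (y + w) - R y - R w) \<le> e / 4" by metis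
  \<comment> \<open>Each cut lies beyond \<open>g\<close> of its predecessor, so \<open>R\<close> is
    almost additive across the block between them.\<close>
  have "\<exists>s. \<forall>k. (s k \<in> I \<and> b0 \<le> s k \<and> M0 \<le> s k) \<and> (s k < s (Suc k) \<and> g (s k) \<le> s (Suc k))"
  proof (rule dependent_nat_choice)
    show "\<exists>x. x \<in> I \<and> b0 \<le> x \<and> M0 \<le> x"
      using I unfolding infinite_nat_iff_unbounded_le by (metis max.bounded_iff)
    fix x :: nat and k :: nat assume "x \<in> I \<and> b0 \<le> x \<and> M0 \<le> x"
    moreover obtain y where "y \<ge> max (Suc x) (g x)" "y \<in> I"
      using I unfolding infinite_nat_iff_unbounded_le by blast
    ultimately show "\<exists>y. (y \<in> I \<and> b0 \<le> y \<and> M0 \<le> y) \<and> (x < y \<and> g x \<le> y)" by (intro exI[of _ y]) auto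
  qed
  then obtain s where s: "\<And>k. s k \<in> I" "\<And>k. b0 \<le> s k" "\<And>k. M0 \<le> s k" "\<And>k. s k < s (Suc k)" "\<And>k. g (s k) \<le> s (Suc k)"
    by blast
  have inj: "inj s" using s(4) by (simp add: strict_mono_Suc_iff strict_mono_imp_inj_on)
  \<comment> \<open>The blocks will cost on average at most
    \<open>4 * L * \<theta> \<le> e / 4\<close>, the last quarter besides the three constant errors
    of \<open>cutoff_error\<close>.\<close>
  define \<theta> where "\<theta> = e / (16 * (L + 1))"
  have \<theta>: "\<theta> > 0" using e L(1) by (simp add: \<theta>_def)
  \<comment> \<open>Makes the second term of \<open>sum_blocks_le\<close> at most
    \<open>real N * \<theta>\<close>, like the first.\<close>
  obtain N :: nat where N: "real N \<ge> max 1 (1 / \<theta> powr (p - 1) / \<theta>)" using real_arch_simple by blast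
  then have N1: "N \<ge> 1" by simp
  have N2: "1 / \<theta> powr (p - 1) \<le> real N * \<theta>" using N \<theta> by (simp add: pos_divide_le_eq mult_ac)
  define T where "T = s ` {..<N}"
  have T: "T \<subseteq> I" "finite T" "T \<noteq> {}" "card T = N"
    using s(1) N1 by (auto simp: T_def card_image inj_on_subset[OF inj] lessThan_empty_iff)
  have avg: "nrm (PS n)
    (S + R - scal (PS n) (inverse (of_nat (card T))) (\<Sum>m\<in>T. cutoff m R)) \<le> 1 + e"
  proof (rule ps_nrm_le)
    fix x :: "nat \<Rightarrow> 'k" assume x: "x \<in> vecs (ell p)" "nrm (ell p) x \<le> 1"
    define d where "d = (\<lambda>k. nrm (ell p) (trunc (s (Suc k)) x - trunc (s k) x))"
    define z where "z = (\<lambda>k. S x + R x - R (trunc (s k) x))"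
    have zm: "z k \<in> vecs (ell q)" for k
      unfolding z_def using x(1) by (auto intro!: cod.ell.add_mem cod.ell.diff_mem ps_mem[OF S'] ps_mem[OF R(1)])
    have zb: "nrm (ell q) (z k) \<le> 1 + e / 4 + e / 4 + e / 4 + 2 * (L * d k)" for k
      unfolding z_def d_def
      by (rule cutoff_error[OF L(2) g[of "s k"] _ _ x less_imp_le[OF s(4)] s(5)]) (use b0 M0 s x in auto)
    have "(\<Sum>m\<in>T. cutoff m R) x = (\<Sum>k<N. R (trunc (s k) x))"
      unfolding sum_fun_apply T_def using x(1)
      by (subst sum.reindex) (auto simp: inj_on_subset[OF inj] cutoff_def)
    then have "(S + R - scal (PS n) (inverse (of_nat (card T))) (\<Sum>m\<in>T. cutoff m R)) x
        = S x + R x - scal (ell q) (inverse (of_nat N)) (\<Sum>k<N. R (trunc (s k) x))"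
      by (simp add: scal_poly_space T(4))
    also have "\<dots> = scal (ell q) (inverse (of_nat N)) (\<Sum>k<N. z k)"
    proof
      fix i
      show "(S x + R x - scal (ell q) (inverse (of_nat N)) (\<Sum>k<N. R (trunc (s k) x))) i
          = scal (ell q) (inverse (of_nat N)) (\<Sum>k<N. z k) i"
        using N1 by (simp add: cod.scal_ell sum_fun_apply z_def sum_subtractf field_simps)
    qed
    finally have eq: "(S + R - scal (PS n) (inverse (of_nat (card T))) (\<Sum>m\<in>T. cutoff m R)) x
        = scal (ell q) (inverse (of_nat N)) (\<Sum>k<N. z k)" .
    have "nrm (ell q) (scal (ell q) (inverse (of_nat N)) (\<Sum>k<N. z k)) = inverse (real N) * nrm (ell q) (\<Sum>k<N. z k)"
      using zm by (subst cod.ell.nrm_scal) (auto simp: norm_inverse)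
    also have "\<dots> \<le> inverse (real N) * (\<Sum>k<N. 1 + e / 4 + e / 4 + e / 4 + 2 * (L * d k))"
      using zb zm by (intro mult_left_mono order_trans[OF cod.ell.nrm_sum] sum_mono) auto
    also have "\<dots> \<le> 1 + e"
    proof -
      have "(\<Sum>k<N. d k) \<le> 2 * (real N * \<theta>)"
        using sum_blocks_le[of s x \<theta> N] s(4) x \<theta> N2 by (simp add: d_def)
      then have "L * (\<Sum>k<N. d k) \<le> L * (2 * (real N * \<theta>))" using L(1) by (intro mult_left_mono)
      moreover have "(\<Sum>k<N. 1 + e / 4 + e / 4 + e / 4 + 2 * (L * d k)) = real N * (1 + 3 * (e / 4)) + 2 * (L * (\<Sum>k<N. d k))"
        by (simp add: sum.distrib sum_distrib_left algebra_simps)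
      ultimately have "(\<Sum>k<N. 1 + e / 4 + e / 4 + e / 4 + 2 * (L * d k)) \<le> real N * (1 + 3 * (e / 4)) + 2 * (L * (2 * (real N * \<theta>)))"
        by linarith
      also have "\<dots> = real N * (1 + 3 * (e / 4) + 4 * L * \<theta>)" by (simp add: algebra_simps)
      also have "\<dots> \<le> real N * (1 + e)"
      proof (rule mult_left_mono)
        have "4 * L * \<theta> \<le> 4 * (L + 1) * \<theta>" using \<theta> by (intro mult_right_mono) auto
        also have "\<dots> = e / 4" using L(1) by (simp add: \<theta>_def field_simps)
        finally show "1 + 3 * (e / 4) + 4 * L * \<theta> \<le> 1 + e" by simp
      qed simp
      finally have "(\<Sum>k<N. 1 + e / 4 + e / 4 + e / 4 + 2 * (L * d k)) \<le> real N * (1 + e)" .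
      then show ?thesis using N1 by (simp add: divide_simps inverse_eq_divide mult_ac)
    qed
    finally show "nrm (ell q) ((S + R - scal (PS n) (inverse (of_nat (card T))) (\<Sum>m\<in>T. cutoff m R)) x) \<le> 1 + e"
      unfolding eq .
  qed
  show ?thesis using T(1-3) avg by blast
qed

end

theorem M_ideal_critical:
  assumes n: "1 \<le> n" and below: "all_weakly_continuous_below TYPE('k::{real_normed_field,heine_borel}) n"
    and npq: "p \<le> real n * q"
  shows "M_ideal (polys_w n (ell p) (ell q)) (poly_space n (ell p :: ('k, nat \<Rightarrow> 'k) nspace) (ell q))"
proof -
  interpret M_ideal_approximation "poly_space n (ell p :: ('k, nat \<Rightarrow> 'k) nspace) (ell q)"
    "polys_w n (ell p) (ell q)" cutoff
  proof (intro M_ideal_approximation.intro normed_poly_space M_ideal_approximation_axioms.intro)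
    show "closed_subspace (polys_w n (ell p) (ell q)) (poly_space n (ell p :: ('k, nat \<Rightarrow> 'k) nspace) (ell q))"
      by (rule closed_subspace_polys_w)
  next
    fix P Q :: "(nat \<Rightarrow> 'k) \<Rightarrow> nat \<Rightarrow> 'k" and m m' :: nat and c :: 'k
    assume P: "P \<in> vecs (PS n)"
    show "cutoff m P \<in> polys_w n (ell p) (ell q)" by (rule cutoff_polys_w[OF P])
    show "cutoff m (P + Q) = cutoff m P + cutoff m Q" by (auto simp: cutoff_def fun_eq_iff)
    show "cutoff m (scal (PS n) c P) = scal (PS n) c (cutoff m P)"
      by (auto simp: cutoff_def scal_poly_space fun_eq_iff cod.scal_ell)
    show "nrm (PS n) (cutoff m P) \<le> nrm (PS n) P"
      by (rule cutoff_ps(2)[OF P])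
    show "cutoff m' (cutoff m P) = cutoff m P" if "m \<le> m'"
      using that by (auto simp: cutoff_def fun_eq_iff min_absorb1 min_absorb2)
  next
    fix P :: "(nat \<Rightarrow> 'k) \<Rightarrow> nat \<Rightarrow> 'k"
    assume "P \<in> polys_w n (ell p) (ell q)"
    then show "(\<lambda>m. nrm (PS n) (cutoff m P - P)) \<longlonglongrightarrow> 0" by (rule cutoff_tendsto)
  next
    fix S R :: "(nat \<Rightarrow> 'k) \<Rightarrow> nat \<Rightarrow> 'k" and e :: real and I :: "nat set"
    assume "S \<in> polys_w n (ell p) (ell q)" "R \<in> vecs (PS n)"
      "nrm (PS n) S \<le> 1" "nrm (PS n) R \<le> 1" "0 < e" "infinite I"
    then show "\<exists>T\<subseteq>I. finite T \<and> T \<noteq> {} \<and> nrm (PS n)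
        (S + R - scal (PS n) (inverse (of_nat (card T))) (\<Sum>m\<in>T. cutoff m R)) \<le> 1 + e"
      by (intro cutoff_average[OF n below npq])
  qed
  show ?thesis by (rule M_ideal)
qed

end

subsection \<open>Failure of the 2-ball property above the critical degree\<close>

context ell_pair
begin

text \<open>The surplus exponent \<open>n * q - p\<close> is nonnegative, so that factor of each
  term is absorbed by bounding the coordinate by the norm of \<open>v\<close>.\<close>

lemma power_mem_ell:
  fixes v :: "nat \<Rightarrow> 'k::real_normed_field"
  assumes npq: "p \<le> real n * q" and v: "v \<in> vecs (ell p)"
  shows "(\<lambda>i. v i ^ n) \<in> vecs (ell q)" "nrm (ell q) (\<lambda>i. v i ^ n) \<le> nrm (ell p) v ^ n"
proof -
  have n0: "n > 0" using npq dom.p by (cases n) auto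
  have pow: "(a ^ n) powr q = a powr p * a powr (real n * q - p)" if "a \<ge> 0" for a :: real
    using that n0 by (cases "a = 0") (auto simp: powr_powr powr_realpow[symmetric] powr_add[symmetric])
  have b: "norm (v i ^ n) powr q \<le> nrm (ell p) v powr (real n * q - p) * norm (v i) powr p" for i
  proof -
    have "norm (v i) powr (real n * q - p) \<le> nrm (ell p) v powr (real n * q - p)"
      using dom.ell_coord[OF v] npq by (intro powr_mono2) auto
    then show ?thesis unfolding norm_power pow[OF norm_ge_zero] by (simp add: mult.commute mult_left_mono)
  qed
  have sm: "summable (\<lambda>i. nrm (ell p) v powr (real n * q - p) * norm (v i) powr p)"
    using v by (intro summable_mult) (simp add: dom.mem_ell)
  show m: "(\<lambda>i. v i ^ n) \<in> vecs (ell q)" unfolding cod.mem_ell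
    by (rule summable_comparison_test'[OF sm, of 0]) (use b in simp)
  have "(\<Sum>i. norm (v i ^ n) powr q) \<le> (\<Sum>i. nrm (ell p) v powr (real n * q - p) * norm (v i) powr p)"
    using b sm m unfolding cod.mem_ell by (intro suminf_le) auto
  also have "\<dots> = nrm (ell p) v powr (real n * q - p) * nrm (ell p) v powr p"
    using v by (simp add: dom.nrm_ell_powr suminf_mult dom.mem_ell)
  also have "\<dots> = (nrm (ell p) v ^ n) powr q" by (simp add: pow dom.ell_nonneg)
  finally show "nrm (ell q) (\<lambda>i. v i ^ n) \<le> nrm (ell p) v ^ n"
    by (subst cod.nrm_ell_le_iff[OF m]) (auto simp: dom.ell_nonneg)
qed

text \<open>Coordinate \<open>i\<close> of the value multiplies coordinate \<open>\<phi> i l\<close>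
  of the \<open>l\<close>-th argument over all \<open>l\<close>. Linearity in each argument is then
  formal, and only membership in the target space is left to check.\<close>

lemma multilinear_coordinates:
  fixes a :: "nat \<Rightarrow> 'k::real_normed_field"
  assumes mem: "\<And>xs. length xs = k \<Longrightarrow> set xs \<subseteq> vecs (ell p) \<Longrightarrow> (\<lambda>i. a i * (\<Prod>l<k. (xs ! l) (\<phi> i l))) \<in> vecs (ell q)"
  shows "multilinear k (ell p) (ell q) (\<lambda>xs i. a i * (\<Prod>l<k. (xs ! l) (\<phi> i l)))"
  unfolding multilinear_def
proof (intro allI impI conjI ballI)
  fix xs :: "(nat \<Rightarrow> 'k) list" assume xs: "length xs = k \<and> set xs \<subseteq> vecs (ell p)"
  then show "(\<lambda>i. a i * (\<Prod>l<k. (xs ! l) (\<phi> i l))) \<in> vecs (ell q)" using mem by blast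
  fix j u v c assume j: "j < k"
  have upd: "(\<Prod>l<k. ((xs[j := z]) ! l) (\<phi> i l)) = z (\<phi> i j) * (\<Prod>l\<in>{..<k} - {j}. (xs ! l) (\<phi> i l))" for z i
    using j xs by (subst prod.remove[of _ j]) (auto intro!: prod.cong)
  show "(\<lambda>i. a i * (\<Prod>l<k. ((xs[j := u + v]) ! l) (\<phi> i l))) =
      (\<lambda>i. a i * (\<Prod>l<k. ((xs[j := u]) ! l) (\<phi> i l))) + (\<lambda>i. a i * (\<Prod>l<k. ((xs[j := v]) ! l) (\<phi> i l)))"
    unfolding upd by (auto simp: algebra_simps)
  show "(\<lambda>i. a i * (\<Prod>l<k. ((xs[j := scal (ell p) c u]) ! l) (\<phi> i l))) =
      scal (ell q) c (\<lambda>i. a i * (\<Prod>l<k. ((xs[j := u]) ! l) (\<phi> i l)))"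
    unfolding upd by (auto simp: dom.scal_ell cod.scal_ell algebra_simps)
qed

definition first_power :: "nat \<Rightarrow> (nat \<Rightarrow> 'k::real_normed_field) \<Rightarrow> nat \<Rightarrow> 'k" where
  "first_power k x = (if x \<in> vecs (ell p) then single 0 (x 0 ^ k) else 0)"

text \<open>The coordinate \<open>0\<close> of the image is kept free for \<open>first_power\<close>.\<close>

definition mixed_power :: "'k \<Rightarrow> nat \<Rightarrow> nat \<Rightarrow> (nat \<Rightarrow> 'k::real_normed_field) \<Rightarrow> nat \<Rightarrow> 'k" where
  "mixed_power c k n x = (if x \<in> vecs (ell p) then (\<lambda>i. if i = 0 then 0 else c * (x 0 ^ (k - n) * x i ^ n)) else 0)"

lemma first_power:
  shows "first_power k \<in> polys_w k (ell p :: ('k::real_normed_field, nat \<Rightarrow> 'k) nspace) (ell q)"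
    and "nrm (poly_space k (ell p :: ('k::real_normed_field, nat \<Rightarrow> 'k) nspace) (ell q)) (first_power k) \<le> 1"
proof -
  have "multilinear k (ell p :: ('k, nat \<Rightarrow> 'k) nspace) (ell q) (\<lambda>xs i. (if i = 0 then 1 else 0) * (\<Prod>l<k. (xs ! l) 0))"
  proof (rule multilinear_coordinates)
    fix xs :: "(nat \<Rightarrow> 'k) list"
    have "(\<lambda>i. (if i = 0 then 1 else 0) * (\<Prod>l<k. (xs ! l) 0)) = single 0 (\<Prod>l<k. (xs ! l) 0)" by auto
    then show "(\<lambda>i. (if i = 0 then 1 else 0) * (\<Prod>l<k. (xs ! l) 0)) \<in> vecs (ell q)" by (simp only: cod.single_mem)
  qed
  then have h: "homogeneous_polynomial k (ell p :: ('k, nat \<Rightarrow> 'k) nspace) (ell q) (first_power k)"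
    unfolding homogeneous_polynomial_def by (intro exI conjI) (auto simp: first_power_def fun_eq_iff)
  have b: "nrm (ell q) (first_power k x) \<le> 1" if "x \<in> vecs (ell p)" "nrm (ell p) x \<le> 1" for x :: "nat \<Rightarrow> 'k"
    using that dom.ell_coord[OF that(1), of 0] by (simp add: first_power_def norm_power power_le_one)
  then show "nrm (poly_space k (ell p :: ('k, nat \<Rightarrow> 'k) nspace) (ell q)) (first_power k) \<le> 1"
    by (rule ps_nrm_le)
  have "first_power k \<in> vecs (poly_space k (ell p :: ('k, nat \<Rightarrow> 'k) nspace) (ell q))"
    unfolding mem_poly_space_iff ball_bounded_def using h b by (auto simp: first_power_def)
  moreover have "dom.seq_weakly_continuous (ell q) (first_power k :: (nat \<Rightarrow> 'k) \<Rightarrow> _)"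
    unfolding dom.seq_weakly_continuous_def
  proof (intro allI impI, elim conjE)
    fix X :: "nat \<Rightarrow> nat \<Rightarrow> 'k" and x C assume X: "\<forall>m. X m \<in> vecs (ell p) \<and> nrm (ell p) (X m) \<le> C"
      and x: "x \<in> vecs (ell p)" and lim: "\<forall>i. (\<lambda>m. X m i) \<longlonglongrightarrow> x i"
    have "first_power k (X m) - first_power k x = single 0 (X m 0 ^ k - x 0 ^ k)" for m
      using X x by (auto simp: first_power_def)
    then have "nrm (ell q) (first_power k (X m) - first_power k x) = norm (X m 0 ^ k - x 0 ^ k)" for m
      by (simp only: cod.nrm_single)
    moreover have "(\<lambda>m. norm (X m 0 ^ k - x 0 ^ k)) \<longlonglongrightarrow> 0"
      using tendsto_power[OF lim[rule_format, of 0], of k] by (simp add: tendsto_norm_zero_iff LIM_zero_iff)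
    ultimately show "(\<lambda>m. nrm (ell q) (first_power k (X m) - first_power k x)) \<longlonglongrightarrow> 0" by (simp only:)
  qed
  ultimately show "first_power k \<in> polys_w k (ell p :: ('k::real_normed_field, nat \<Rightarrow> 'k) nspace) (ell q)"
    by (simp add: polys_w_def dom.weakly_continuous_on_bounded_iff_seq)
qed

lemma mixed_power_nrm:
  fixes x :: "nat \<Rightarrow> 'k::real_normed_field"
  assumes npq: "p \<le> real n * q" and x: "x \<in> vecs (ell p)"
  shows "nrm (ell q) (mixed_power c k n x) \<le> norm c * norm (x 0) ^ (k - n) * nrm (ell p) (x - trunc 1 x) ^ n"
proof -
  have n0: "n > 0" using npq dom.p by (cases n) auto
  have t: "x - trunc 1 x \<in> vecs (ell p)" using x by auto
  have "mixed_power c k n x = scal (ell q) (c * x 0 ^ (k - n)) (\<lambda>i. (x - trunc 1 x) i ^ n)"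
    using x n0 by (auto simp: mixed_power_def cod.scal_ell fun_eq_iff mult.assoc)
  then have "nrm (ell q) (mixed_power c k n x) = norm (c * x 0 ^ (k - n)) * nrm (ell q) (\<lambda>i. (x - trunc 1 x) i ^ n)"
    by (simp only: cod.ell_scal_nrm[OF power_mem_ell(1)[OF npq t]])
  also have "\<dots> \<le> norm (c * x 0 ^ (k - n)) * nrm (ell p) (x - trunc 1 x) ^ n"
    by (intro mult_left_mono power_mem_ell(2)[OF npq t]) auto
  finally show ?thesis by (simp add: norm_mult norm_power)
qed

lemma mixed_power_mem:
  assumes npq: "p \<le> real n * q" and nk: "n \<le> k"
  shows "mixed_power c k n \<in> vecs (poly_space k (ell p :: ('k::real_normed_field, nat \<Rightarrow> 'k) nspace) (ell q))"
proof -
  let ?A = "\<lambda>(xs :: (nat \<Rightarrow> 'k) list) i. (if i = 0 then 0 else c) * (\<Prod>l<k. (xs ! l) (if l < k - n then 0 else i))"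
  have prod_split: "(\<Prod>l<k. if l < k - n then a else b) = a ^ (k - n) * b ^ n" for a b :: "'b::comm_monoid_mult"
  proof -
    have "{..<k} \<inter> {l. l < k - n} = {..<k - n}" "{..<k} \<inter> - {l. l < k - n} = {k - n..<k}" by auto
    then show ?thesis using nk by (simp add: prod.If_cases)
  qed
  have "multilinear k (ell p :: ('k, nat \<Rightarrow> 'k) nspace) (ell q) ?A"
  proof (rule multilinear_coordinates)
    fix xs :: "(nat \<Rightarrow> 'k) list" assume xs: "length xs = k" "set xs \<subseteq> vecs (ell p)"
    \<comment> \<open>Dominates all arguments in every coordinate, so the product of different
      sequences is bounded by powers of a single one and \<open>power_mem_ell\<close>
      applies.\<close>
    define v :: "nat \<Rightarrow> real" where "v = (\<Sum>l<k. (\<lambda>i. norm ((xs ! l) i)))"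
    have vi: "v i = (\<Sum>l<k. norm ((xs ! l) i))" for i by (simp add: v_def sum_fun_apply)
    have "(\<lambda>i. norm ((xs ! l) i)) \<in> vecs (ell p)" if "l < k" for l
    proof -
      have "xs ! l \<in> vecs (ell p)" using xs that nth_mem by blast
      then show ?thesis by (simp add: dom.mem_ell)
    qed
    then have v: "v \<in> vecs (ell p)" unfolding v_def by auto
    have bd: "norm (?A xs i) \<le> norm (scal (ell q) (norm c * v 0 ^ (k - n)) (\<lambda>i. v i ^ n) i)" for i
    proof -
      have le: "norm ((xs ! l) j) \<le> v j" if "l < k" for l j
        unfolding vi using that by (intro member_le_sum) auto
      have v0: "v j \<ge> 0" for j unfolding vi by (intro sum_nonneg) auto
      have "(\<Prod>l<k. norm ((xs ! l) (if l < k - n then 0 else i))) \<le> (\<Prod>l<k. if l < k - n then v 0 else v i)"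
        using le by (intro prod_mono) auto
      then have "norm (?A xs i) \<le> norm c * (v 0 ^ (k - n) * v i ^ n)"
        unfolding prod_split[symmetric] norm_mult prod_norm[symmetric] by (intro mult_mono prod_nonneg) auto
      also have "\<dots> = norm (scal (ell q) (norm c * v 0 ^ (k - n)) (\<lambda>i. v i ^ n) i)"
        using v0 by (simp add: cod.scal_ell abs_mult power_abs)
      finally show ?thesis .
    qed
    have "scal (ell q) (norm c * v 0 ^ (k - n)) (\<lambda>i. v i ^ n) \<in> vecs (ell q)"
      by (intro cod.ell.scal_mem power_mem_ell(1)[OF npq v])
    then have sm: "summable (\<lambda>i. norm (scal (ell q) (norm c * v 0 ^ (k - n)) (\<lambda>i. v i ^ n) i) powr q)"
      by (simp only: cod.mem_ell)
    show "(\<lambda>i. ?A xs i) \<in> vecs (ell q)" unfolding cod.mem_ell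
    proof (rule summable_comparison_test'[OF sm, of 0])
      fix i :: nat
      show "norm (norm (?A xs i) powr q) \<le> norm (scal (ell q) (norm c * v 0 ^ (k - n)) (\<lambda>i. v i ^ n) i) powr q"
        using bd[of i] cod.p by (simp only: real_norm_def abs_of_nonneg[OF powr_ge_zero]) (intro powr_mono2, auto)
    qed
  qed
  then have h: "homogeneous_polynomial k (ell p :: ('k, nat \<Rightarrow> 'k) nspace) (ell q) (mixed_power c k n)"
    unfolding homogeneous_polynomial_def
  proof (intro exI conjI ballI)
    fix x :: "nat \<Rightarrow> 'k" assume x: "x \<in> vecs (ell p)"
    have "(\<Prod>l<k. (replicate k x ! l) (if l < k - n then 0 else i)) = x 0 ^ (k - n) * x i ^ n" for i
      unfolding prod_split[symmetric] by (intro prod.cong) auto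
    then show "mixed_power c k n x = ?A (replicate k x)" using x by (simp add: mixed_power_def fun_eq_iff)
  qed
  have "nrm (ell q) (mixed_power c k n x) \<le> norm c" if x: "x \<in> vecs (ell p)" "nrm (ell p) x \<le> 1" for x :: "nat \<Rightarrow> 'k"
  proof -
    have "norm (x 0) ^ (k - n) \<le> 1" "nrm (ell p) (x - trunc 1 x) ^ n \<le> 1"
      using dom.ell_coord[OF x(1), of 0] dom.nrm_tail_le[OF x(1), of 1] x(2)
      by (auto intro!: power_le_one simp: dom.ell_nonneg)
    then have "norm c * norm (x 0) ^ (k - n) * nrm (ell p) (x - trunc 1 x) ^ n \<le> norm c * 1 * 1"
      by (intro mult_mono) (auto simp: dom.ell_nonneg)
    then show ?thesis using mixed_power_nrm[OF npq x(1), of c k] by simp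
  qed
  then show ?thesis unfolding mem_poly_space_iff ball_bounded_def using h by (auto simp: mixed_power_def)
qed

text \<open>The unit vectors are weakly null, but this polynomial maps them to unit vectors. They
  start at index 1 because \<open>mixed_power\<close> leaves coordinate 0 of its values
  empty.\<close>

lemma not_all_weakly_continuous:
  assumes npq: "p \<le> real n * q"
  shows "polys_w n (ell p :: ('k::real_normed_field, nat \<Rightarrow> 'k) nspace) (ell q) \<noteq> vecs (PS n)"
proof
  assume "polys_w n (ell p :: ('k, nat \<Rightarrow> 'k) nspace) (ell q) = vecs (PS n)"
  then have R: "mixed_power 1 n n \<in> polys_w n (ell p :: ('k, nat \<Rightarrow> 'k) nspace) (ell q)"
    using mixed_power_mem[OF npq order_refl] by blast
  have n0: "n > 0" using npq dom.p by (cases n) auto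
  have "(\<lambda>m. single (Suc m) (1::'k) i) \<longlonglongrightarrow> 0 i" for i
    by (intro tendsto_eventually eventually_mono[OF eventually_gt_at_top[of i]]) auto
  then have "(\<lambda>m. nrm (ell q) (mixed_power 1 n n (single (Suc m) (1::'k)) - mixed_power 1 n n 0)) \<longlonglongrightarrow> 0"
    by (intro polys_w_seq[OF R, of _ 1]) auto
  moreover have "mixed_power 1 n n (single (Suc m) (1::'k)) - mixed_power 1 n n 0 = single (Suc m) 1" for m
    using n0 by (auto simp: mixed_power_def fun_eq_iff)
  then have "nrm (ell q) (mixed_power 1 n n (single (Suc m) (1::'k)) - mixed_power 1 n n 0) = 1" for m
    by (simp only: cod.nrm_single norm_one)
  ultimately show False by (simp add: LIMSEQ_const_iff)
qed

lemma two_coordinates_le_nrm: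
  fixes v :: "nat \<Rightarrow> 'k::real_normed_field"
  assumes v: "v \<in> vecs (ell q)" and ij: "i \<noteq> j"
  shows "pnorm2 q (norm (v i)) (norm (v j)) \<le> nrm (ell q) v"
proof -
  have "pnorm2 q (norm (v i)) (norm (v j)) = nrm (ell q) (single i (v i) + single j (v j))"
    using ij by (subst cod.nrm_disjoint) auto
  also have "\<dots> \<le> nrm (ell q) v" using ij by (intro cod.ell_mono(2)[OF v]) auto
  finally show ?thesis .
qed

text \<open>
  With \<open>S = first_power k\<close> and a suitable \<open>R = mixed_power c k n\<close> the balls of radius 1 around
  \<open>R + S\<close> and \<open>R - S\<close> both contain \<open>R\<close> and meet the ideal in \<open>S\<close> and \<open>- S\<close>. On \<open>t e\<^sub>0 + s e\<^sub>m\<close>, where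
  \<open>R\<close> attains its norm with \<open>t > 0\<close>, an element of the ideal cannot compensate \<open>R\<close> as \<open>m \<rightarrow> \<infinity>\<close>,
  and it increases the effect of \<open>S\<close> or of \<open>- S\<close>.
\<close>

theorem not_semi_M_ideal_above:
  assumes npq: "p \<le> real n * q" and nk: "n < k"
  shows "\<not> semi_M_ideal (polys_w k (ell p) (ell q)) (poly_space k (ell p :: ('k::real_normed_field, nat \<Rightarrow> 'k) nspace) (ell q))"
proof
  let ?X = "poly_space k (ell p :: ('k, nat \<Rightarrow> 'k) nspace) (ell q)"
  let ?J = "polys_w k (ell p :: ('k, nat \<Rightarrow> 'k) nspace) (ell q)"
  assume semi: "semi_M_ideal ?J ?X"
  interpret X: normed_nspace ?X by (rule normed_poly_space)
  have n0: "n > 0" using npq dom.p by (cases n) auto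
  define \<sigma> where "\<sigma> = (\<lambda>t::real. (1 - t powr p) powr (1 / p))"
  \<comment> \<open>If \<open>nrm (ell p) x \<le> 1\<close> and \<open>norm (x 0) = t\<close>, the
    rest of \<open>x\<close> has norm at most \<open>\<sigma> t\<close>; so \<open>\<phi> t\<close>
    bounds \<open>mixed_power 1 k n x\<close>. Its maximum over \<open>t\<close> normalises
    \<open>R\<close>.\<close>
  define \<phi> where "\<phi> = (\<lambda>t::real. t ^ (k - n) * \<sigma> t ^ n)"
  have "continuous_on {0..1} \<phi>" unfolding \<phi>_def \<sigma>_def
    using dom.p by (intro continuous_intros continuous_on_powr') (auto simp: powr_le_one_le intro!: powr_le1)
  then obtain t where t: "t \<in> {0..1}" "\<And>r. r \<in> {0..1} \<Longrightarrow> \<phi> r \<le> \<phi> t"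
    using continuous_attains_sup[of "{0..1::real}" \<phi>] by auto
  have half: "(1 / 2) powr p < (1::real)" using dom.p powr_less_mono2[of p "1/2" 1] by simp
  have "\<phi> (1 / 2) > 0" unfolding \<phi>_def \<sigma>_def using half by (intro mult_pos_pos zero_less_power) auto
  then have \<phi>t: "\<phi> t > 0" using t(2)[of "1/2"] by simp
  \<comment> \<open>Here \<open>n < k\<close> matters strictly: \<open>\<phi> 0 = 0\<close>, so the
    maximiser is positive and \<open>S\<close> does not vanish where \<open>R\<close> attains its
    norm.\<close>
  have t0: "t > 0" using \<phi>t t(1) nk by (cases "t = 0") (auto simp: \<phi>_def power_0_left)
  have tp: "t powr p \<le> 1" using t(1) dom.p powr_mono2[of p t 1] by simp
  have \<sigma>p: "\<sigma> r powr p = 1 - r powr p" if "r powr p \<le> 1" for r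
    unfolding \<sigma>_def using that by (intro dom.powr_inverse_cancel) simp
  define s where "s = \<sigma> t"
  have s: "s \<ge> 0" "s powr p = 1 - t powr p" using \<sigma>p[OF tp] by (auto simp: s_def \<sigma>_def)
  define c :: 'k where "c = of_real (inverse (\<phi> t))"
  have nc: "norm c = inverse (\<phi> t)" unfolding c_def using \<phi>t by (subst norm_of_real) simp
  define S :: "(nat \<Rightarrow> 'k) \<Rightarrow> nat \<Rightarrow> 'k" where "S = first_power k"
  define R :: "(nat \<Rightarrow> 'k) \<Rightarrow> nat \<Rightarrow> 'k" where "R = mixed_power c k n"
  have SJ: "S \<in> ?J" "nrm ?X S \<le> 1" unfolding S_def using first_power by auto
  have SX: "S \<in> vecs ?X" using SJ by (simp add: polys_w_def)
  have RX: "R \<in> vecs ?X" unfolding R_def by (rule mixed_power_mem[OF npq less_imp_le[OF nk]])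
  have R1: "nrm ?X R \<le> 1"
  proof (rule ps_nrm_le)
    fix x :: "nat \<Rightarrow> 'k" assume x: "x \<in> vecs (ell p)" "nrm (ell p) x \<le> 1"
    define r where "r = norm (x 0)"
    have r: "r \<in> {0..1}" using dom.ell_coord[OF x(1), of 0] x(2) by (auto simp: r_def)
    have rp: "r powr p \<le> 1" using r dom.p powr_mono2[of p r 1] by simp
    have "trunc 1 x = single 0 (x 0)" by auto
    then have "nrm (ell p) (trunc 1 x) = r" by (simp only: dom.nrm_single r_def)
    moreover have "nrm (ell p) x powr p \<le> 1 powr p" using x(2) dom.p by (intro powr_mono2) (auto simp: dom.ell_nonneg)
    ultimately have "nrm (ell p) (x - trunc 1 x) powr p \<le> \<sigma> r powr p"
      using dom.nrm_split[OF x(1), of 1] \<sigma>p[OF rp] by simp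
    then have "nrm (ell p) (x - trunc 1 x) \<le> \<sigma> r" by (subst (asm) dom.powr_p_le_iff) (auto simp: dom.ell_nonneg \<sigma>_def)
    then have "norm c * r ^ (k - n) * nrm (ell p) (x - trunc 1 x) ^ n \<le> norm c * r ^ (k - n) * \<sigma> r ^ n"
      using r by (intro mult_left_mono power_mono) (auto simp: dom.ell_nonneg)
    also have "\<dots> = inverse (\<phi> t) * \<phi> r" by (simp add: nc \<phi>_def)
    also have "\<dots> \<le> inverse (\<phi> t) * \<phi> t" using t(2)[OF r] \<phi>t by (intro mult_left_mono) auto
    also have "\<dots> = 1" using \<phi>t by simp
    finally show "nrm (ell q) (R x) \<le> 1" using mixed_power_nrm[OF npq x(1), of c k] unfolding R_def r_def by simp
  qed
  have uS: "- S \<in> ?J"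
    unfolding X.uminus_eq_scal[OF SX] by (rule weakly_continuous_scal[OF SJ(1)])
  \<comment> \<open>Half the excess over 1 of the norm of a vector with entries \<open>t ^ k\<close>
    and 1. One half is the enlargement of the balls, the other absorbs the error at the chosen
    \<open>m\<close>.\<close>
  define \<epsilon> where "\<epsilon> = (pnorm2 q (t ^ k) 1 - 1) / 2"
  have \<epsilon>: "\<epsilon> > 0"
  proof -
    have "(1::real) = 1 powr (1 / q)" by simp
    also have "\<dots> < ((t ^ k) powr q + 1 powr q) powr (1 / q)" using cod.p t0 by (intro powr_less_mono2) auto
    finally show ?thesis by (simp add: \<epsilon>_def pnorm2_def)
  qed
  have "closed_ball ?X (R + S) 1 \<inter> closed_ball ?X (R - S) 1 \<noteq> {}"
    using RX SX SJ by (auto simp: closed_ball_def intro!: exI[of _ R])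
  moreover have "closed_ball ?X (R + S) 1 \<inter> ?J \<noteq> {}"
    using RX R1 SX SJ by (auto simp: closed_ball_def intro!: exI[of _ S])
  moreover have "closed_ball ?X (R - S) 1 \<inter> ?J \<noteq> {}"
    using RX R1 SX uS by (auto simp: closed_ball_def intro!: exI[of _ "- S"])
  moreover have "R + S \<in> vecs ?X" "R - S \<in> vecs ?X" using RX SX by auto
  ultimately have "closed_ball ?X (R + S) (1 + \<epsilon>) \<inter> closed_ball ?X (R - S) (1 + \<epsilon>) \<inter> ?J \<noteq> {}"
    using semi \<epsilon> unfolding semi_M_ideal_def by (metis zero_less_one)
  then obtain T where T: "T \<in> ?J" "nrm ?X (T - (R + S)) \<le> 1 + \<epsilon>" "nrm ?X (T - (R - S)) \<le> 1 + \<epsilon>"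
    by (auto simp: closed_ball_def)
  have TX: "T \<in> vecs ?X" using T(1) by (simp add: polys_w_def)
  define x0 :: "nat \<Rightarrow> 'k" where "x0 = single 0 (of_real t)"
  define x :: "nat \<Rightarrow> nat \<Rightarrow> 'k" where "x = (\<lambda>m. x0 + single (Suc m) (of_real s))"
  have x0m: "x0 \<in> vecs (ell p)" by (simp add: x0_def)
  have xm: "x m \<in> vecs (ell p)" for m unfolding x_def x0_def by (intro dom.ell_add(1)) auto
  have x1: "nrm (ell p) (x m) \<le> 1" for m
  proof -
    have "nrm (ell p) (x m) = pnorm2 p (norm (of_real t :: 'k)) (norm (of_real s :: 'k))"
      unfolding x_def x0_def by (subst dom.nrm_disjoint) auto
    also have "\<dots> = 1" unfolding pnorm2_def using t0 s by simp
    finally show ?thesis by simp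
  qed
  have "(\<lambda>m. x m i) \<longlonglongrightarrow> x0 i" for i
    by (intro tendsto_eventually eventually_mono[OF eventually_gt_at_top[of i]]) (auto simp: x_def)
  then have lim: "(\<lambda>m. nrm (ell q) (T (x m) - T x0)) \<longlonglongrightarrow> 0"
    by (rule polys_w_seq[OF T(1) xm x1 x0m])
  define \<tau> where "\<tau> = T x0 0"
  have Tm: "T (x m) - T x0 \<in> vecs (ell q)" "T x0 \<in> vecs (ell q)" for m
    using ps_mem[OF TX] xm x0m by (auto intro!: cod.ell.diff_mem)
  have l0: "(\<lambda>m. T (x m) 0 - \<tau>) \<longlonglongrightarrow> 0"
    by (rule Lim_null_comparison[OF _ lim]) (use cod.ell_coord[OF Tm(1), of _ 0] in \<open>auto simp: \<tau>_def\<close>)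
  have "(\<lambda>i. T x0 (Suc i)) \<longlonglongrightarrow> 0"
  proof (rule Lim_null_comparison)
    show "(\<lambda>i. nrm (ell q) (T x0 - trunc (Suc i) (T x0))) \<longlonglongrightarrow> 0"
      using LIMSEQ_Suc[OF cod.tail_null[OF Tm(2)]] .
    show "\<forall>\<^sub>F i in sequentially. norm (T x0 (Suc i)) \<le> nrm (ell q) (T x0 - trunc (Suc i) (T x0))"
    proof (rule always_eventually, rule allI)
      fix i
      have "T x0 - trunc (Suc i) (T x0) \<in> vecs (ell q)" using Tm(2) by auto
      from cod.ell_coord[OF this, of "Suc i"] show "norm (T x0 (Suc i)) \<le> nrm (ell q) (T x0 - trunc (Suc i) (T x0))" by simp
    qed
  qed
  moreover have "(\<lambda>m. T (x m) (Suc m) - T x0 (Suc m)) \<longlonglongrightarrow> 0"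
    by (rule Lim_null_comparison[OF _ lim]) (use cod.ell_coord[OF Tm(1)] in fastforce)
  ultimately have l1: "(\<lambda>m. T (x m) (Suc m)) \<longlonglongrightarrow> 0" using tendsto_add by fastforce
  have "\<forall>\<^sub>F m in sequentially. norm (T (x m) 0 - \<tau>) + norm (T (x m) (Suc m)) < \<epsilon>"
    using tendsto_add[OF tendsto_norm[OF l0] tendsto_norm[OF l1]] \<epsilon> by (intro order_tendstoD(2)) auto
  then obtain m where m: "norm (T (x m) 0 - \<tau>) + norm (T (x m) (Suc m)) < \<epsilon>"
    using eventually_happens'[OF sequentially_bot] by blast
  have xv: "x m 0 = of_real t" "x m (Suc m) = of_real s" by (auto simp: x_def x0_def)
  have Sx: "S (x m) 0 = of_real t ^ k" "S (x m) (Suc m) = 0" using xm xv by (auto simp: S_def first_power_def)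
  have "c * (of_real t ^ (k - n) * of_real s ^ n) = of_real (inverse (\<phi> t) * \<phi> t)"
    unfolding c_def \<phi>_def s_def by simp
  then have Rx: "R (x m) 0 = 0" "R (x m) (Suc m) = 1" using xm xv \<phi>t by (auto simp: R_def mixed_power_def)
  \<comment> \<open>\<open>V\<close> stands for \<open>T - (R + S)\<close> or
    \<open>T - (R - S)\<close>, with \<open>b\<close> the sign of \<open>S\<close>. At
    \<open>x m\<close>, \<open>S\<close> acts in coordinate 0, where \<open>T\<close> is nearly
    \<open>\<tau>\<close>, and \<open>R\<close> in coordinate \<open>Suc m\<close>, where
    \<open>T\<close> is nearly 0.\<close>
  have key: "pnorm2 q (norm (\<tau> - b * of_real t ^ k)) 1 < 1 + 2 * \<epsilon>"
    if V: "V \<in> vecs ?X" "nrm ?X V \<le> 1 + \<epsilon>" "V (x m) 0 = T (x m) 0 - b * of_real t ^ k" "V (x m) (Suc m) = T (x m) (Suc m) - 1"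
    for V b
  proof -
    have "pnorm2 q (norm (V (x m) 0)) (norm (V (x m) (Suc m))) \<le> nrm (ell q) (V (x m))"
      by (rule two_coordinates_le_nrm[OF ps_mem[OF V(1) xm]]) simp
    also have "\<dots> \<le> 1 + \<epsilon>" using ps_nrm_ball[OF V(1) xm x1] V(2) by (rule order_trans)
    finally have A: "pnorm2 q (norm (V (x m) 0)) (norm (V (x m) (Suc m))) \<le> 1 + \<epsilon>" .
    have "\<bar>norm (\<tau> - b * of_real t ^ k) - norm (V (x m) 0)\<bar> \<le> norm (\<tau> - T (x m) 0)"
      using norm_triangle_ineq3[of "\<tau> - b * of_real t ^ k" "V (x m) 0"] by (simp add: V(3))
    moreover have "\<bar>1 - norm (V (x m) (Suc m))\<bar> \<le> norm (T (x m) (Suc m))"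
      using norm_triangle_ineq3[of 1 "1 - T (x m) (Suc m)"] by (simp add: V(4) norm_minus_commute)
    moreover have "pnorm2 q (norm (\<tau> - b * of_real t ^ k)) 1 \<le> pnorm2 q (norm (V (x m) 0)) (norm (V (x m) (Suc m)))
        + \<bar>norm (\<tau> - b * of_real t ^ k) - norm (V (x m) 0)\<bar> + \<bar>1 - norm (V (x m) (Suc m))\<bar>"
      by (rule cod.pnorm2_lipschitz) auto
    ultimately show ?thesis using A m by (simp add: norm_minus_commute)
  qed
  have k1: "pnorm2 q (norm (\<tau> - 1 * of_real t ^ k)) 1 < 1 + 2 * \<epsilon>"
    by (rule key[OF _ T(2)]) (use TX RX SX Sx Rx in auto)
  have k2: "pnorm2 q (norm (\<tau> - (-1) * of_real t ^ k)) 1 < 1 + 2 * \<epsilon>"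
    by (rule key[OF _ T(3)]) (use TX RX SX Sx Rx in auto)
  \<comment> \<open>Moving \<open>\<tau>\<close> by \<open>t ^ k\<close> in opposite directions
    gives two numbers at distance \<open>2 * t ^ k\<close>, so one of them has norm at least
    \<open>t ^ k\<close>, whatever \<open>T\<close> is.\<close>
  have "2 * t ^ k = norm ((\<tau> - (-1) * of_real t ^ k) - (\<tau> - 1 * of_real t ^ k))"
    using t0 by (simp add: norm_mult norm_power)
  also have "\<dots> \<le> norm (\<tau> - (-1) * of_real t ^ k) + norm (\<tau> - 1 * of_real t ^ k)" by (rule norm_triangle_ineq4)
  finally have "t ^ k \<le> norm (\<tau> - (-1) * of_real t ^ k) \<or> t ^ k \<le> norm (\<tau> - 1 * of_real t ^ k)" by linarith
  then have "pnorm2 q (t ^ k) 1 < 1 + 2 * \<epsilon>"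
  proof
    assume "t ^ k \<le> norm (\<tau> - (-1) * of_real t ^ k)"
    then have "pnorm2 q (t ^ k) 1 \<le> pnorm2 q (norm (\<tau> - (-1) * of_real t ^ k)) 1"
      using t0 by (intro cod.pnorm2_mono) auto
    then show ?thesis using k2 by linarith
  next
    assume "t ^ k \<le> norm (\<tau> - 1 * of_real t ^ k)"
    then have "pnorm2 q (t ^ k) 1 \<le> pnorm2 q (norm (\<tau> - 1 * of_real t ^ k)) 1"
      using t0 by (intro cod.pnorm2_mono) auto
    then show ?thesis using k1 by linarith
  qed
  then show False by (simp add: \<epsilon>_def field_simps)
qed

subsection \<open>The critical degree\<close>

text \<open>Every \<open>k \<ge> max 1 (p / q)\<close> satisfies the condition under
  \<open>LEAST\<close>, by \<open>not_all_weakly_continuous\<close>, so the minimum is attained, and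
  minimality gives the second claim. If \<open>n * q < p\<close> held,
  \<open>weakly_continuous_if_subcritical\<close> would make degree \<open>n\<close> weakly
  continuous as well.\<close>

lemma critical_degree:
  fixes E :: "('k::{real_normed_field,heine_borel}, nat \<Rightarrow> 'k) nspace"
  defines "E \<equiv> ell p" and "F \<equiv> ell q :: ('k, nat \<Rightarrow> 'k) nspace"
  defines "n \<equiv> critical_degree E F"
  shows "1 \<le> n" "all_weakly_continuous_below TYPE('k) n" "p \<le> real n * q"
proof -
  let ?C = "\<lambda>k. 1 \<le> k \<and> polys_w k E F \<noteq> vecs (poly_space k E F)"
  obtain k :: nat where k: "real k \<ge> max 1 (p / q)" using real_arch_simple by blast
  then have "p \<le> real k * q" using cod.p by (simp add: pos_divide_le_eq)
  then have "?C k" using not_all_weakly_continuous[of k, where 'k = 'k] k by (simp add: E_def F_def)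
  then have n: "?C n" unfolding n_def critical_degree_def by (rule LeastI)
  then show n1: "1 \<le> n" by simp
  have "\<not> ?C k" if "k < n" for k
    using that unfolding n_def critical_degree_def by (rule not_less_Least)
  then show below: "all_weakly_continuous_below TYPE('k) n"
    unfolding all_weakly_continuous_below_def E_def F_def by blast
  show "p \<le> real n * q"
  proof (rule ccontr)
    assume "\<not> ?thesis"
    then have "real n * q < p" by simp
    then have "vecs (poly_space n E F) \<subseteq> polys_w n E F"
      using weakly_continuous_if_subcritical[OF n1 below] unfolding E_def F_def by blast
    moreover have "polys_w n E F \<subseteq> vecs (poly_space n E F)" by (auto simp: polys_w_def)
    ultimately show False using n by blast
  qed
qed

end

theorem theorem3p2:
  fixes p q :: real
  assumes "1 < p" and "1 < q"
  shows "(let E = ell p :: (real, nat \<Rightarrow> real) nspace; F = ell q; n = critical_degree E F in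
            M_ideal (polys_w n E F) (poly_space n E F) \<and>
            (\<forall>k>n. \<not> semi_M_ideal (polys_w k E F) (poly_space k E F))) \<and>
         (let E = ell p :: (complex, nat \<Rightarrow> complex) nspace; F = ell q; n = critical_degree E F in
            M_ideal (polys_w n E F) (poly_space n E F) \<and>
            (\<forall>k>n. \<not> semi_M_ideal (polys_w k E F) (poly_space k E F)))"
proof -
  interpret ell_pair p q using assms by unfold_locales
  show ?thesis unfolding Let_def
    by (intro conjI allI impI M_ideal_critical critical_degree not_semi_M_ideal_above[OF critical_degree(3)])
qed

end
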